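(* Let $(\Gamma,\alpha)$ be a cyclic expansive system on a compact connected abelian group $\Gamma$ whose associated polynomial $f=a_0+\dots+a_dx^d$ is irreducible. Let $\Gamma_0\subset\Gamma$ be the path component of the identity and $\Omega$ the homoclinic group. The following are equivalent: (1) $\Omega\cap\Gamma_0\ne\{0\}$; (2) $\Omega\subset\Gamma_0$; (3) $f(x)$ or $x^df(1/x)$ is monic up to a sign (i.e. $a_d=\pm1$ or $a_0=\pm1$).
   Context: Cyclic: the Pontryagin dual of $\Gamma$ is a cyclic module over $\mathbb Z[x,x^{-1}]$ ($x$ acting via $\alpha$); its annihilator is generated by the associated polynomial $f\in\mathbb Z[x]$, primitive with $a_0\ne0$, $a_d>0$. Expansive: some neighbourhood $U$ of $0$ with $\bigcap_{n\in\mathbb Z}\alpha^n(U)=\{0\}$. Homoclinic group: $\Omega=\{g\in\Gamma:\alpha^n(g)\to0\text{ as }n\to\pm\infty\}$. *)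

theory Defs
  imports "HOL-Analysis.Analysis" "HOL-Computational_Algebra.Computational_Algebra"
begin

definition apow :: "('a \<Rightarrow> 'a) \<Rightarrow> int \<Rightarrow> 'a \<Rightarrow> 'a" where
  "apow \<alpha> n = (if n \<ge> 0 then \<alpha> ^^ nat n else (inv \<alpha>) ^^ nat (- n))"

definition cont_aut :: "('a::topological_ab_group_add \<Rightarrow> 'a) \<Rightarrow> bool" where
  "cont_aut \<alpha> \<longleftrightarrow> bij \<alpha> \<and> (\<forall>a b. \<alpha> (a + b) = \<alpha> a + \<alpha> b)
     \<and> continuous_on UNIV \<alpha> \<and> continuous_on UNIV (inv \<alpha>)"

definition is_char :: "('a::topological_ab_group_add \<Rightarrow> complex) \<Rightarrow> bool" where
  "is_char \<kappa> \<longleftrightarrow> continuous_on UNIV \<kappa> \<and> (\<forall>a b. \<kappa> (a + b) = \<kappa> a * \<kappa> b)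
     \<and> (\<forall>a. norm (\<kappa> a) = 1)"

text \<open>Module action of the Laurent polynomial  x^k * p(x)  (p in Z[x], k in Z) on a character,
  x acting via the dual automorphism: (x . chi)(g) = kappa(alpha g).  The dual group is written
  multiplicatively, so integer coefficients act as integer powers.\<close>
definition lact :: "('a \<Rightarrow> 'a) \<Rightarrow> int poly \<Rightarrow> int \<Rightarrow> ('a \<Rightarrow> complex) \<Rightarrow> 'a \<Rightarrow> complex" where
  "lact \<alpha> p k \<kappa> = (\<lambda>g. \<Prod>i\<le>degree p. (\<kappa> (apow \<alpha> (int i + k) g)) powi (coeff p i))"

text \<open>The dual is a cyclic Z[x,x^-1]-module, generated by some character chi, whose annihilator
  is the ideal generated by f.  Every Laurent polynomial is x^k p with p in Z[x]; for f primitive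
  with nonzero constant term, x^k p lies in f Z[x,x^-1] iff f divides p in Z[x], and
  x^k p annihilates chi iff p does.\<close>
definition cyclic_with_poly :: "('a::topological_ab_group_add \<Rightarrow> 'a) \<Rightarrow> int poly \<Rightarrow> bool" where
  "cyclic_with_poly \<alpha> f \<longleftrightarrow> (\<exists>\<kappa>. is_char \<kappa>
      \<and> (\<forall>\<psi>. is_char \<psi> \<longrightarrow> (\<exists>p k. \<psi> = lact \<alpha> p k \<kappa>))
      \<and> (\<forall>p. lact \<alpha> p 0 \<kappa> = (\<lambda>_. 1) \<longleftrightarrow> f dvd p))"

definition expansive :: "('a::topological_ab_group_add \<Rightarrow> 'a) \<Rightarrow> bool" where
  "expansive \<alpha> \<longleftrightarrow> (\<exists>U. open U \<and> 0 \<in> U \<and> (\<Inter>n::int. apow \<alpha> n ` U) = {0})"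

definition homoclinic :: "('a::topological_ab_group_add \<Rightarrow> 'a) \<Rightarrow> 'a set" where
  "homoclinic \<alpha> = {g. ((\<lambda>n::nat. apow \<alpha> (int n) g) \<longlonglongrightarrow> 0)
                      \<and> ((\<lambda>n::nat. apow \<alpha> (- int n) g) \<longlonglongrightarrow> 0)}"

end

theory Submission
  imports Defs
begin

text \<open>
  Characters separate the points of a compact abelian group: by averaging translates one gets an
  invariant mean, hence a convolution algebra of continuous functions. The normalized convolution
  powers of a self-adjoint function converge to an idempotent; nonzero idempotents
  have squared norm at least one, so below each there is a minimal one, and a minimal one is a multiple of a
  character.

  Consequently \<open>g\<close> is determined by the orbit \<open>\<kappa> (\<alpha>\<^sup>n g)\<close> of its value under the generating character,
  and \<open>\<Gamma>\<close> becomes the group of sequences \<open>w\<close> of reals modulo one with \<open>f(\<sigma>) w\<close> integral, \<open>\<sigma>\<close> being the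
  shift. Expansiveness means that \<open>f\<close> has no zero on the unit circle. Homoclinic points are the null
  sequences \<open>u\<close>, for which \<open>f(\<sigma>) u\<close> is integral and finitely supported; lifting paths shows that the
  path component of the identity consists of the genuine solutions of \<open>f(\<sigma>) w = 0\<close>. A homoclinic
  \<open>u\<close> therefore lies in the path component iff \<open>f(\<sigma>) m = - f(\<sigma>) u\<close> has an integral solution \<open>m\<close>. If
  \<open>f\<close> has a unit as leading or constant coefficient, it can be solved recursively. If it has
  neither, Fatou's lemma on rational power series with integer coefficients shows that \<open>m\<close> is
  finitely supported, so that \<open>u + m\<close> is a bounded solution of the homogeneous equation, hence zero.
\<close>


section \<open>Invariant means on compact abelian groups\<close>

text \<open>Recognising points is half of the work; the other half is producing them. A path to a
  point lifting a genuine solution \<open>w\<close> runs through points lifting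
  \<open>s * w\<close>, and (2) gives (1) only once \<Omega> is known to be nonzero, for which the
  decaying solution of \<open>f(\<sigma>) w = \<delta>\<close>, with \<delta> the indicator of zero,
  has to be realised in \<Gamma>. So the coordinate map must be onto the sequences \<open>w\<close>
  with \<open>f(\<sigma>) w\<close> integral. It is, because only multiples of \<open>f\<close>
  annihilate the generator, so that every relation between coordinates that holds on \<Gamma> also
  holds at the wanted sequence; comparing means of peaked trigonometric polynomials turns this into
  existence.

  Expansiveness serves twice: absence of zeros on the unit circle makes \<open>f(\<sigma>)\<close>
  surjective on exponentially decaying sequences and injective on bounded ones. In the Fatou step
  the two tails of \<open>m\<close> obey different recurrences: to the right the reversed polynomial
  acts, to the left \<open>f\<close> itself, so a nonunit is required at either end of
  \<open>f\<close>.\<close>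

definition avg :: "'a::ab_group_add list \<Rightarrow> ('a \<Rightarrow> 'b::real_vector) \<Rightarrow> 'a \<Rightarrow> 'b" where
  "avg xs \<phi> x = (1 / real (length xs)) *\<^sub>R (\<Sum>a\<leftarrow>xs. \<phi> (x + a))"

text \<open>The value is approximated uniformly by finite averages of translates, so invariance and
  positivity come for free. In an abelian group such a value is unique, which justifies the
  \<open>THE\<close> in \<open>mean\<close>.\<close>

definition has_mean :: "('a::ab_group_add \<Rightarrow> 'b::real_normed_vector) \<Rightarrow> 'b \<Rightarrow> bool" where
  "has_mean \<phi> c \<longleftrightarrow> (\<forall>\<epsilon>>0. \<exists>xs. xs \<noteq> [] \<and> (\<forall>x. norm (avg xs \<phi> x - c) \<le> \<epsilon>))"

definition mean :: "('a::ab_group_add \<Rightarrow> complex) \<Rightarrow> complex" where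
  "mean \<phi> = (THE c. has_mean \<phi> c)"

definition sumset :: "'a::ab_group_add list \<Rightarrow> 'a list \<Rightarrow> 'a list" where
  "sumset xs ys = concat (map (\<lambda>x. map (\<lambda>y. x + y) ys) xs)"

lemma sumset_Nil_iff [simp]: "sumset xs ys = [] \<longleftrightarrow> xs = [] \<or> ys = []"
  by (induction xs) (auto simp: sumset_def)

lemma length_sumset [simp]: "length (sumset xs ys) = length xs * length ys"
  by (induction xs) (auto simp: sumset_def)

lemma sum_list_sumset:
  fixes f :: "'a::ab_group_add \<Rightarrow> 'b::comm_monoid_add"
  shows "(\<Sum>a\<leftarrow>sumset xs ys. f a) = (\<Sum>a\<leftarrow>xs. \<Sum>b\<leftarrow>ys. f (a + b))"
  by (induction xs) (auto simp: sumset_def o_def)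

lemma scaleR_sum_list:
  fixes f :: "'a \<Rightarrow> 'b::real_vector"
  shows "c *\<^sub>R (\<Sum>a\<leftarrow>xs. f a) = (\<Sum>a\<leftarrow>xs. c *\<^sub>R f a)"
  by (induction xs) (auto simp: scaleR_add_right)

lemma avg_avg: "avg xs (avg ys \<phi>) = avg (sumset xs ys) \<phi>"
  unfolding avg_def
  by (auto simp: sum_list_sumset scaleR_sum_list[symmetric] add.assoc fun_eq_iff)

lemma sum_list_commute:
  fixes f :: "'a \<Rightarrow> 'b \<Rightarrow> 'c::comm_monoid_add"
  shows "(\<Sum>a\<leftarrow>xs. \<Sum>b\<leftarrow>ys. f a b) = (\<Sum>b\<leftarrow>ys. \<Sum>a\<leftarrow>xs. f a b)"
  by (induction xs) (auto simp: sum_list_addf)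

lemma avg_commute: "avg xs (avg ys \<phi>) = avg ys (avg xs \<phi>)"
proof -
  have "(\<Sum>a\<leftarrow>xs. \<Sum>b\<leftarrow>ys. \<phi> (x + (a + b))) = (\<Sum>b\<leftarrow>ys. \<Sum>a\<leftarrow>xs. \<phi> (x + (b + a)))" for x
    by (subst sum_list_commute) (simp add: add.commute)
  then show ?thesis
    by (simp add: avg_avg) (simp add: avg_def sum_list_sumset mult.commute fun_eq_iff)
qed

lemma avg_add: "avg xs (\<lambda>x. \<phi> x + \<psi> x) x = avg xs \<phi> x + avg xs \<psi> x"
  by (simp add: avg_def sum_list_addf scaleR_add_right)

lemma avg_diff: "avg xs (\<lambda>x. \<phi> x - \<psi> x) x = avg xs \<phi> x - avg xs \<psi> x"
  by (simp add: avg_def sum_list_subtractf scaleR_diff_right)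

lemma avg_const [simp]: "xs \<noteq> [] \<Longrightarrow> avg xs (\<lambda>_. c) x = c"
proof -
  assume "xs \<noteq> []"
  have "(\<Sum>a\<leftarrow>ys. c) = real (length ys) *\<^sub>R c" for ys :: "'a list"
    by (induction ys) (auto simp: scaleR_add_left)
  with \<open>xs \<noteq> []\<close> show ?thesis by (simp add: avg_def)
qed

lemma avg_linear:
  assumes "linear L"
  shows "L (avg xs \<phi> x) = avg xs (\<lambda>x. L (\<phi> x)) x"
proof -
  have "L (\<Sum>a\<leftarrow>xs. \<phi> (x + a)) = (\<Sum>a\<leftarrow>xs. L (\<phi> (x + a)))"
    by (induction xs) (auto simp: linear_0[OF assms] linear_add[OF assms])
  then show ?thesis by (simp add: avg_def linear_scale[OF assms])
qed

lemma avg_mono: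
  fixes \<phi> \<psi> :: "'a::ab_group_add \<Rightarrow> real"
  assumes "\<And>x. \<phi> x \<le> \<psi> x" shows "avg xs \<phi> x \<le> avg xs \<psi> x"
  unfolding avg_def by (auto intro!: divide_right_mono sum_list_mono assms)

lemma norm_avg_le:
  assumes "\<And>x. norm (\<phi> x) \<le> B" "xs \<noteq> []"
  shows "norm (avg xs \<phi> x) \<le> B"
proof -
  have "norm (\<Sum>a\<leftarrow>ys. \<phi> (x + a)) \<le> real (length ys) * B" for ys
  proof (induction ys)
    case (Cons a ys)
    have "norm (\<phi> (x + a) + (\<Sum>a\<leftarrow>ys. \<phi> (x + a))) \<le> B + real (length ys) * B"
      by (rule order.trans[OF norm_triangle_ineq add_mono[OF assms(1) Cons.IH]])
    then show ?case by (simp add: distrib_right)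
  qed simp
  from this[of xs] show ?thesis using assms(2) by (simp add: avg_def divide_simps mult.commute)
qed

lemma norm_avg_diff_le:
  assumes "\<And>x. norm (\<phi> x - c) \<le> B" "xs \<noteq> []"
  shows "norm (avg xs \<phi> x - c) \<le> B"
  using norm_avg_le[of "\<lambda>x. \<phi> x - c" B xs x] assms by (simp add: avg_diff)

text \<open>Two averages commute, and averaging once more a function that is within \<epsilon> of a
  constant keeps it there. The double average is therefore close to both candidates.\<close>

lemma has_mean_unique:
  assumes "has_mean \<phi> c" "has_mean \<phi> d" shows "c = d"
proof (rule ccontr)
  assume "c \<noteq> d"
  define \<epsilon> where "\<epsilon> = norm (c - d) / 3"
  have "\<epsilon> > 0" using \<open>c \<noteq> d\<close> by (simp add: \<epsilon>_def)
  obtain xs where xs: "xs \<noteq> []" "\<And>x. norm (avg xs \<phi> x - c) \<le> \<epsilon>"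
    using assms(1) \<open>\<epsilon> > 0\<close> unfolding has_mean_def by blast
  obtain ys where ys: "ys \<noteq> []" "\<And>x. norm (avg ys \<phi> x - d) \<le> \<epsilon>"
    using assms(2) \<open>\<epsilon> > 0\<close> unfolding has_mean_def by blast
  have "norm (avg ys (avg xs \<phi>) 0 - c) \<le> \<epsilon>" by (rule norm_avg_diff_le) (use xs ys in auto)
  moreover have "norm (avg ys (avg xs \<phi>) 0 - d) \<le> \<epsilon>"
    by (subst avg_commute, rule norm_avg_diff_le) (use xs ys in auto)
  ultimately have "norm (c - d) \<le> 2 * \<epsilon>"
    using norm_triangle_ineq4[of "avg ys (avg xs \<phi>) 0 - d" "avg ys (avg xs \<phi>) 0 - c"] by simp
  then show False using \<open>\<epsilon> > 0\<close> by (simp add: \<epsilon>_def)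
qed

lemma mean_eqI: "has_mean \<phi> c \<Longrightarrow> mean \<phi> = c"
  unfolding mean_def by (rule the_equality) (auto intro: has_mean_unique)

lemma has_mean_const: "has_mean (\<lambda>_. c) c"
  unfolding has_mean_def by (auto intro!: exI[of _ "[0]"])

text \<open>Averaging over \<open>sumset ys xs\<close> performs both averages in succession, so each
  summand keeps the approximation found for it separately.\<close>

lemma has_mean_add:
  assumes "has_mean \<phi> c" "has_mean \<psi> d"
  shows "has_mean (\<lambda>x. \<phi> x + \<psi> x) (c + d)"
  unfolding has_mean_def
proof (intro allI impI)
  fix \<epsilon> :: real assume "\<epsilon> > 0"
  then have e: "\<epsilon> / 2 > 0" by simp
  obtain xs where xs: "xs \<noteq> []" "\<And>x. norm (avg xs \<phi> x - c) \<le> \<epsilon> / 2"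
    using assms(1) e unfolding has_mean_def by blast
  obtain ys where ys: "ys \<noteq> []" "\<And>x. norm (avg ys \<psi> x - d) \<le> \<epsilon> / 2"
    using assms(2) e unfolding has_mean_def by blast
  have "norm (avg (sumset ys xs) (\<lambda>x. \<phi> x + \<psi> x) x - (c + d)) \<le> \<epsilon>" for x
  proof -
    have 1: "norm (avg ys (avg xs \<phi>) x - c) \<le> \<epsilon> / 2" by (rule norm_avg_diff_le) (use xs ys in auto)
    have 2: "norm (avg xs (avg ys \<psi>) x - d) \<le> \<epsilon> / 2" by (rule norm_avg_diff_le) (use xs ys in auto)
    have "avg (sumset ys xs) (\<lambda>x. \<phi> x + \<psi> x) x = avg ys (avg xs \<phi>) x + avg xs (avg ys \<psi>) x"
      by (subst avg_add) (simp add: avg_avg[symmetric] avg_commute[of xs ys])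
    then show ?thesis using norm_triangle_ineq[of "avg ys (avg xs \<phi>) x - c" "avg xs (avg ys \<psi>) x - d"] 1 2
      by (simp add: algebra_simps)
  qed
  then show "\<exists>xs. xs \<noteq> [] \<and> (\<forall>x. norm (avg xs (\<lambda>x. \<phi> x + \<psi> x) x - (c + d)) \<le> \<epsilon>)"
    using xs ys by (intro exI[of _ "sumset ys xs"]) auto
qed

lemma has_mean_linear:
  assumes "has_mean \<phi> c" "bounded_linear L"
  shows "has_mean (\<lambda>x. L (\<phi> x)) (L c)"
  unfolding has_mean_def
proof (intro allI impI)
  fix \<epsilon> :: real assume "\<epsilon> > 0"
  interpret bounded_linear L by fact
  obtain K where K: "K > 0" "\<And>x. norm (L x) \<le> norm x * K" using pos_bounded by blast
  obtain xs where xs: "xs \<noteq> []" "\<And>x. norm (avg xs \<phi> x - c) \<le> \<epsilon> / K"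
    using assms(1) \<open>\<epsilon> > 0\<close> K unfolding has_mean_def by (meson divide_pos_pos)
  have "norm (avg xs (\<lambda>x. L (\<phi> x)) x - L c) \<le> \<epsilon>" for x
  proof -
    have "avg xs (\<lambda>x. L (\<phi> x)) x - L c = L (avg xs \<phi> x - c)"
      by (simp add: avg_linear[OF linear_axioms] diff)
    also have "norm \<dots> \<le> norm (avg xs \<phi> x - c) * K" by (rule K)
    also have "\<dots> \<le> \<epsilon> / K * K" using xs(2)[of x] K by (intro mult_right_mono) auto
    finally show ?thesis using K by simp
  qed
  then show "\<exists>xs. xs \<noteq> [] \<and> (\<forall>x. norm (avg xs (\<lambda>x. L (\<phi> x)) x - L c) \<le> \<epsilon>)"
    using xs by blast
qed

lemma has_mean_translate:
  assumes "has_mean \<phi> c" shows "has_mean (\<lambda>x. \<phi> (x + a)) c"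
proof -
  have "avg xs (\<lambda>x. \<phi> (x + a)) x = avg xs \<phi> (x + a)" for xs x
    by (simp add: avg_def algebra_simps)
  moreover have "\<exists>xs. xs \<noteq> [] \<and> (\<forall>x. norm (avg xs \<phi> (x + a) - c) \<le> \<epsilon>)" if "\<epsilon> > 0" for \<epsilon>
    using assms that unfolding has_mean_def by blast
  ultimately show ?thesis unfolding has_mean_def by simp
qed

lemma has_mean_reflect:
  assumes "has_mean \<phi> c" shows "has_mean (\<lambda>x. \<phi> (- x)) c"
proof -
  have *: "avg (map uminus xs) (\<lambda>x. \<phi> (- x)) x = avg xs \<phi> (- x)" for xs x
    by (simp add: avg_def o_def)
  show ?thesis unfolding has_mean_def
  proof (intro allI impI)
    fix \<epsilon> :: real assume "\<epsilon> > 0"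
    then obtain xs where xs: "xs \<noteq> []" "\<And>x. norm (avg xs \<phi> x - c) \<le> \<epsilon>"
      using assms unfolding has_mean_def by blast
    then show "\<exists>xs. xs \<noteq> [] \<and> (\<forall>x. norm (avg xs (\<lambda>x. \<phi> (- x)) x - c) \<le> \<epsilon>)"
      by (intro exI[of _ "map uminus xs"]) (simp add: *)
  qed
qed

lemma has_mean_norm_le:
  assumes "has_mean \<phi> c" "\<And>x. norm (\<phi> x - d) \<le> B" shows "norm (c - d) \<le> B"
proof (rule field_le_epsilon)
  fix \<epsilon> :: real assume "\<epsilon> > 0"
  then obtain xs where xs: "xs \<noteq> []" "\<And>x. norm (avg xs \<phi> x - c) \<le> \<epsilon>"
    using assms unfolding has_mean_def by blast
  have "norm (avg xs \<phi> 0 - d) \<le> B" by (rule norm_avg_diff_le) (use assms xs in auto)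
  then show "norm (c - d) \<le> B + \<epsilon>" using xs(2)[of 0] norm_triangle_ineq4[of "avg xs \<phi> 0 - d" "avg xs \<phi> 0 - c"] by simp
qed

lemma has_mean_nonneg:
  fixes \<phi> :: "'a::ab_group_add \<Rightarrow> real"
  assumes "has_mean \<phi> c" "\<And>x. 0 \<le> \<phi> x" shows "0 \<le> c"
proof (rule field_le_epsilon)
  fix \<epsilon> :: real assume "\<epsilon> > 0"
  then obtain xs where xs: "xs \<noteq> []" "\<And>x. norm (avg xs \<phi> x - c) \<le> \<epsilon>"
    using assms unfolding has_mean_def by blast
  have "avg xs (\<lambda>_. 0) 0 \<le> avg xs \<phi> 0" by (rule avg_mono) (use assms in auto)
  then show "0 \<le> c + \<epsilon>" using xs(1) xs(2)[of 0] by simp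
qed

locale compact_ab_group =
  fixes G :: "'a::{topological_ab_group_add,t2_space} itself"
  assumes compact_UNIV: "compact (UNIV :: 'a set)"
begin

lemma bounded_continuous:
  fixes \<phi> :: "'a \<Rightarrow> 'b::real_normed_vector"
  assumes "continuous_on UNIV \<phi>"
  obtains B where "B > 0" "\<And>x. norm (\<phi> x) \<le> B"
  using compact_imp_bounded[OF compact_continuous_image[OF assms compact_UNIV]] that
  unfolding bounded_pos by blast

lemma uniformly_continuous:
  fixes \<phi> :: "'a \<Rightarrow> 'b::real_normed_vector"
  assumes "continuous_on UNIV \<phi>" "\<epsilon> > 0"
  obtains U where "open U" "0 \<in> U" "\<And>x u. u \<in> U \<Longrightarrow> norm (\<phi> (x + u) - \<phi> x) \<le> \<epsilon>"
proof -
  have "continuous_on (UNIV \<times> UNIV) (\<lambda>(u, x). \<phi> (x + u))"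
    unfolding case_prod_unfold
    by (rule continuous_on_compose2[OF assms(1)], intro continuous_intros) simp
  then obtain U where U: "0 \<in> U" "open U" "\<forall>x\<in>U \<inter> UNIV. \<forall>t\<in>UNIV.
      dist ((\<lambda>(u, x). \<phi> (x + u)) (x, t)) ((\<lambda>(u, x). \<phi> (x + u)) (0, t)) \<le> \<epsilon>"
    by (rule continuous_on_prod_compactE[OF _ compact_UNIV UNIV_I[of 0] assms(2)])
  show ?thesis by (rule that[OF U(2,1)]) (use U(3) in \<open>simp add: dist_norm\<close>)
qed

lemma finite_translates_cover:
  assumes "open U" "0 \<in> U"
  obtains ys where "ys \<noteq> []" "\<And>z. \<exists>y\<in>set ys. z + y \<in> (U :: 'a set)"
proof -
  have op: "open {z. z + y \<in> U}" for y
    using open_vimage[OF assms(1), of "\<lambda>z. z + y"] by (simp add: vimage_def continuous_intros)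
  have "UNIV \<subseteq> (\<Union>y\<in>UNIV. {z. z + y \<in> U})"
  proof
    fix z :: 'a
    have "z + (- z) \<in> U" using assms(2) by simp
    then show "z \<in> (\<Union>y\<in>UNIV. {z. z + y \<in> U})" by blast
  qed
  then obtain C where C: "finite C" "UNIV \<subseteq> (\<Union>y\<in>C. {z. z + y \<in> U})"
    using compactE_image[OF compact_UNIV, of UNIV "\<lambda>y. {z. z + y \<in> U}"] op
    by (metis (no_types, lifting))
  obtain ys where ys: "set ys = C" using C(1) finite_list by blast
  have "\<exists>y\<in>set ys. z + y \<in> U" for z using C(2) ys by blast
  moreover from this have "ys \<noteq> []" by force
  ultimately show ?thesis using that by blast
qed

text \<open>The mean is the infimum \<open>p\<close> of all \<open>M\<close> that dominate some
  average. A nearly optimal average \<open>h\<close> cannot dip below \<open>p - \<epsilon>\<close>: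
  by equicontinuity the dip fills a translate of a neighbourhood, and averaging once more over
  \<open>ys\<close> makes every point feel it, which pushes the supremum below
  \<open>p\<close>.\<close>

lemma has_mean_real:
  fixes \<phi> :: "'a \<Rightarrow> real"
  assumes cont: "continuous_on UNIV \<phi>"
  shows "\<exists>c. has_mean \<phi> c"
proof -
  define P where "P = {M. \<exists>xs. xs \<noteq> [] \<and> (\<forall>x. avg xs \<phi> x \<le> M)}"
  define p where "p = Inf P"
  obtain B where B: "B > 0" "\<And>x. norm (\<phi> x) \<le> B" using bounded_continuous[OF cont] by blast
  have "avg [0] \<phi> x \<le> B" for x using B(2)[of x] by (simp add: avg_def)
  then have "B \<in> P" unfolding P_def by blast
  then have ne: "P \<noteq> {}" by blast
  have "- B \<le> M" if "M \<in> P" for M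
  proof -
    from that obtain xs where "xs \<noteq> []" "\<And>x. avg xs \<phi> x \<le> M" unfolding P_def by blast
    then show ?thesis using norm_avg_le[of \<phi> B xs 0] B(2) by (smt (verit) real_norm_def)
  qed
  then have bdd: "bdd_below P" by (auto simp: bdd_below_def)
  have low: "p \<le> M" if "xs \<noteq> []" "\<And>x. avg xs \<phi> x \<le> M" for xs M
    unfolding p_def by (rule cInf_lower[OF _ bdd]) (use that in \<open>auto simp: P_def\<close>)
  have "has_mean \<phi> p" unfolding has_mean_def
  proof (intro allI impI)
    fix \<epsilon> :: real assume "\<epsilon> > 0"
    obtain U where U: "open U" "0 \<in> U" "\<And>x u. u \<in> U \<Longrightarrow> norm (\<phi> (x + u) - \<phi> x) \<le> \<epsilon> / 2"
      by (rule uniformly_continuous[OF cont, of "\<epsilon> / 2"]) (use \<open>\<epsilon> > 0\<close> in auto)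
    obtain ys where ys: "ys \<noteq> []" "\<And>z. \<exists>y\<in>set ys. z + y \<in> U"
      using finite_translates_cover[OF U(1,2)] by blast
    define n where "n = real (length ys)"
    have "n \<ge> 1" using ys(1) unfolding n_def by (cases ys) auto
    \<comment> \<open>Each of the \<open>n - 1\<close> undisturbed summands may exceed
      \<open>p\<close> by \<delta>, in total by at most \<open>\<epsilon> / 4\<close>, while the
      summand in the dip stays \<open>\<epsilon> / 2\<close> below \<open>p\<close>.\<close>
    define \<delta> where "\<delta> = \<epsilon> / (4 * n)"
    have "\<delta> > 0" "\<delta> \<le> \<epsilon>" using \<open>n \<ge> 1\<close> \<open>\<epsilon> > 0\<close> by (auto simp: \<delta>_def field_simps)
    have "\<exists>M\<in>P. M < p + \<delta>"
      unfolding p_def using ne bdd \<open>\<delta> > 0\<close> by (meson cInf_lessD less_add_same_cancel1)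
    then obtain xs where xs: "xs \<noteq> []" "\<And>x. avg xs \<phi> x \<le> p + \<delta>"
      unfolding P_def by (smt (verit) mem_Collect_eq)
    define h where "h = avg xs \<phi>"
    \<comment> \<open>Averaging preserves the modulus of continuity, so \<open>U\<close> serves for
      \<open>h\<close> although it was chosen before \<open>xs\<close>.\<close>
    have hU: "\<bar>h (x + u) - h x\<bar> \<le> \<epsilon> / 2" if "u \<in> U" for x u
    proof -
      have "h (x + u) - h x = avg xs (\<lambda>x. \<phi> (x + u) - \<phi> x) x"
        unfolding avg_diff by (simp add: h_def avg_def algebra_simps)
      moreover have "norm (avg xs (\<lambda>x. \<phi> (x + u) - \<phi> x) x) \<le> \<epsilon> / 2"
        by (rule norm_avg_le) (use U(3)[OF that] xs in auto)
      ultimately show ?thesis by simp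
    qed
    have "p - \<epsilon> \<le> h x0" for x0
    proof (rule ccontr)
      assume "\<not> p - \<epsilon> \<le> h x0"
      then have x0: "h x0 < p - \<epsilon>" by simp
      define M where "M = ((n - 1) * (p + \<delta>) + (p - \<epsilon> / 2)) / n"
      have "avg (sumset ys xs) \<phi> x \<le> M" for x
      proof -
        obtain y where y: "y \<in> set ys" "(x - x0) + y \<in> U" using ys(2) by blast
        have "h (x0 + ((x - x0) + y)) \<le> h x0 + \<epsilon> / 2" using hU[OF y(2), of x0] by linarith
        then have hy: "h (x + y) \<le> p - \<epsilon> / 2" using x0 by (simp add: algebra_simps)
        obtain l r where lr: "ys = l @ y # r" using split_list[OF y(1)] by blast
        have S: "(\<Sum>a\<leftarrow>l. h (x + a)) \<le> real (length l) * (p + \<delta>)" for l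
        proof (induction l)
          case (Cons a l)
          then show ?case using xs(2)[of "x + a"] by (simp add: h_def distrib_right)
        qed simp
        have "n - 1 = real (length l) + real (length r)" by (simp add: n_def lr)
        then have "(\<Sum>a\<leftarrow>ys. h (x + a)) \<le> (n - 1) * (p + \<delta>) + (p - \<epsilon> / 2)"
          using S[of l] S[of r] hy unfolding lr by (simp add: distrib_right)
        then have "avg ys h x \<le> M"
          using \<open>n \<ge> 1\<close> by (simp add: avg_def M_def n_def divide_right_mono)
        then show ?thesis by (simp add: h_def avg_avg)
      qed
      then have "p \<le> M" using low[of "sumset ys xs" M] xs ys by auto
      moreover have "M < p"
      proof -
        have "M = p + ((n - 1) * \<delta> - \<epsilon> / 2) / n" using \<open>n \<ge> 1\<close> by (simp add: M_def field_simps)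
        moreover have "(n - 1) * \<delta> \<le> \<epsilon> / 4" using \<open>n \<ge> 1\<close> \<open>\<epsilon> > 0\<close> by (simp add: \<delta>_def field_simps)
        ultimately show ?thesis using \<open>n \<ge> 1\<close> \<open>\<epsilon> > 0\<close> by (simp add: divide_less_0_iff)
      qed
      ultimately show False by simp
    qed
    then have "p - \<epsilon> \<le> avg xs \<phi> x" for x by (simp add: h_def)
    then have "norm (avg xs \<phi> x - p) \<le> \<epsilon>" for x
      using xs(2)[of x] \<open>\<delta> \<le> \<epsilon>\<close> unfolding real_norm_def
      by (smt (verit, best))
    then show "\<exists>xs. xs \<noteq> [] \<and> (\<forall>x. norm (avg xs \<phi> x - p) \<le> \<epsilon>)" using xs by blast
  qed
  then show ?thesis by blast
qed

lemma has_mean_mean: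
  fixes \<phi> :: "'a \<Rightarrow> complex"
  assumes cont: "continuous_on UNIV \<phi>"
  shows "has_mean \<phi> (mean \<phi>)"
proof -
  obtain a where a: "has_mean (\<lambda>x. Re (\<phi> x)) a"
    using has_mean_real[of "\<lambda>x. Re (\<phi> x)"] cont by (auto intro!: continuous_intros)
  obtain b where b: "has_mean (\<lambda>x. Im (\<phi> x)) b"
    using has_mean_real[of "\<lambda>x. Im (\<phi> x)"] cont by (auto intro!: continuous_intros)
  have "bounded_linear (\<lambda>y. \<i> * complex_of_real y)"
    by (rule bounded_linear_const_mult[OF bounded_linear_of_real])
  from has_mean_add[OF has_mean_linear[OF a bounded_linear_of_real] has_mean_linear[OF b this]]
  have "has_mean \<phi> (complex_of_real a + \<i> * complex_of_real b)"
    by (simp only: complex_eq[symmetric])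
  then show ?thesis using mean_eqI[of \<phi>] by simp
qed

end


section \<open>The convolution algebra and its mean inner product\<close>

context compact_ab_group
begin

abbreviation cont :: "('a \<Rightarrow> complex) \<Rightarrow> bool" where "cont \<phi> \<equiv> continuous_on UNIV \<phi>"

lemma cont_compose:
  "cont \<phi> \<Longrightarrow> continuous_on S g \<Longrightarrow> continuous_on S (\<lambda>x. \<phi> (g x))"
  by (rule continuous_on_compose2[OF _ _ subset_UNIV])

lemma mean_const [simp]: "mean (\<lambda>_::'a. c) = c"
  by (rule mean_eqI has_mean_const)+

lemma mean_add: "cont \<phi> \<Longrightarrow> cont \<psi> \<Longrightarrow> mean (\<lambda>x. \<phi> x + \<psi> x) = mean \<phi> + mean \<psi>"
  by (intro mean_eqI has_mean_add has_mean_mean)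

lemma mean_cmul: "cont \<phi> \<Longrightarrow> mean (\<lambda>x. c * \<phi> x) = c * mean \<phi>"
  by (intro mean_eqI has_mean_linear[of \<phi> _ "\<lambda>z. c * z"] has_mean_mean bounded_linear_mult_right)

lemma mean_diff: "cont \<phi> \<Longrightarrow> cont \<psi> \<Longrightarrow> mean (\<lambda>x. \<phi> x - \<psi> x) = mean \<phi> - mean \<psi>"
  using mean_add[of \<phi> "\<lambda>x. (-1) * \<psi> x"] mean_cmul[of \<psi> "-1"]
  by (simp add: continuous_on_minus)

lemma mean_cnj: "cont \<phi> \<Longrightarrow> mean (\<lambda>x. cnj (\<phi> x)) = cnj (mean \<phi>)"
  by (intro mean_eqI has_mean_linear[of \<phi> _ cnj] has_mean_mean bounded_linear_cnj)

lemma mean_translate: "cont \<phi> \<Longrightarrow> mean (\<lambda>x. \<phi> (x + a)) = mean \<phi>"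
  by (intro mean_eqI has_mean_translate has_mean_mean)

lemma mean_reflect: "cont \<phi> \<Longrightarrow> mean (\<lambda>x. \<phi> (a - x)) = mean \<phi>"
  using mean_eqI[OF has_mean_reflect[OF has_mean_translate[OF has_mean_mean[of \<phi>]]], of a] by simp

lemma norm_mean_le: "cont \<phi> \<Longrightarrow> (\<And>x. norm (\<phi> x) \<le> B) \<Longrightarrow> norm (mean \<phi>) \<le> B"
  using has_mean_norm_le[OF has_mean_mean, of \<phi> 0 B] by simp

lemma norm_mean_diff_le:
  "cont \<phi> \<Longrightarrow> cont \<psi> \<Longrightarrow> (\<And>x. norm (\<phi> x - \<psi> x) \<le> B) \<Longrightarrow> norm (mean \<phi> - mean \<psi>) \<le> B"
  using norm_mean_le[of "\<lambda>x. \<phi> x - \<psi> x" B] by (simp add: mean_diff continuous_on_diff)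

lemma Re_mean_mono:
  assumes "cont \<phi>" "cont \<psi>" "\<And>x. Re (\<phi> x) \<le> Re (\<psi> x)"
  shows "Re (mean \<phi>) \<le> Re (mean \<psi>)"
proof -
  have "has_mean (\<lambda>x. Re (\<psi> x - \<phi> x)) (Re (mean (\<lambda>x. \<psi> x - \<phi> x)))"
    using assms by (intro has_mean_linear[OF _ bounded_linear_Re] has_mean_mean continuous_intros)
  from has_mean_nonneg[OF this] show ?thesis using assms by (simp add: mean_diff)
qed

lemma cont_mean:
  fixes F :: "'a \<Rightarrow> 'a \<Rightarrow> complex"
  assumes "continuous_on UNIV (\<lambda>p. F (fst p) (snd p))"
  shows "cont (\<lambda>x. mean (F x))"
  unfolding continuous_on_eq_continuous_at[OF open_UNIV] isCont_def tendsto_iff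
proof (intro ballI allI impI)
  fix x0 :: 'a and e :: real assume "e > 0"
  then have e: "e / 2 > 0" by simp
  have sec: "cont (F x)" for x
    using continuous_on_compose2[OF assms, of UNIV "\<lambda>y. (x, y)"]
    by (simp add: continuous_on_Pair)
  obtain X where X: "x0 \<in> X" "open X" "\<forall>x\<in>X \<inter> UNIV. \<forall>t\<in>UNIV.
      dist (F (fst (x, t)) (snd (x, t))) (F (fst (x0, t)) (snd (x0, t))) \<le> e / 2"
    by (rule continuous_on_prod_compactE[OF _ compact_UNIV UNIV_I[of x0] e,
          of "\<lambda>p. F (fst p) (snd p)"]) (use assms in simp)
  have "dist (mean (F x)) (mean (F x0)) < e" if "x \<in> X" for x
    using norm_mean_diff_le[OF sec sec, of x x0 "e / 2"] X(3) that \<open>e > 0\<close>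
    by (force simp: dist_norm)
  then show "\<forall>\<^sub>F x in at x0. dist (mean (F x)) (mean (F x0)) < e"
    unfolding eventually_at_topological using X(1,2) by blast
qed

lemma simultaneous_avg:
  fixes m :: "('a \<Rightarrow> complex) \<Rightarrow> complex"
  assumes "finite X" "\<And>\<phi>. \<phi> \<in> X \<Longrightarrow> has_mean \<phi> (m \<phi>)" "\<epsilon> > 0"
  shows "\<exists>ys. ys \<noteq> [] \<and> (\<forall>\<phi>\<in>X. \<forall>y. norm (avg ys \<phi> y - m \<phi>) \<le> \<epsilon>)"
  using assms(1,2)
proof (induction X rule: finite_induct)
  case empty
  then show ?case by (intro exI[of _ "[0]"]) auto
next
  case (insert \<phi> X)
  from insert obtain ys where ys: "ys \<noteq> []" "\<And>\<psi> y. \<psi> \<in> X \<Longrightarrow> norm (avg ys \<psi> y - m \<psi>) \<le> \<epsilon>" by auto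
  from insert.prems[of \<phi>] obtain xs where xs: "xs \<noteq> []" "\<And>y. norm (avg xs \<phi> y - m \<phi>) \<le> \<epsilon>"
    using assms(3) unfolding has_mean_def by blast
  have 1: "norm (avg (sumset xs ys) \<psi> y - m \<psi>) \<le> \<epsilon>" if "\<psi> \<in> X" for \<psi> y
    unfolding avg_avg[symmetric] by (rule norm_avg_diff_le) (use ys that xs in auto)
  have 2: "norm (avg (sumset xs ys) \<phi> y - m \<phi>) \<le> \<epsilon>" for y
    unfolding avg_avg[symmetric] by (subst avg_commute, rule norm_avg_diff_le) (use ys xs in auto)
  show ?case using 1 2 xs(1) ys(1) by (intro exI[of _ "sumset xs ys"]) auto
qed

lemma mean_avg:
  assumes "\<And>y. cont (\<lambda>x. F x y)"
  shows "mean (\<lambda>x. avg ys (F x) y) = avg ys (\<lambda>y. mean (\<lambda>x. F x y)) y"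
proof -
  have "has_mean (\<lambda>x. \<Sum>a\<leftarrow>ys. F x (y + a)) (\<Sum>a\<leftarrow>ys. mean (\<lambda>x. F x (y + a)))" for ys
    by (induction ys) (auto intro!: has_mean_const has_mean_add has_mean_mean assms)
  from has_mean_linear[OF this bounded_linear_scaleR_right]
  show ?thesis unfolding avg_def by (rule mean_eqI)
qed

text \<open>Fubini for the mean. Uniform continuity in the first variable reduces
  \<open>F x\<close>, up to a third of \<epsilon>, to finitely many sections \<open>F (- z)\<close>,
  for which \<open>simultaneous_avg\<close> supplies one list \<open>ys\<close>. This list then
  works for all \<open>x\<close>, and the outer mean passes through a finite average by
  linearity.\<close>

lemma mean_commute:
  fixes F :: "'a \<Rightarrow> 'a \<Rightarrow> complex"
  assumes F: "continuous_on UNIV (\<lambda>p. F (fst p) (snd p))"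
  shows "mean (\<lambda>x. mean (\<lambda>y. F x y)) = mean (\<lambda>y. mean (\<lambda>x. F x y))"
proof -
  have sec1: "cont (F x)" for x
    using continuous_on_compose2[OF F, of UNIV "\<lambda>y. (x, y)"]
    by (simp add: continuous_on_Pair)
  have sec2: "cont (\<lambda>x. F x y)" for y
    using continuous_on_compose2[OF F, of UNIV "\<lambda>x. (x, y)"]
    by (simp add: continuous_on_Pair)
  define \<phi> where "\<phi> x = mean (F x)" for x
  have c\<phi>: "cont \<phi>" unfolding \<phi>_def using cont_mean[OF F] by simp
  have "has_mean (\<lambda>y. mean (\<lambda>x. F x y)) (mean \<phi>)"
    unfolding has_mean_def
  proof (intro allI impI)
    fix \<epsilon> :: real assume "\<epsilon> > 0"
    then have e3: "\<epsilon> / 3 > 0" by simp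
    have "continuous_on (UNIV \<times> UNIV \<times> UNIV) (\<lambda>(u, x, y). F (x + u) y)"
      unfolding case_prod_unfold
      using continuous_on_compose2[OF F, of "UNIV \<times> UNIV \<times> UNIV"
          "\<lambda>q. (fst (snd q) + fst q, snd (snd q))"]
      by (simp add: continuous_intros)
    then obtain U where U: "0 \<in> U" "open U" "\<forall>u\<in>U \<inter> UNIV. \<forall>t\<in>UNIV \<times> UNIV.
        dist ((\<lambda>(u, x, y). F (x + u) y) (u, t)) ((\<lambda>(u, x, y). F (x + u) y) (0, t)) \<le> \<epsilon> / 3"
      by (rule continuous_on_prod_compactE[OF _ compact_Times[OF compact_UNIV compact_UNIV] UNIV_I[of 0] e3])
    then have U3: "norm (F (x + u) y - F x y) \<le> \<epsilon> / 3" if "u \<in> U" for u x y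
      using that by (auto simp: dist_norm)
    obtain zs where zs: "zs \<noteq> []" "\<And>w. \<exists>z\<in>set zs. w + z \<in> U"
      using finite_translates_cover[OF U(2,1)] by blast
    have "\<exists>ys. ys \<noteq> [] \<and> (\<forall>\<psi>\<in>(\<lambda>z. F (- z)) ` set zs. \<forall>y. norm (avg ys \<psi> y - mean \<psi>) \<le> \<epsilon> / 3)"
      by (rule simultaneous_avg) (use sec1 has_mean_mean e3 in auto)
    then obtain ys where ys: "ys \<noteq> []"
      "\<And>z y. z \<in> set zs \<Longrightarrow> norm (avg ys (F (- z)) y - \<phi> (- z)) \<le> \<epsilon> / 3"
      unfolding \<phi>_def by auto
    have main: "norm (avg ys (F x) y - \<phi> x) \<le> \<epsilon>" for x y
    proof -
      obtain z where z: "z \<in> set zs" "x + z \<in> U" using zs(2) by blast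
      have "norm (F x y - F (- z) y) \<le> \<epsilon> / 3" for y using U3[OF z(2), of "- z" y] by simp
      then have 1: "norm (avg ys (\<lambda>y. F x y - F (- z) y) y) \<le> \<epsilon> / 3" "norm (\<phi> x - \<phi> (- z)) \<le> \<epsilon> / 3"
        unfolding \<phi>_def by (rule norm_avg_le[OF _ ys(1)] norm_mean_diff_le[OF sec1 sec1])+
      have 2: "norm (A - B) \<le> norm (A - A' ) + norm (A' - B') + norm (B - B')" for A B A' B' :: complex
        using norm_triangle_ineq4[of "(A - A') + (A' - B')" "B - B'"] norm_triangle_ineq[of "A - A'" "A' - B'"] by simp
      show ?thesis
        using 1 ys(2)[OF z(1), of y] 2[of "avg ys (F x) y" "\<phi> x" "avg ys (F (- z)) y" "\<phi> (- z)"]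
        unfolding avg_diff by linarith
    qed
    have "norm (avg ys (\<lambda>y. mean (\<lambda>x. F x y)) y - mean \<phi>) \<le> \<epsilon>" for y
    proof -
      have "(\<Sum>a\<leftarrow>ys. F x (y + a)) = (\<Sum>i<length ys. F x (y + ys ! i))" for x
        by (simp add: sum_list_sum_nth atLeast0LessThan)
      then have "cont (\<lambda>x. avg ys (F x) y)"
        unfolding avg_def by (simp add: continuous_intros sec2)
      from norm_mean_diff_le[OF this c\<phi> main] show ?thesis by (simp add: mean_avg[OF sec2])
    qed
    then show "\<exists>xs. xs \<noteq> [] \<and> (\<forall>x. norm (avg xs (\<lambda>y. mean (\<lambda>x. F x y)) x - mean \<phi>) \<le> \<epsilon>)"
      using ys(1) by blast
  qed
  from mean_eqI[OF this] show ?thesis by (simp add: \<phi>_def[abs_def])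
qed

definition sqn :: "('a \<Rightarrow> complex) \<Rightarrow> real" where
  "sqn f = Re (mean (\<lambda>x. f x * cnj (f x)))"

definition conv :: "('a \<Rightarrow> complex) \<Rightarrow> ('a \<Rightarrow> complex) \<Rightarrow> 'a \<Rightarrow> complex" where
  "conv f g x = mean (\<lambda>y. f (x - y) * g y)"

definition adj :: "('a \<Rightarrow> complex) \<Rightarrow> 'a \<Rightarrow> complex" where
  "adj f x = cnj (f (- x))"

lemma mean_sq:
  assumes "cont f"
  shows "mean (\<lambda>x. f x * cnj (f x)) = of_real (sqn f)"
proof -
  have c: "cont (\<lambda>x. f x * cnj (f x))" using assms by (intro continuous_intros)
  have "cnj (mean (\<lambda>x. f x * cnj (f x))) = mean (\<lambda>x. f x * cnj (f x))"
    using mean_cnj[OF c] by (simp add: mult.commute)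
  then show ?thesis by (simp add: sqn_def complex_eq_iff)
qed

lemma sqn_nonneg: "cont f \<Longrightarrow> 0 \<le> sqn f"
  unfolding sqn_def using Re_mean_mono[of "\<lambda>_. 0" "\<lambda>x. f x * cnj (f x)"]
  by (simp add: continuous_intros)

text \<open>The translates of \<phi> by \<open>zs\<close> have real parts adding up to at least
  \<open>b\<close> everywhere, and their sum has mean \<open>length zs\<close> times that of \<phi>.
  The factor depends on the covering alone and not on \<phi>, a uniformity that
  \<open>coord_surj\<close> exploits.\<close>

lemma Re_mean_lower:
  assumes c: "cont \<phi>" and nn: "\<And>x. 0 \<le> Re (\<phi> x)"
    and U: "\<And>u. u \<in> U \<Longrightarrow> b \<le> Re (\<phi> u)" and zs: "\<And>w. \<exists>z\<in>set zs. w + z \<in> U"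
  shows "b \<le> real (length zs) * Re (mean \<phi>)"
proof -
  define \<psi> where "\<psi> x = (\<Sum>z\<leftarrow>zs. \<phi> (x + z))" for x
  have "has_mean (\<lambda>x. \<Sum>z\<leftarrow>zs. \<phi> (x + z)) (\<Sum>z\<leftarrow>zs. mean \<phi>)" for zs
    by (induction zs) (auto intro!: has_mean_const has_mean_add has_mean_translate has_mean_mean c)
  then have m\<psi>: "mean \<psi> = (\<Sum>z\<leftarrow>zs. mean \<phi>)" unfolding \<psi>_def by (rule mean_eqI)
  have "\<psi> x = (\<Sum>i<length zs. \<phi> (x + zs ! i))" for x
    by (simp add: \<psi>_def sum_list_sum_nth atLeast0LessThan)
  then have c\<psi>: "cont \<psi>" by (simp add: continuous_intros cont_compose[OF c])
  have "b \<le> Re (\<psi> x)" for x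
  proof -
    obtain z where z: "z \<in> set zs" "x + z \<in> U" using zs by blast
    have nnl: "0 \<le> Re (\<Sum>z\<leftarrow>l. \<phi> (x + z))" for l
      by (induction l) (auto simp: nn)
    obtain l r where lr: "zs = l @ z # r" using split_list[OF z(1)] by blast
    show ?thesis using U[OF z(2)] nnl[of l] nnl[of r] by (simp add: \<psi>_def lr)
  qed
  then have "b \<le> Re (mean \<psi>)" using Re_mean_mono[of "\<lambda>_. of_real b" \<psi>] c\<psi> by simp
  moreover have "Re (\<Sum>z\<leftarrow>zs. mean \<phi>) = real (length zs) * Re (mean \<phi>)" for zs :: "'a list"
    by (induction zs) (auto simp: algebra_simps)
  ultimately show ?thesis by (simp add: m\<psi>)
qed

lemma Re_mean_pos:
  assumes c: "cont \<phi>" and nn: "\<And>x. 0 \<le> Re (\<phi> x)" and x0: "Re (\<phi> x0) > 0"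
  shows "Re (mean \<phi>) > 0"
proof -
  define e where "e = Re (\<phi> x0) / 2"
  have "e > 0" using x0 by (simp add: e_def)
  obtain U where U: "open U" "0 \<in> U" "\<And>x u. u \<in> U \<Longrightarrow> norm (\<phi> (x + u) - \<phi> x) \<le> e"
    by (rule uniformly_continuous[OF c \<open>e > 0\<close>]) auto
  obtain zs where zs: "zs \<noteq> []" "\<And>w. \<exists>z\<in>set zs. w + z \<in> U"
    using finite_translates_cover[OF U(1,2)] by blast
  have "e \<le> real (length zs) * Re (mean (\<lambda>x. \<phi> (x + x0)))"
  proof (rule Re_mean_lower[OF _ _ _ zs(2)])
    show "cont (\<lambda>x. \<phi> (x + x0))" by (intro cont_compose[OF c] continuous_intros)
    show "e \<le> Re (\<phi> (u + x0))" if "u \<in> U" for u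
    proof -
      have "\<bar>Re (\<phi> (x0 + u) - \<phi> x0)\<bar> \<le> e" using U(3)[OF that] by (rule order.trans[OF abs_Re_le_cmod])
      then have "e \<le> Re (\<phi> (x0 + u))" unfolding e_def by (simp only: abs_le_iff minus_complex.sel) linarith
      then show ?thesis by (simp add: add.commute)
    qed
  qed (simp add: nn)
  then have "0 < real (length zs) * Re (mean \<phi>)" using \<open>e > 0\<close> by (simp add: mean_translate[OF c])
  then show ?thesis by (simp add: zero_less_mult_iff)
qed

lemma sqn_pos: "cont f \<Longrightarrow> f x \<noteq> 0 \<Longrightarrow> sqn f > 0"
  unfolding sqn_def
  by (rule Re_mean_pos[of _ x]) (auto simp: continuous_intros complex_norm_square[symmetric] simp flip: of_real_power)

lemma Cauchy_Schwarz_mean: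
  assumes "cont f" "cont g"
  shows "(norm (mean (\<lambda>x. f x * cnj (g x))))\<^sup>2 \<le> sqn f * sqn g"
proof (cases "\<exists>x. g x \<noteq> 0")
  case False
  then show ?thesis using sqn_nonneg[OF assms(1)] by (simp add: sqn_def)
next
  case True
  define s where "s = sqn g"
  have s: "s > 0" using True sqn_pos[OF assms(2)] by (auto simp: s_def)
  define c where "c = mean (\<lambda>x. f x * cnj (g x))"
  \<comment> \<open>The coefficient of the orthogonal projection of \<open>f\<close> to the line
    spanned by \<open>g\<close>.\<close>
  define t where "t = c / of_real s"
  note [continuous_intros] = assms
  have c': "mean (\<lambda>x. g x * cnj (f x)) = cnj c"
    unfolding c_def by (subst mean_cnj[symmetric]) (auto intro!: continuous_intros simp: mult.commute)
  have cc: "cont (\<lambda>x. f x * cnj (f x))" "cont (\<lambda>x. f x * cnj (g x))" "cont (\<lambda>x. g x * cnj (f x))"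
    "cont (\<lambda>x. g x * cnj (g x))" by (intro continuous_intros)+
  have eq: "(f x - t * g x) * cnj (f x - t * g x) = ((f x * cnj (f x) - cnj t * (f x * cnj (g x)))
      - t * (g x * cnj (f x))) + (t * cnj t) * (g x * cnj (g x))" for x
    by (simp add: algebra_simps)
  have "mean (\<lambda>x. (f x - t * g x) * cnj (f x - t * g x))
     = of_real (sqn f) - cnj t * c - t * cnj c + t * cnj t * of_real s"
    unfolding eq using cc
    by (subst mean_add mean_diff mean_cmul; (intro continuous_intros)?)+
       (simp_all add: c' c_def[symmetric] mean_sq[OF assms(1)] mean_sq[OF assms(2)] s_def)
  also have "\<dots> = of_real (sqn f) - c * cnj c / of_real s"
    using s by (simp add: t_def field_simps)
  also have "\<dots> = of_real (sqn f) - of_real ((norm c)\<^sup>2) / of_real s"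
    by (simp only: complex_norm_square)
  finally have "sqn (\<lambda>x. f x - t * g x) = Re (of_real (sqn f) - of_real ((norm c)\<^sup>2) / of_real s)"
    unfolding sqn_def[of "\<lambda>x. f x - t * g x"] by (rule arg_cong)
  then have "sqn (\<lambda>x. f x - t * g x) = sqn f - (norm c)\<^sup>2 / s"
    by (simp flip: of_real_divide)
  moreover have "0 \<le> sqn (\<lambda>x. f x - t * g x)" by (intro sqn_nonneg continuous_intros)
  ultimately have "(norm c)\<^sup>2 / s \<le> sqn f" by simp
  then show ?thesis using s unfolding c_def[symmetric] s_def[symmetric] by (simp add: divide_le_eq)
qed

lemma cont_conv:
  assumes "cont f" "cont g" shows "cont (conv f g)"
  unfolding conv_def
  by (rule cont_mean) (intro continuous_intros cont_compose[OF assms(1)] cont_compose[OF assms(2)])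

lemma cont_adj:
  assumes "cont f" shows "cont (adj f)"
  unfolding adj_def by (intro continuous_intros cont_compose[OF assms])

lemma conv_commute:
  assumes "cont f" "cont g" shows "conv f g = conv g f"
proof
  fix x
  have "cont (\<lambda>y. f (x - y) * g y)"
    by (intro continuous_intros assms cont_compose[OF assms(1)])
  from mean_reflect[OF this, of x] show "conv f g x = conv g f x"
    by (simp add: conv_def mult.commute)
qed

lemma conv_assoc:
  assumes "cont f" "cont g" "cont h"
  shows "conv (conv f g) h = conv f (conv g h)"
proof
  fix x
  have c1: "cont (\<lambda>z. f (x - y - z) * g z)" for y
    by (intro continuous_intros assms cont_compose[OF assms(1)])
  have c2: "cont (\<lambda>u. f (x - u) * g (u - y))" for y
    by (intro continuous_intros assms cont_compose[OF assms(1)] cont_compose[OF assms(2)])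
  have c3: "cont (\<lambda>y. g (u - y) * h y)" for u
    by (intro continuous_intros assms cont_compose[OF assms(2)])
  have c4: "continuous_on UNIV (\<lambda>p. f (x - snd p) * g (snd p - fst p) * h (fst p))"
    by (intro continuous_intros assms cont_compose[OF assms(1)] cont_compose[OF assms(2)] cont_compose[OF assms(3)])
  have "conv f g (x - y) * h y = mean (\<lambda>u. f (x - u) * g (u - y) * h y)" for y
    using mean_translate[OF c1, of y "- y"] mean_cmul[OF c2, of "h y" y]
    by (simp add: conv_def algebra_simps)
  then have "conv (conv f g) h x = mean (\<lambda>y. mean (\<lambda>u. f (x - u) * g (u - y) * h y))"
    by (simp add: conv_def[of "conv f g"])
  also have "\<dots> = mean (\<lambda>u. mean (\<lambda>y. f (x - u) * g (u - y) * h y))"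
    by (rule mean_commute[of "\<lambda>y u. f (x - u) * g (u - y) * h y"]) (rule c4)
  also have "\<dots> = conv f (conv g h) x"
    using mean_cmul[OF c3] by (simp add: conv_def mult.assoc)
  finally show "conv (conv f g) h x = conv f (conv g h) x" .
qed

lemma conv_add_right:
  assumes "cont f" "cont g" "cont h"
  shows "conv f (\<lambda>x. g x + h x) = (\<lambda>x. conv f g x + conv f h x)"
proof
  fix x
  have "cont (\<lambda>y. f (x - y) * g y)" "cont (\<lambda>y. f (x - y) * h y)"
    by (intro continuous_intros assms cont_compose[OF assms(1)])+
  from mean_add[OF this] show "conv f (\<lambda>x. g x + h x) x = conv f g x + conv f h x"
    by (simp add: conv_def distrib_left)
qed

lemma conv_cmul_right:
  assumes "cont f" "cont g"
  shows "conv f (\<lambda>x. c * g x) = (\<lambda>x. c * conv f g x)"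
proof
  fix x
  have "cont (\<lambda>y. f (x - y) * g y)"
    by (intro continuous_intros assms cont_compose[OF assms(1)])
  from mean_cmul[OF this, of c] show "conv f (\<lambda>x. c * g x) x = c * conv f g x"
    by (simp add: conv_def ac_simps)
qed

lemma conv_diff_right:
  assumes "cont f" "cont g" "cont h"
  shows "conv f (\<lambda>x. g x - h x) = (\<lambda>x. conv f g x - conv f h x)"
  using conv_add_right[of f g "\<lambda>x. (-1) * h x"] conv_cmul_right[of f h "-1"] assms
  by (simp add: continuous_on_minus)

lemma conv_translate_right:
  assumes "cont f" "cont g"
  shows "conv f (\<lambda>x. g (x + a)) = (\<lambda>x. conv f g (x + a))"
proof
  fix x
  have "cont (\<lambda>y. f (x + a - y) * g y)"
    by (intro continuous_intros assms cont_compose[OF assms(1)])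
  from mean_translate[OF this, of a] show "conv f (\<lambda>x. g (x + a)) x = conv f g (x + a)"
    by (simp add: conv_def algebra_simps)
qed

lemma adj_conv:
  assumes "cont f" "cont g"
  shows "adj (conv f g) = conv (adj f) (adj g)"
proof
  fix x
  have c: "cont (\<lambda>y. f (- x - y) * g y)" "cont (\<lambda>y. cnj (f (- x - y)) * cnj (g y))"
    by (intro continuous_intros assms cont_compose[OF assms(1)])+
  show "adj (conv f g) x = conv (adj f) (adj g) x"
    using mean_reflect[OF c(2), of 0] mean_cnj[OF c(1)] by (simp add: conv_def adj_def)
qed

lemma adj_adj [simp]: "adj (adj f) = f"
  by (simp add: adj_def fun_eq_iff)

text \<open>Evaluation at zero acts as a trace for convolution. For self-adjoint \<open>k\<close> it
  turns inner products of convolution powers into values of further powers at zero.\<close>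

lemma conv_adj_0:
  assumes "cont f" "cont g"
  shows "conv f (adj g) 0 = mean (\<lambda>x. f x * cnj (g x))"
  using mean_reflect[of "\<lambda>x. f x * cnj (g x)" 0] assms
  by (simp add: conv_def adj_def continuous_intros)

text \<open>Cauchy-Schwarz after a reflection. Convolution with a fixed function thus upgrades
  convergence in mean square to uniform convergence, which keeps limits continuous.\<close>

lemma norm_conv_le:
  assumes "cont f" "cont g"
  shows "(norm (conv f g x))\<^sup>2 \<le> sqn f * sqn g"
proof -
  have c: "cont (\<lambda>y. f (x - y))" "cont (\<lambda>y. cnj (g y))"
    by (intro continuous_intros assms cont_compose[OF assms(1)])+
  have "sqn (\<lambda>y. f (x - y)) = sqn f"
    unfolding sqn_def using mean_reflect[of "\<lambda>y. f y * cnj (f y)" x] assms by (simp add: continuous_intros)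
  moreover have "sqn (\<lambda>y. cnj (g y)) = sqn g" by (simp add: sqn_def mult.commute)
  ultimately show ?thesis using Cauchy_Schwarz_mean[OF c] by (simp add: conv_def)
qed

lemma sqn_le_bound:
  assumes "cont f" "\<And>x. (norm (f x))\<^sup>2 \<le> B" shows "sqn f \<le> B"
  unfolding sqn_def
  using Re_mean_mono[of "\<lambda>x. f x * cnj (f x)" "\<lambda>_. of_real B"] assms
  by (simp add: continuous_intros complex_norm_square[symmetric] flip: of_real_power)

lemma sqn_conv_le:
  assumes "cont f" "cont g" shows "sqn (conv f g) \<le> sqn f * sqn g"
  by (rule sqn_le_bound[OF cont_conv[OF assms] norm_conv_le[OF assms]])

lemma sqn_diff:
  assumes "cont f" "cont g"
  shows "sqn (\<lambda>x. f x - g x) = sqn f - 2 * Re (mean (\<lambda>x. f x * cnj (g x))) + sqn g"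
proof -
  have c: "cont (\<lambda>x. f x * cnj (f x))" "cont (\<lambda>x. f x * cnj (g x))" "cont (\<lambda>x. g x * cnj (f x))"
    "cont (\<lambda>x. g x * cnj (g x))" using assms by (intro continuous_intros; simp)+
  have "mean (\<lambda>x. g x * cnj (f x)) = cnj (mean (\<lambda>x. f x * cnj (g x)))"
    by (subst mean_cnj[symmetric]) (auto simp: c mult.commute)
  moreover have "mean (\<lambda>x. (f x - g x) * cnj (f x - g x)) = mean (\<lambda>x. f x * cnj (f x))
      - mean (\<lambda>x. f x * cnj (g x)) - mean (\<lambda>x. g x * cnj (f x)) + mean (\<lambda>x. g x * cnj (g x))"
  proof -
    have "(f x - g x) * cnj (f x - g x) = ((f x * cnj (f x) - f x * cnj (g x)) - g x * cnj (f x)) + g x * cnj (g x)" for x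
      by (simp add: algebra_simps)
    then show ?thesis using c by (simp add: mean_add mean_diff continuous_intros)
  qed
  ultimately show ?thesis by (simp add: sqn_def)
qed

end


section \<open>Idempotents and characters\<close>

context compact_ab_group
begin

lemma conv_cmul_left:
  assumes "cont f" "cont g"
  shows "conv (\<lambda>x. c * f x) g = (\<lambda>x. c * conv f g x)"
proof -
  have "cont (\<lambda>x. c * f x)" using assms by (intro continuous_intros)
  then show ?thesis using conv_commute conv_cmul_right assms by metis
qed

lemma tendsto_conv:
  assumes "cont g" "\<And>n. cont (v n)" "cont e" "uniform_limit UNIV v e sequentially"
  shows "(\<lambda>n. conv g (v n) x) \<longlonglongrightarrow> conv g e x"
proof (rule tendstoI)
  fix r :: real assume "r > 0"
  obtain B where B: "B > 0" "\<And>x. norm (g x) \<le> B" using bounded_continuous[OF assms(1)] by blast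
  have "r / (2 * B) > 0" using \<open>r > 0\<close> B(1) by simp
  with assms(4) have "\<forall>\<^sub>F n in sequentially. \<forall>y\<in>UNIV. dist (v n y) (e y) < r / (2 * B)"
    by (rule uniform_limitD)
  then show "\<forall>\<^sub>F n in sequentially. dist (conv g (v n) x) (conv g e x) < r"
  proof eventually_elim
    case (elim n)
    have "norm (conv g (v n) x - conv g e x) \<le> B * (r / (2 * B))"
      unfolding conv_def
    proof (rule norm_mean_diff_le)
      show "cont (\<lambda>y. g (x - y) * v n y)" "cont (\<lambda>y. g (x - y) * e y)"
        by (intro continuous_intros assms cont_compose[OF assms(1)])+
      fix y
      have "norm (g (x - y) * v n y - g (x - y) * e y) = norm (g (x - y)) * norm (v n y - e y)"
        by (simp add: norm_mult[symmetric] algebra_simps)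
      also have "\<dots> \<le> B * (r / (2 * B))"
        using elim B by (intro mult_mono) (auto simp: dist_norm less_imp_le)
      finally show "norm (g (x - y) * v n y - g (x - y) * e y) \<le> B * (r / (2 * B))" .
    qed
    then show ?case using B \<open>r > 0\<close> by (simp add: dist_norm)
  qed
qed

definition idem :: "('a \<Rightarrow> complex) \<Rightarrow> bool" where
  "idem e \<longleftrightarrow> cont e \<and> adj e = e \<and> conv e e = e"

text \<open>Power iteration for the self-adjoint operator of convolution by \<open>k\<close>: the
  normalised powers \<open>u n\<close> of \<open>conv k k\<close> converge to the projection to its
  top eigenvalue \<open>lam\<close>. Convergence is extracted from two monotone real sequences,
  \<open>r\<close> and \<open>c\<close>.\<close>

lemma spectral_idempotent:
  assumes ck: "cont k" and sa: "adj k = k" and nz: "k x0 \<noteq> 0"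
  obtains e lam where "idem e" "e 0 \<noteq> 0" "lam > 0"
    "conv (conv k k) e = (\<lambda>x. of_real lam * e x)"
proof -
  define kp where "kp n = (conv k ^^ n) k" for n
  have kp0: "kp 0 = k" and kpS: "kp (Suc n) = conv k (kp n)" for n by (simp_all add: kp_def)
  have ckp: "cont (kp n)" for n by (induction n) (simp_all add: kp0 kpS ck cont_conv)
  have akp: "adj (kp n) = kp n" for n by (induction n) (simp_all add: kp0 kpS ck sa ckp adj_conv)
  have kpp: "conv (kp n) (kp m) = kp (Suc (n + m))" for n m
    by (induction n) (simp_all add: kp0 kpS conv_assoc ck ckp)
  have inner: "mean (\<lambda>x. kp n x * cnj (kp m x)) = kp (Suc (n + m)) 0" for n m
    using conv_adj_0[OF ckp ckp, of n m] by (simp add: akp kpp)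
  define b where "b n = sqn (kp n)" for n
  have kb: "kp (Suc (2 * n)) 0 = of_real (b n)" for n
    using mean_sq[OF ckp, of n] inner[of n n] by (simp add: b_def mult_2)
  have logconv: "(b (Suc n))\<^sup>2 \<le> b n * b (Suc (Suc n))" for n
    using Cauchy_Schwarz_mean[OF ckp ckp, of n "Suc (Suc n)"] kb[of "Suc n"]
    unfolding inner b_def[symmetric] by (simp add: mult_2)
  have sub: "b (Suc (n + m)) \<le> b n * b m" for n m
    using sqn_conv_le[OF ckp ckp, of n m] by (simp add: kpp b_def)
  have bpos2: "b n > 0 \<and> b (Suc n) > 0" for n
  proof (induction n)
    case 0
    have b0: "b 0 > 0" using sqn_pos[OF ck nz] by (simp add: b_def kp0)
    then have "kp 1 0 \<noteq> 0" using kb[of 0] by simp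
    then show ?case using b0 sqn_pos[OF ckp] by (simp add: b_def)
  next
    case (Suc n)
    then have "0 < b n * b (Suc (Suc n))" using logconv[of n] less_le_trans[OF zero_less_power] by blast
    then show ?case using Suc by (simp add: zero_less_mult_iff)
  qed
  then have bpos: "b n > 0" for n by blast
  \<comment> \<open>Log-convexity of the squared norms makes these quotients increase, and
    submultiplicativity bounds them by \<open>b 0\<close>.\<close>
  define r where "r n = b (Suc n) / b n" for n
  have "incseq r"
    by (rule incseq_SucI) (use logconv bpos in \<open>auto simp: r_def field_simps power2_eq_square\<close>)
  moreover have "r n \<le> b 0" for n
    using sub[of n 0] bpos[of n] by (simp add: r_def field_simps)
  ultimately obtain lam where lam: "r \<longlonglongrightarrow> lam" "\<And>n. r n \<le> lam"
    using incseq_convergent[of r "b 0"] by blast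
  have "r 0 > 0" using bpos by (simp add: r_def)
  then have lpos: "lam > 0" using lam(2)[of 0] by simp
  have quot: "(\<lambda>n. b (n + j) / b n) \<longlonglongrightarrow> lam ^ j" for j
  proof (induction j)
    case 0
    then show ?case using bpos by (simp add: less_imp_neq[symmetric])
  next
    case (Suc j)
    have "(\<lambda>n. r (n + j) * (b (n + j) / b n)) \<longlonglongrightarrow> lam * lam ^ j"
      by (intro tendsto_mult LIMSEQ_ignore_initial_segment lam Suc)
    moreover have "r (n + j) * (b (n + j) / b n) = b (n + Suc j) / b n" for n
      using bpos[of "n + j"] by (simp add: r_def)
    ultimately show ?case by (simp only: power_Suc)
  qed
  \<comment> \<open>Divide \<open>b (Suc (n + m)) \<le> b n * b m\<close> by \<open>b n\<close> and
    let \<open>n\<close> grow. This keeps the normalised norms \<open>c\<close> at least one, so the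
    limit idempotent does not vanish.\<close>
  have bge: "lam ^ Suc m \<le> b m" for m
  proof (rule LIMSEQ_le_const2[OF quot])
    show "\<exists>N. \<forall>n\<ge>N. b (n + Suc m) / b n \<le> b m"
      using sub[of _ m] bpos by (auto simp: field_simps)
  qed
  define c where "c n = b n / lam ^ Suc n" for n
  have cge: "c n \<ge> 1" for n using bge[of n] lpos by (simp add: c_def field_simps)
  have "decseq c"
  proof (rule decseq_SucI)
    fix n
    have "b (Suc n) \<le> lam * b n" using lam(2)[of n] bpos[of n] by (simp add: r_def field_simps)
    then show "c (Suc n) \<le> c n" using lpos by (simp add: c_def field_simps)
  qed
  then obtain L where L: "c \<longlonglongrightarrow> L" using decseq_convergent[of c 1] cge by blast
  \<comment> \<open>As \<open>kp n\<close> is the convolution power of exponent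
    \<open>n + 1\<close>, this is the power of exponent \<open>n + 1\<close> of
    \<open>conv k k\<close> divided by \<open>lam\<close>. Only even powers of \<open>k\<close>
    occur, so the values at zero are squared norms.\<close>
  define u where "u n = (\<lambda>x. of_real (1 / lam ^ Suc n) * kp (Suc (2 * n)) x)" for n
  have cu: "cont (u n)" for n unfolding u_def by (intro continuous_intros ckp)
  have uu: "conv (u n) (u m) = u (Suc (n + m))" for n m
  proof -
    have "conv (u n) (u m) = (\<lambda>x. of_real (1 / lam ^ Suc n) * (of_real (1 / lam ^ Suc m) *
        kp (Suc (Suc (2 * n) + Suc (2 * m))) x))"
      unfolding u_def conv_cmul_left[OF ckp cu[unfolded u_def]] conv_cmul_right[OF ckp ckp] kpp ..
    also have "\<dots> = u (Suc (n + m))"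
      unfolding u_def by (simp add: fun_eq_iff power_add field_simps)
    finally show ?thesis .
  qed
  have au: "adj (u n) = u n" for n
    using akp[of "Suc (2 * n)"] unfolding u_def adj_def by (simp add: fun_eq_iff)
  have u0: "u n 0 = of_real (c n)" for n
    unfolding u_def by (simp add: kb c_def del: mult_Suc_right)
  have innu: "mean (\<lambda>x. u n x * cnj (u m x)) = of_real (c (Suc (n + m)))" for n m
    using conv_adj_0[OF cu cu, of n m] by (simp add: au uu u0)
  have D: "sqn (\<lambda>x. u n x - u m x) = c (Suc (2 * n)) - 2 * c (Suc (n + m)) + c (Suc (2 * m))" for n m
    unfolding sqn_diff[OF cu cu] sqn_def innu by (simp add: mult_2[symmetric])
  \<comment> \<open>Convolving with \<open>u 0\<close> raises both indices by one; this shift is the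
    price for passing from mean square to uniform estimates.\<close>
  have stepu: "(norm (u (Suc n) x - u (Suc m) x))\<^sup>2 \<le> sqn (u 0) * sqn (\<lambda>x. u n x - u m x)" for n m x
  proof -
    have "conv (u 0) (\<lambda>x. u n x - u m x) = (\<lambda>x. u (Suc n) x - u (Suc m) x)"
      using conv_diff_right[OF cu cu cu, of 0 n m] by (simp add: uu)
    then show ?thesis using norm_conv_le[OF cu continuous_on_diff[OF cu cu], of 0 n m x] by simp
  qed
  have "uniformly_Cauchy_on UNIV (\<lambda>n. u (Suc n))"
    unfolding uniformly_Cauchy_on_def
  proof (intro allI impI)
    fix \<epsilon> :: real assume "\<epsilon> > 0"
    define K where "K = sqn (u 0) + 1"
    have "K > 0" using sqn_nonneg[OF cu, of 0] by (simp add: K_def)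
    \<comment> \<open>The values of \<open>c\<close> enter with weights one, two, one, each off from
      \<open>L\<close> by less than \<delta>, hence the factor four; the eight leaves half of
      \<open>\<epsilon>\<^sup>2\<close> to spare.\<close>
    define \<delta> where "\<delta> = \<epsilon>\<^sup>2 / (8 * K)"
    have "\<delta> > 0" using \<open>\<epsilon> > 0\<close> \<open>K > 0\<close> by (simp add: \<delta>_def)
    then obtain M where M: "\<And>n. n \<ge> M \<Longrightarrow> \<bar>c n - L\<bar> < \<delta>"
      using L unfolding LIMSEQ_def dist_real_def by blast
    have "dist (u (Suc m) x) (u (Suc n) x) < \<epsilon>" if "m \<ge> M" "n \<ge> M" for m n x
    proof -
      have "sqn (\<lambda>x. u m x - u n x) \<le> 4 * \<delta>"
        using M[of "Suc (2 * m)"] M[of "Suc (m + n)"] M[of "Suc (2 * n)"] that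
        unfolding D by simp
      then have "sqn (u 0) * sqn (\<lambda>x. u m x - u n x) \<le> K * (4 * \<delta>)"
        using \<open>K > 0\<close> sqn_nonneg[OF continuous_on_diff[OF cu cu], of m n]
        by (intro mult_mono) (auto simp: K_def)
      also have "\<dots> < \<epsilon>\<^sup>2" using \<open>K > 0\<close> \<open>\<epsilon> > 0\<close> by (simp add: \<delta>_def)
      finally have "(norm (u (Suc m) x - u (Suc n) x))\<^sup>2 < \<epsilon>\<^sup>2" using stepu[of m x n] by simp
      then show ?thesis using \<open>\<epsilon> > 0\<close> unfolding dist_norm by (simp add: power2_less_imp_less)
    qed
    then show "\<exists>M. \<forall>x\<in>UNIV. \<forall>m\<ge>M. \<forall>n\<ge>M. dist (u (Suc m) x) (u (Suc n) x) < \<epsilon>" by blast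
  qed
  then have "uniformly_convergent_on UNIV (\<lambda>n. u (Suc n))"
    by (rule Cauchy_uniformly_convergent)
  then obtain e where ul: "uniform_limit UNIV (\<lambda>n. u (Suc n)) e sequentially"
    unfolding uniformly_convergent_on_def by blast
  have ce: "cont e" by (rule uniform_limit_theorem[OF _ ul]) (auto simp: cu)
  have pt: "(\<lambda>n. u (Suc n) x) \<longlonglongrightarrow> e x" for x using tendsto_uniform_limitI[OF ul] by blast
  have ue: "conv (u m) e = e" for m
  proof
    fix x
    have "(\<lambda>n. conv (u m) (u (Suc n)) x) \<longlonglongrightarrow> conv (u m) e x"
      by (rule tendsto_conv[OF cu cu ce ul])
    moreover have "(\<lambda>n. u (Suc (n + Suc m)) x) \<longlonglongrightarrow> e x"
      using LIMSEQ_ignore_initial_segment[OF pt[of x], of "Suc m"] by simp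
    ultimately show "conv (u m) e x = e x"
      using LIMSEQ_unique[of "\<lambda>n. u (Suc (n + Suc m)) x"] by (simp add: uu add.commute)
  qed
  have "conv e e = e"
  proof
    fix x
    have "(\<lambda>n. conv e (u (Suc n)) x) \<longlonglongrightarrow> conv e e x"
      by (rule tendsto_conv[OF ce cu ce ul])
    then show "conv e e x = e x" using LIMSEQ_unique[OF _ tendsto_const] by (simp add: conv_commute[OF ce cu] ue)
  qed
  moreover have "adj e = e"
  proof
    fix x
    have "(\<lambda>n. cnj (u (Suc n) (- x))) \<longlonglongrightarrow> adj e x"
      unfolding adj_def by (intro tendsto_cnj pt)
    moreover have "cnj (u (Suc n) (- x)) = u (Suc n) x" for n
      using fun_cong[OF au[of "Suc n"], of x] by (simp add: adj_def)
    ultimately show "adj e x = e x" using LIMSEQ_unique[OF _ pt] by simp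
  qed
  ultimately have ie: "idem e" using ce by (simp add: idem_def)
  have "(\<lambda>n. complex_of_real (c (Suc n))) \<longlonglongrightarrow> e 0" using pt[of 0] by (simp add: u0)
  then have "(\<lambda>n. c (Suc n)) \<longlonglongrightarrow> Re (e 0)" using tendsto_Re by fastforce
  then have "1 \<le> Re (e 0)" by (rule LIMSEQ_le_const) (use cge in auto)
  then have e0: "e 0 \<noteq> 0" by auto
  have "conv (u 0) e = (\<lambda>x. of_real (1 / lam) * conv (conv k k) e x)"
    unfolding u_def using conv_cmul_left[OF ckp ce, of "of_real (1 / lam)" 1] by (simp add: kpS kp0)
  then have "conv (conv k k) e = (\<lambda>x. of_real lam * e x)"
    using ue[of 0] lpos by (auto simp: fun_eq_iff field_simps)
  then show ?thesis using that[OF ie e0 lpos] by blast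
qed

lemma idem_0: "idem e \<Longrightarrow> e 0 = of_real (sqn e)"
  using conv_adj_0[of e e] mean_sq[of e] by (simp add: idem_def)

lemma idem_sqn_ge_1:
  assumes "idem e" "e x \<noteq> 0" shows "sqn e \<ge> 1"
proof -
  have c: "cont e" "conv e e = e" using assms by (auto simp: idem_def)
  have pos: "sqn e > 0" using sqn_pos[OF c(1) assms(2)] .
  have "sqn e \<le> sqn e * sqn e" using sqn_conv_le[OF c(1) c(1)] c(2) by simp
  then show ?thesis using pos by simp
qed

text \<open>The integer part of \<open>sqn\<close> plays the role of a rank. Since
  \<open>sqn\<close> of an idempotent is its value at zero, it is additive, and a proper idempotent
  \<open>e'\<close> below \<open>e\<close> loses \<open>sqn (e - e') \<ge> 1\<close>, which lowers
  the integer part.\<close>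

lemma minimal_idempotent:
  assumes "idem e0" "e0 \<noteq> (\<lambda>_. 0)"
  obtains e where "idem e" "e \<noteq> (\<lambda>_. 0)" "conv e0 e = e"
    "\<And>e'. idem e' \<Longrightarrow> e' \<noteq> (\<lambda>_. 0) \<Longrightarrow> conv e e' = e' \<Longrightarrow> e' = e"
proof -
  define P where "P e \<longleftrightarrow> idem e \<and> e \<noteq> (\<lambda>_. 0) \<and> conv e0 e = e" for e
  have "P e0" using assms by (auto simp: P_def idem_def)
  then obtain e where e: "P e" "\<And>e'. P e' \<Longrightarrow> nat \<lfloor>sqn e\<rfloor> \<le> nat \<lfloor>sqn e'\<rfloor>"
    using ex_has_least_nat[of P e0 "\<lambda>e. nat \<lfloor>sqn e\<rfloor>"] by blast
  have ie: "cont e" "adj e = e" "conv e e = e" "conv e0 e = e" "cont e0"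
    using e(1) assms by (auto simp: P_def idem_def)
  have "e' = e" if e': "idem e'" "e' \<noteq> (\<lambda>_. 0)" "conv e e' = e'" for e'
  proof (rule ccontr)
    assume "e' \<noteq> e"
    have ie': "cont e'" "adj e' = e'" "conv e' e' = e'" using e' by (auto simp: idem_def)
    have ee': "conv e' e = e'" using e'(3) conv_commute ie ie' by simp
    define d where "d x = e x - e' x" for x
    have cd: "cont d" unfolding d_def by (intro continuous_intros ie ie')
    have ed: "conv e d = d" "conv e' d = (\<lambda>_. 0)"
      unfolding d_def conv_diff_right[OF ie(1) ie(1) ie'(1)] conv_diff_right[OF ie'(1) ie(1) ie'(1)]
      by (simp_all add: ie ie' e'(3) ee')
    have "conv d d = d"
    proof -
      have "conv d d = (\<lambda>x. conv d e x - conv d e' x)"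
        using conv_diff_right[OF cd ie(1) ie'(1)] by (simp add: d_def[abs_def])
      then show ?thesis using ed by (simp add: conv_commute[OF cd ie(1)] conv_commute[OF cd ie'(1)])
    qed
    moreover have "adj d x = d x" for x
      using fun_cong[OF ie(2), of x] fun_cong[OF ie'(2), of x] by (simp add: adj_def d_def)
    ultimately have "idem d" using cd by (auto simp: idem_def)
    moreover from \<open>e' \<noteq> e\<close> obtain x where "e' x \<noteq> e x" by (auto simp: fun_eq_iff)
    then have "d x \<noteq> 0" by (simp add: d_def)
    ultimately have d1: "sqn d \<ge> 1" by (rule idem_sqn_ge_1)
    have "complex_of_real (sqn d) = of_real (sqn e) - of_real (sqn e')"
      using idem_0[OF \<open>idem d\<close>] idem_0[OF e'(1)] idem_0[of e] e(1) by (simp add: d_def P_def)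
    then have sq: "sqn d = sqn e - sqn e'" by (metis of_real_diff of_real_eq_iff)
    have "conv e0 e' = e'" using conv_assoc[OF ie(5) ie(1) ie'(1)] by (simp add: e'(3) ie(4))
    then have "P e'" using e' by (simp add: P_def)
    from e(2)[OF this] show False using d1 sq sqn_nonneg[OF ie'(1)] by linarith
  qed
  then show ?thesis using that[of e] e(1) by (auto simp: P_def)
qed

text \<open>Minimality makes the ideal cut out by \<open>e\<close> one-dimensional. For self-adjoint
  \<open>h\<close> in it, the spectral idempotent of \<open>h\<close> lies below \<open>e\<close>,
  hence is \<open>e\<close>, and its eigenvalue equation says that \<open>conv h h\<close> is a
  multiple of \<open>e\<close>. An arbitrary \<open>h\<close> splits into self-adjoint parts
  \<open>p\<close> and \<open>q\<close>.\<close>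

lemma minimal_idempotent_conv:
  assumes ie: "idem e" and nz: "e \<noteq> (\<lambda>_. 0)"
    and min: "\<And>e'. idem e' \<Longrightarrow> e' \<noteq> (\<lambda>_. 0) \<Longrightarrow> conv e e' = e' \<Longrightarrow> e' = e"
    and ch: "cont h"
  shows "\<exists>c. conv e h = (\<lambda>x. c * e x)"
proof -
  have ce: "cont e" "adj e = e" "conv e e = e" using ie by (auto simp: idem_def)
  have sq: "\<exists>c. conv h h = (\<lambda>x. c * e x)" if h: "cont h" "adj h = h" "conv e h = h" for h
  proof (cases "\<exists>x. h x \<noteq> 0")
    case False
    then have "conv h h = (\<lambda>x. 0 * e x)" by (simp add: conv_def fun_eq_iff)
    then show ?thesis by blast
  next
    case True
    then obtain x0 where "h x0 \<noteq> 0" by blast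
    from spectral_idempotent[OF h(1,2) this] obtain e' lam where e': "idem e'" "e' 0 \<noteq> 0" "lam > 0"
      "conv (conv h h) e' = (\<lambda>x. of_real lam * e' x)" by blast
    have ce': "cont e'" using e' by (simp add: idem_def)
    have chh: "cont (conv h h)" by (intro cont_conv h)
    have "(\<lambda>x. of_real lam * conv e e' x) = conv e (conv (conv h h) e')"
      by (simp add: e'(4) conv_cmul_right[OF ce(1) ce'])
    also have "\<dots> = conv (conv h h) e'"
      by (simp add: conv_assoc[symmetric] chh ce ce' h cont_conv)
    finally have "conv e e' = e'" using e'(3,4) by (auto simp: fun_eq_iff)
    then have "e' = e" by (intro min) (use e' in auto)
    moreover have "conv (conv h h) e = conv h h"
      using h by (simp add: conv_assoc ce conv_commute[OF h(1) ce(1)])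
    ultimately show ?thesis using e'(4) by auto
  qed
  have sa: "\<exists>c. conv e p = (\<lambda>x. c * e x)" if p: "cont p" "adj p = p" for p
  proof -
    define h where "h = conv e p"
    have h: "cont h" "adj h = h" "conv e h = h"
      unfolding h_def by (simp_all add: cont_conv ce p adj_conv conv_assoc[symmetric])
    \<comment> \<open>Linearises the square: under convolution the square of \<open>h + e\<close> is
      that of \<open>h\<close> plus \<open>2 h + e\<close>. Both squares are multiples of
      \<open>e\<close>, hence so is \<open>h\<close>.\<close>
    define g where "g x = h x + e x" for x
    have cg: "cont g" unfolding g_def by (intro continuous_intros h ce)
    have "adj g x = g x" for x
      using fun_cong[OF h(2), of x] fun_cong[OF ce(2), of x] by (simp add: adj_def g_def)
    moreover have eg: "conv e g = g"
      using conv_add_right[OF ce(1) h(1) ce(1)] by (simp add: g_def[abs_def] h ce)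
    ultimately obtain c where c: "conv g g = (\<lambda>x. c * e x)" using sq[of g] cg by blast
    obtain c' where c': "conv h h = (\<lambda>x. c' * e x)" using sq[OF h] by blast
    have he: "conv h e = h" using h conv_commute ce by simp
    have gh: "conv g h = (\<lambda>x. c' * e x + h x)"
      using conv_add_right[OF h(1) h(1) ce(1)] unfolding conv_commute[OF cg h(1)]
      by (simp add: g_def[abs_def] c' he)
    have "conv g g = (\<lambda>x. conv g h x + conv g e x)"
      using conv_add_right[OF cg h(1) ce(1)] by (simp add: g_def[abs_def])
    then have "c * e x = c' * e x + h x + (h x + e x)" for x
      using c gh eg conv_commute[OF cg ce(1)] by (auto simp: fun_eq_iff g_def)
    then have "h x = ((c - c' - 1) / 2) * e x" for x by (simp add: field_simps)
    then show ?thesis unfolding h_def by blast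
  qed
  define p where "p x = (h x + adj h x) / 2" for x
  define q where "q x = (h x - adj h x) / (2 * \<i>)" for x
  have cpq: "cont p" "cont q"
    unfolding p_def q_def by (intro continuous_intros cont_adj ch; simp)+
  have "adj p = p" "adj q = q"
    by (auto simp: adj_def p_def q_def fun_eq_iff field_simps)
  then obtain c d where cd: "conv e p = (\<lambda>x. c * e x)" "conv e q = (\<lambda>x. d * e x)" using sa cpq by metis
  have "h = (\<lambda>x. p x + \<i> * q x)" by (auto simp: p_def q_def fun_eq_iff field_simps)
  then have "conv e h = (\<lambda>x. conv e p x + \<i> * conv e q x)"
    using conv_add_right[OF ce(1) cpq(1), of "\<lambda>x. \<i> * q x"] conv_cmul_right[OF ce(1) cpq(2), of \<i>] cpq(2)
    by (simp add: continuous_intros)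
  then have "conv e h = (\<lambda>x. (c + \<i> * d) * e x)" by (simp add: cd algebra_simps)
  then show ?thesis by blast
qed

text \<open>Convolution commutes with translation, so a translate of \<open>e\<close> is again fixed
  by \<open>conv e\<close> and thus a multiple of \<open>e\<close>. After division by
  \<open>e 0\<close> this is multiplicativity, and \<open>adj e = e\<close> gives modulus
  one.\<close>

lemma minimal_idempotent_character:
  assumes ie: "idem e" and nz: "e \<noteq> (\<lambda>_. 0)"
    and min: "\<And>e'. idem e' \<Longrightarrow> e' \<noteq> (\<lambda>_. 0) \<Longrightarrow> conv e e' = e' \<Longrightarrow> e' = e"
  shows "is_char (\<lambda>x. e x / e 0)"
proof -
  have ce: "cont e" "adj e = e" "conv e e = e" using ie by (auto simp: idem_def)
  obtain x0 where "e x0 \<noteq> 0" using nz by auto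
  then have "sqn e > 0" using sqn_pos ce by blast
  then have e0: "e 0 \<noteq> 0" using idem_0[OF ie] by simp
  have mult: "e (x + a) * e 0 = e x * e a" for x a
  proof -
    have "cont (\<lambda>x. e (x + a))" by (intro cont_compose[OF ce(1)] continuous_intros)
    from minimal_idempotent_conv[OF ie nz min this]
    obtain c where "conv e (\<lambda>x. e (x + a)) = (\<lambda>x. c * e x)" by blast
    then have *: "e (x + a) = c * e x" for x
      unfolding conv_translate_right[OF ce(1) ce(1)] ce(3) by (rule fun_cong)
    show ?thesis using *[of x] *[of 0] by simp
  qed
  have "norm (e a / e 0) = 1" for a
  proof -
    have "e (- a) = cnj (e a)" using fun_cong[OF ce(2), of "- a"] by (simp add: adj_def)
    moreover have "cnj (e 0) = e 0" using idem_0[OF ie] by simp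
    ultimately have "e a * cnj (e a) = e 0 * cnj (e 0)" using mult[of a "- a"] by (simp add: mult.commute)
    then have "complex_of_real ((norm (e a))\<^sup>2) = of_real ((norm (e 0))\<^sup>2)"
      unfolding complex_norm_square .
    then have "norm (e a) = norm (e 0)" using of_real_eq_iff power2_eq_iff_nonneg norm_ge_zero by blast
    then show ?thesis using e0 by (simp add: norm_divide)
  qed
  moreover have "cont (\<lambda>x. e x / e 0)" by (intro continuous_intros ce) (simp add: e0)
  moreover have "e (a + b) / e 0 = e a / e 0 * (e b / e 0)" for a b
    using mult[of a b] e0 by (simp add: field_simps)
  ultimately show ?thesis unfolding is_char_def by blast
qed

lemma continuous_separation:
  fixes a b :: 'a assumes "a \<noteq> b"
  obtains \<phi> where "cont \<phi>" "\<phi> a \<noteq> \<phi> b"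
proof -
  have "Hausdorff_space (euclidean :: 'a topology)"
    unfolding Hausdorff_space_def using hausdorff by (auto simp: disjnt_def)
  moreover have "compact_space (euclidean :: 'a topology)"
    using compact_UNIV by (simp add: compact_space_def)
  ultimately have "normal_space (euclidean :: 'a topology)"
    using compact_Hausdorff_or_regular_imp_normal_space by blast
  then obtain f where f: "continuous_map euclidean (top_of_set {0..1::real}) f"
     "f ` {a} \<subseteq> {0}" "f ` {b} \<subseteq> {1}"
    by (rule Urysohn_lemma[of euclidean "{a}" "{b}" 0 1]) (use assms in auto)
  have "continuous_on UNIV f" using f(1) by (simp add: continuous_map_in_subtopology)
  then have "cont (\<lambda>x. complex_of_real (f x))" by (intro continuous_intros)
  then show ?thesis by (rule that) (use f in auto)
qed

theorem characters_separate_points: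
  fixes g :: 'a assumes "g \<noteq> 0"
  obtains \<xi> where "is_char \<xi>" "\<xi> g \<noteq> 1"
proof -
  obtain \<phi> where \<phi>: "cont \<phi>" "\<phi> 0 \<noteq> \<phi> g" by (rule continuous_separation[OF assms[symmetric]])
  \<comment> \<open>A function invariant under translation by \<open>g\<close> has zero convolution
    with \<open>h\<close>. A character found below the spectral idempotent of
    \<open>conv h (adj h)\<close> therefore cannot be trivial at \<open>g\<close>.\<close>
  define h where "h x = \<phi> x - \<phi> (x + g)" for x
  have c\<phi>g: "cont (\<lambda>x. \<phi> (x + g))" by (intro cont_compose[OF \<phi>(1)] continuous_intros)
  have ch: "cont h" unfolding h_def by (intro continuous_intros \<phi>(1) c\<phi>g)
  define k where "k = conv h (adj h)"
  have ck: "cont k" unfolding k_def by (intro cont_conv ch cont_adj)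
  have "adj k = k" unfolding k_def by (simp add: adj_conv ch cont_adj conv_commute)
  moreover have "k 0 \<noteq> 0"
    unfolding k_def conv_adj_0[OF ch ch] mean_sq[OF ch] using sqn_pos[OF ch, of 0] \<phi>(2) by (simp add: h_def)
  ultimately obtain e0 lam where e0: "idem e0" "e0 0 \<noteq> 0" "lam > 0"
    "conv (conv k k) e0 = (\<lambda>x. of_real lam * e0 x)"
    using spectral_idempotent[OF ck] by blast
  have "e0 \<noteq> (\<lambda>_. 0)" using e0(2) by auto
  then obtain e where e: "idem e" "e \<noteq> (\<lambda>_. 0)" "conv e0 e = e"
    "\<And>e'. idem e' \<Longrightarrow> e' \<noteq> (\<lambda>_. 0) \<Longrightarrow> conv e e' = e' \<Longrightarrow> e' = e"
    using minimal_idempotent[OF e0(1)] by blast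
  have ce: "cont e" "cont e0" using e(1) e0(1) by (auto simp: idem_def)
  have "is_char (\<lambda>x. e x / e 0)" by (rule minimal_idempotent_character[OF e(1,2,4)])
  moreover have "e g / e 0 \<noteq> 1"
  proof
    assume *: "e g / e 0 = 1"
    have "e (x + g) / e 0 = e x / e 0 * (e g / e 0)" for x
      using \<open>is_char (\<lambda>x. e x / e 0)\<close> unfolding is_char_def by blast
    then have per: "e (x + g) = e x" for x using * by (cases "e 0 = 0") auto
    have "conv \<phi> e (x + g) = conv \<phi> e x" for x
      using fun_cong[OF conv_translate_right[OF \<phi>(1) ce(1), of g], of x] by (simp add: per)
    then have "conv e h = (\<lambda>_. 0)"
      unfolding h_def conv_diff_right[OF ce(1) \<phi>(1) c\<phi>g] conv_translate_right[OF ce(1) \<phi>(1)]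
      by (simp add: conv_commute[OF ce(1) \<phi>(1)])
    then have "conv e k = conv (\<lambda>_. 0) (adj h)"
      unfolding k_def by (simp add: conv_assoc[symmetric] ce ch cont_adj)
    then have "conv k e = (\<lambda>_. 0)" by (simp add: conv_commute[OF ck ce(1)] conv_def fun_eq_iff)
    then have "conv (conv k k) e = (\<lambda>_. 0)"
      by (simp add: conv_assoc ck ce) (simp add: conv_def fun_eq_iff)
    \<comment> \<open>Being below \<open>e0\<close>, the idempotent \<open>e\<close> inherits the
      eigenvalue equation.\<close>
    moreover have "conv (conv k k) e = (\<lambda>x. of_real lam * e x)"
    proof -
      have "conv (conv k k) e = conv (conv (conv k k) e0) e"
        by (simp add: conv_assoc ck ce cont_conv e(3))
      then show ?thesis by (simp add: e0(4) conv_cmul_left[OF ce(2) ce(1)] e(3))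
    qed
    ultimately show False using e(2) e0(3) by (auto simp: fun_eq_iff)
  qed
  ultimately show ?thesis by (rule that)
qed

end


section \<open>The dual embedding\<close>

text \<open>The operator \<open>p(\<sigma>)\<close> on two-sided sequences, over any commutative
  ring so that integral, real and complex solutions share one algebra.\<close>

definition pact :: "'b::comm_ring_1 poly \<Rightarrow> (int \<Rightarrow> 'b) \<Rightarrow> int \<Rightarrow> 'b" where
  "pact p w n = (\<Sum>i\<le>degree p. coeff p i * w (n + int i))"

lemma pact_altdef:
  assumes "degree p \<le> N" shows "pact p w n = (\<Sum>i\<le>N. coeff p i * w (n + int i))"
  unfolding pact_def by (rule sum.mono_neutral_left) (use assms in \<open>auto simp: coeff_eq_0\<close>)

lemma pact_0 [simp]: "pact 0 w n = 0" by (simp add: pact_def)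

lemma pact_add: "pact (p + q) w n = pact p w n + pact q w n"
proof -
  define N where "N = max (degree p) (degree q)"
  have "degree (p + q) \<le> N" "degree p \<le> N" "degree q \<le> N"
    by (auto simp: N_def degree_add_le_max)
  then show ?thesis by (simp add: pact_altdef[where N = N] sum.distrib distrib_right)
qed

lemma pact_smult: "pact (smult a q) w n = a * pact q w n"
proof -
  have "degree (smult a q) \<le> degree q" by (rule degree_smult_le)
  then show ?thesis by (simp add: pact_altdef[where N = "degree q"] sum_distrib_left mult.assoc)
qed

lemma pact_pCons: "pact (pCons a p) w n = a * w n + pact p w (n + 1)"
proof -
  have "pact (pCons a p) w n = (\<Sum>i\<le>Suc (degree p). coeff (pCons a p) i * w (n + int i))"
    by (rule pact_altdef) (rule degree_pCons_le)
  also have "\<dots> = a * w n + (\<Sum>i\<le>degree p. coeff p i * w (n + 1 + int i))"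
    by (subst sum.atMost_Suc_shift) (simp add: add.assoc)
  finally show ?thesis by (simp add: pact_def)
qed

lemma pact_mult: "pact (p * q) w n = pact p (pact q w) n"
  by (induction p arbitrary: n) (simp_all add: pact_add pact_smult pact_pCons)

lemma pact_seq_add: "pact p (\<lambda>n. v n + w n) n = pact p v n + pact p w n"
  by (simp add: pact_def sum.distrib distrib_left)

lemma pact_seq_cmul: "pact p (\<lambda>n. c * w n) n = c * pact p w n"
  by (simp add: pact_def sum_distrib_left mult_ac)

lemma coeff_of_int_poly [simp]:
  "coeff (map_poly (of_int :: int \<Rightarrow> 'b::ring_1) p) i = of_int (coeff p i)"
  by (simp add: coeff_map_poly)

lemma degree_of_int_poly [simp]:
  "degree (map_poly (of_int :: int \<Rightarrow> 'b::ring_char_0) p) = degree p"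
  by (rule degree_map_poly) simp

lemma of_int_poly_mult:
  "map_poly (of_int :: int \<Rightarrow> 'b::comm_ring_1) (p * q) = map_poly of_int p * map_poly of_int q"
  by (rule poly_eqI) (simp add: coeff_mult)

lemma pact_Ints:
  fixes w :: "int \<Rightarrow> 'b::{comm_ring_1,ring_char_0}"
  assumes "\<And>n. w n \<in> \<int>" shows "pact (map_poly of_int p) w n \<in> \<int>"
  unfolding pact_def by (intro Ints_sum Ints_mult) (auto simp: assms)

section \<open>Trigonometric polynomials and peak functions\<close>

inductive trig :: "int set \<Rightarrow> ((int \<Rightarrow> complex) \<Rightarrow> complex) \<Rightarrow> bool" for J where
  trig_mono: "(\<And>z. (\<And>n. norm (z n) = 1) \<Longrightarrow> F z = (\<Prod>n\<in>J. z n powi c n)) \<Longrightarrow> trig J F"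
| trig_add: "trig J F \<Longrightarrow> trig J H \<Longrightarrow> trig J (\<lambda>z. F z + H z)"
| trig_cmul: "trig J F \<Longrightarrow> trig J (\<lambda>z. a * F z)"

text \<open>On unimodular sequences no coordinate vanishes, so integer exponents add. This is why
  \<open>trig_mono\<close> asks for the product formula only there.\<close>

lemma trig_mult_mono:
  assumes "trig J F" "\<And>z. (\<And>n. norm (z n) = 1) \<Longrightarrow> H z = (\<Prod>n\<in>J. z n powi c n)"
  shows "trig J (\<lambda>z. F z * H z)"
  using assms(1)
proof (induction rule: trig.induct)
  case (trig_mono F d)
  show ?case
  proof (rule trig.trig_mono[where c = "\<lambda>n. d n + c n"])
    fix z :: "int \<Rightarrow> complex" assume z: "\<And>n. norm (z n) = 1"
    then have "z n \<noteq> 0" for n by (metis norm_zero zero_neq_one)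
    then show "F z * H z = (\<Prod>n\<in>J. z n powi (d n + c n))"
      using trig_mono[OF z] assms(2)[OF z] by (simp add: power_int_add prod.distrib)
  qed
next
  case (trig_add F1 F2)
  then show ?case using trig.trig_add by (simp add: distrib_right)
next
  case (trig_cmul F a)
  then show ?case using trig.trig_cmul[of J "\<lambda>z. F z * H z" a] by (simp add: mult.assoc)
qed

lemma trig_mult:
  assumes "trig J F" "trig J H" shows "trig J (\<lambda>z. F z * H z)"
  using assms(2)
proof (induction rule: trig.induct)
  case (trig_mono H c)
  show ?case by (rule trig_mult_mono[OF assms(1) trig_mono])
next
  case (trig_add F1 F2)
  then show ?case using trig.trig_add by (simp add: distrib_left)
next
  case (trig_cmul H a)
  then show ?case using trig.trig_cmul[of J "\<lambda>z. F z * H z" a] by (simp add: mult.left_commute)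
qed

lemma trig_1: "trig J (\<lambda>_. 1)"
  by (rule trig_mono[where c = "\<lambda>_. 0"]) simp

lemma trig_power: "trig J F \<Longrightarrow> trig J (\<lambda>z. F z ^ M)"
  by (induction M) (simp_all add: trig_1 trig_mult)

lemma trig_prod: "finite S \<Longrightarrow> (\<And>n. n \<in> S \<Longrightarrow> trig J (F n)) \<Longrightarrow> trig J (\<lambda>z. \<Prod>n\<in>S. F n z)"
  by (induction S rule: finite_induct) (simp_all add: trig_1 trig_mult)

lemma trig_coord:
  assumes "finite J" "n \<in> J" shows "trig J (\<lambda>z. z n powi k)"
proof (rule trig_mono[where c = "\<lambda>m. if m = n then k else 0"])
  fix z :: "int \<Rightarrow> complex"
  have "(\<Prod>m\<in>J. z m powi (if m = n then k else 0)) = (\<Prod>m\<in>J. if m = n then z n powi k else 1)"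
    by (rule prod.cong) auto
  then show "z n powi k = (\<Prod>m\<in>J. z m powi (if m = n then k else 0))"
    using assms by (simp add: prod.delta)
qed

text \<open>On the unit circle the factors are \<open>((1 + Re z) / 2) ^ M\<close>, so they peak at \<open>z = 1\<close>.\<close>

definition peak :: "int set \<Rightarrow> nat \<Rightarrow> (int \<Rightarrow> complex) \<Rightarrow> complex" where
  "peak J M z = (\<Prod>n\<in>J. ((1 / 4) * (2 * 1 + (z n powi 1 + z n powi (- 1)))) ^ M)"

lemma trig_peak: "finite J \<Longrightarrow> trig J (peak J M)"
  unfolding peak_def
  by (intro trig_prod trig_power trig_cmul trig_add trig_coord trig_1) auto

lemma unimodular_peak_factor:
  fixes z :: complex
  assumes "norm z = 1"
  shows "(1 / 4) * (2 * 1 + (z powi 1 + z powi (- 1))) = of_real (1 - (norm (z - 1))\<^sup>2 / 4)"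
proof -
  have zz: "z * cnj z = 1" using complex_norm_square[of z] assms by simp
  then have "inverse z = cnj z" by (metis inverse_unique)
  then have *: "z powi 1 + z powi (- 1) = z + cnj z" by (simp add: power_int_minus)
  have "complex_of_real ((norm (z - 1))\<^sup>2) = (z - 1) * cnj (z - 1)" by (rule complex_norm_square)
  also have "\<dots> = 2 - (z + cnj z)" by (simp add: algebra_simps zz)
  finally have "z + cnj z = 2 - complex_of_real ((norm (z - 1))\<^sup>2)" by (simp only: diff_diff_eq2 add_diff_cancel_left')
  then show ?thesis unfolding * by simp
qed

lemma Re_peak:
  assumes "\<And>n. norm (z n) = 1"
  shows "Re (peak J M z) = (\<Prod>n\<in>J. (1 - (norm (z n - 1))\<^sup>2 / 4) ^ M)"
  unfolding peak_def unimodular_peak_factor[OF assms]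
  by (simp only: of_real_power[symmetric] of_real_prod[symmetric] Re_complex_of_real)

lemma unimodular_factor_bounds:
  fixes z :: complex
  assumes "norm z = 1" shows "0 \<le> 1 - (norm (z - 1))\<^sup>2 / 4" "1 - (norm (z - 1))\<^sup>2 / 4 \<le> 1"
proof -
  have "norm (z - 1) \<le> 2" using norm_triangle_ineq4[of z 1] assms by simp
  then have "(norm (z - 1))\<^sup>2 \<le> 2\<^sup>2" by (rule power_mono) simp
  then show "0 \<le> 1 - (norm (z - 1))\<^sup>2 / 4" "1 - (norm (z - 1))\<^sup>2 / 4 \<le> 1" by auto
qed

definition vanishing :: "(int \<Rightarrow> 'b::real_normed_vector) \<Rightarrow> bool" where
  "vanishing s \<longleftrightarrow> (\<forall>\<epsilon>>0. \<exists>N. \<forall>n. \<bar>n\<bar> \<ge> N \<longrightarrow> norm (s n) < \<epsilon>)"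

section \<open>Coordinates given by the orbit of the generating character\<close>

locale cyclic_system = compact_ab_group G
  for G :: "'a::{topological_ab_group_add,t2_space} itself" +
  fixes \<alpha> :: "'a \<Rightarrow> 'a" and f :: "int poly" and \<kappa> :: "'a \<Rightarrow> complex"
  assumes aut: "cont_aut \<alpha>" and char: "is_char \<kappa>"
    and gen: "\<And>\<psi>. is_char \<psi> \<Longrightarrow> \<exists>p k. \<psi> = lact \<alpha> p k \<kappa>"
    and ann: "\<And>p. lact \<alpha> p 0 \<kappa> = (\<lambda>_. 1) \<longleftrightarrow> f dvd p"
begin

lemma apow_Suc: "apow \<alpha> (n + 1) g = \<alpha> (apow \<alpha> n g)"
proof -
  have b: "bij \<alpha>" using aut by (simp add: cont_aut_def)
  show ?thesis
  proof (cases "n \<ge> 0")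
    case True
    then show ?thesis by (simp add: apow_def nat_add_distrib)
  next
    case False
    define k where "k = nat (- (n + 1))"
    have "nat (- n) = Suc k" using False by (simp add: k_def)
    then have "\<alpha> (apow \<alpha> n g) = (inv \<alpha> ^^ k) g"
      using False b by (simp add: apow_def bij_is_surj surj_f_inv_f)
    also have "\<dots> = apow \<alpha> (n + 1) g"
    proof (cases "n = - 1")
      case True then show ?thesis by (simp add: apow_def k_def)
    next
      case 2: False
      then show ?thesis using False by (simp add: apow_def k_def)
    qed
    finally show ?thesis ..
  qed
qed

lemma apow_0 [simp]: "apow \<alpha> 0 g = g"
  by (simp add: apow_def)

lemma apow_add: "apow \<alpha> (m + n) g = apow \<alpha> m (apow \<alpha> n g)"
proof (induction m rule: int_induct[where k = 0])
  case (step1 i)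
  then show ?case using apow_Suc[of "i + n" g] apow_Suc[of i] by (simp add: algebra_simps)
next
  case (step2 i)
  have "inj \<alpha>" using aut by (simp add: cont_aut_def bij_is_inj)
  moreover have "\<alpha> (apow \<alpha> (i - 1 + n) g) = \<alpha> (apow \<alpha> (i - 1) (apow \<alpha> n g))"
    using step2 apow_Suc[of "i - 1 + n" g] apow_Suc[of "i - 1" "apow \<alpha> n g"] by (simp add: algebra_simps)
  ultimately show ?case by (simp add: inj_eq)
qed simp

lemma apow_hom: "apow \<alpha> n (a + b) = apow \<alpha> n a + apow \<alpha> n b"
proof (induction n rule: int_induct[where k = 0])
  case (step1 i)
  then show ?case using aut by (simp add: apow_Suc cont_aut_def)
next
  case (step2 i)
  have "inj \<alpha>" and hom: "\<And>a b. \<alpha> (a + b) = \<alpha> a + \<alpha> b" using aut by (simp_all add: cont_aut_def bij_is_inj)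
  moreover have "\<alpha> (apow \<alpha> (i - 1) (a + b)) = \<alpha> (apow \<alpha> (i - 1) a + apow \<alpha> (i - 1) b)"
    using step2 apow_Suc[of "i - 1"] hom by simp
  ultimately show ?case by (blast dest: injD)
qed simp

lemma apow_zero [simp]: "apow \<alpha> n 0 = 0"
  using apow_hom[of n 0 0] by simp

lemma continuous_apow: "continuous_on UNIV (apow \<alpha> n)"
proof -
  have *: "continuous_on UNIV (h ^^ k)" if "continuous_on UNIV h" for h :: "'a \<Rightarrow> 'a" and k
  proof (induction k)
    case (Suc k)
    then show ?case using continuous_on_compose2[OF that Suc] by (simp add: o_def)
  qed (simp add: id_def)
  show ?thesis using aut *[of \<alpha>] *[of "inv \<alpha>"] by (auto simp: apow_def cont_aut_def)
qed

definition coord :: "int \<Rightarrow> 'a \<Rightarrow> complex" where "coord n g = \<kappa> (apow \<alpha> n g)"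

lemma coord_add: "coord n (a + b) = coord n a * coord n b"
  using char by (simp add: coord_def apow_hom is_char_def)

lemma norm_coord [simp]: "norm (coord n g) = 1"
  using char by (simp add: coord_def is_char_def)

lemma coord_nonzero [simp]: "coord n g \<noteq> 0"
  using norm_coord[of n g] by (metis norm_zero zero_neq_one)

lemma cont_coord: "cont (coord n)"
  unfolding coord_def by (rule cont_compose[OF _ continuous_apow]) (use char in \<open>simp add: is_char_def\<close>)

lemma coord_zero [simp]: "coord n 0 = 1"
  using coord_add[of n 0 0] by simp

lemma coord_diff: "coord n (a - b) = coord n a / coord n b"
  using coord_add[of n "a - b" b] by (simp add: field_simps)

lemma coord_apow: "coord n (apow \<alpha> m g) = coord (n + m) g"
  by (simp add: coord_def apow_add)

lemma coord_eq_1_imp_0: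
  assumes "\<And>n. coord n g = 1" shows "g = 0"
proof (rule ccontr)
  assume "g \<noteq> 0"
  then obtain \<psi> where \<psi>: "is_char \<psi>" "\<psi> g \<noteq> 1" by (rule characters_separate_points)
  then obtain p k where "\<psi> = lact \<alpha> p k \<kappa>" using gen by blast
  then have "\<psi> g = 1" using assms by (simp add: lact_def coord_def)
  with \<psi>(2) show False by simp
qed

lemma coord_inject:
  assumes "\<And>n. coord n g = coord n h" shows "g = h"
proof -
  have "g - h = 0" by (rule coord_eq_1_imp_0) (simp add: coord_diff assms)
  then show ?thesis by simp
qed

text \<open>The open sets \<open>V j\<close> grow with \<open>j\<close>, because \<open>j\<close>
  both widens the index window and narrows the gap; by compactness a single \<open>N\<close> handles
  both. With \<open>t\<close> constantly one this yields neighbourhoods of zero, with a missed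
  sequence it yields the gap used in \<open>coord_surj\<close>.\<close>

lemma coord_separation:
  assumes "closed K" "\<And>g. g \<in> K \<Longrightarrow> \<exists>n. coord n g \<noteq> t n"
  obtains N :: nat where "\<And>g. g \<in> K \<Longrightarrow> \<exists>n. \<bar>n\<bar> \<le> int N \<and> norm (coord n g - t n) > 1 / (real N + 1)"
proof -
  define V where "V j = (\<Union>n\<in>{- int j..int j}. {g. norm (coord n g - t n) > 1 / (real j + 1)})" for j
  have "compact K" using compact_Int_closed[OF compact_UNIV assms(1)] by simp
  moreover have "open (V j)" for j unfolding V_def
    by (intro open_UN ballI open_Collect_less continuous_intros cont_coord)
  moreover have "K \<subseteq> (\<Union>j\<in>UNIV. V j)"
  proof
    fix g assume "g \<in> K"
    then obtain n where "coord n g \<noteq> t n" using assms(2) by blast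
    then obtain m :: nat where m: "inverse (of_nat (Suc m)) < norm (coord n g - t n)"
      using reals_Archimedean[of "norm (coord n g - t n)"] by auto
    define j where "j = max m (nat \<bar>n\<bar>)"
    have "1 / (real j + 1) \<le> inverse (of_nat (Suc m))" by (auto simp: j_def field_simps)
    then have "g \<in> V j" using m by (auto simp: V_def j_def intro!: bexI[of _ n])
    then show "g \<in> (\<Union>j\<in>UNIV. V j)" by blast
  qed
  ultimately obtain D where D: "finite D" "K \<subseteq> (\<Union>j\<in>D. V j)"
    using compactE_image[of K UNIV V] by (metis (no_types, lifting))
  define N where "N = Max (insert 0 D)"
  have "\<exists>n. \<bar>n\<bar> \<le> int N \<and> norm (coord n g - t n) > 1 / (real N + 1)" if "g \<in> K" for g
  proof -
    obtain j where j: "j \<in> D" "g \<in> V j" using D(2) \<open>g \<in> K\<close> by blast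
    have "j \<le> N" using D(1) j(1) by (simp add: N_def)
    then have "1 / (real N + 1) \<le> 1 / (real j + 1)" by (simp add: field_simps)
    moreover obtain n where "n \<in> {- int j..int j}" "norm (coord n g - t n) > 1 / (real j + 1)"
      using j(2) by (auto simp: V_def)
    ultimately show ?thesis using \<open>j \<le> N\<close> by (intro exI[of _ n]) auto
  qed
  then show ?thesis using that by blast
qed

lemma coord_neighbourhood:
  assumes "open U" "0 \<in> U"
  obtains N :: nat and \<epsilon> :: real where "\<epsilon> > 0"
    "\<And>g. (\<And>n. \<bar>n\<bar> \<le> int N \<Longrightarrow> norm (coord n g - 1) < \<epsilon>) \<Longrightarrow> g \<in> U"
proof -
  have "\<exists>n. coord n g \<noteq> 1" if "g \<in> - U" for g
    using coord_eq_1_imp_0[of g] that assms(2) by auto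
  with assms(1) obtain N :: nat where N:
    "\<And>g. g \<in> - U \<Longrightarrow> \<exists>n. \<bar>n\<bar> \<le> int N \<and> norm (coord n g - 1) > 1 / (real N + 1)"
    using coord_separation[of "- U" "\<lambda>_. 1"] by (metis closed_Compl)
  have "g \<in> U" if "\<And>n. \<bar>n\<bar> \<le> int N \<Longrightarrow> norm (coord n g - 1) < 1 / (real N + 1)" for g
    using N[of g] that by force
  then show ?thesis using that[of "1 / (real N + 1)" N] by simp
qed

text \<open>A relation that is trivial on \<Gamma> says that the polynomial of its exponents
  annihilates \<kappa>, hence is a multiple of \<open>f\<close>, hence maps \<open>w\<close> to
  integers. The minus sign is there because \<open>coord_surj\<close> translates the wanted point to
  the identity.\<close>

lemma coord_dual:
  fixes w :: "int \<Rightarrow> real" and c :: "int \<Rightarrow> int" and N :: nat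
  assumes w: "\<And>n. pact (map_poly of_int f) w n \<in> \<int>"
    and one: "\<And>g. (\<Prod>n\<in>{- int N..int N}. coord n g powi c n) = 1"
  shows "(\<Prod>n\<in>{- int N..int N}. cis (- 2 * pi * w n) powi c n) = 1"
proof -
  let ?J = "{- int N..int N}"
  \<comment> \<open>Multiplying by the power \<open>N\<close> of the variable turns exponents
    indexed from \<open>- N\<close> to \<open>N\<close> into a genuine polynomial; the relation is
    then used at the point \<open>apow \<alpha> (int N) g\<close>.\<close>
  define p where "p = (\<Sum>i\<le>2 * N. monom (c (int i - int N)) i)"
  have cp: "coeff p i = (if i \<le> 2 * N then c (int i - int N) else 0)" for i
    by (simp add: p_def coeff_sum)
  have dp: "degree p \<le> 2 * N" by (rule degree_le) (simp add: cp)
  have bij: "bij_betw (\<lambda>i. int i - int N) {..2 * N} ?J"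
    by (rule bij_betw_byWitness[where f' = "\<lambda>n. nat (n + int N)"]) auto
  have "lact \<alpha> p 0 \<kappa> g = 1" for g
  proof -
    have "lact \<alpha> p 0 \<kappa> g = (\<Prod>i\<le>degree p. coord (int i) g powi coeff p i)"
      by (simp add: lact_def coord_def)
    also have "\<dots> = (\<Prod>i\<le>2 * N. coord (int i) g powi coeff p i)"
      by (rule prod.mono_neutral_left) (use dp in \<open>auto simp: coeff_eq_0\<close>)
    also have "\<dots> = (\<Prod>i\<le>2 * N. coord (int i - int N) (apow \<alpha> (int N) g) powi c (int i - int N))"
      by (rule prod.cong) (auto simp: cp coord_apow)
    also have "\<dots> = (\<Prod>n\<in>?J. coord n (apow \<alpha> (int N) g) powi c n)"
      by (rule prod.reindex_bij_betw[OF bij])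
    finally show ?thesis by (simp add: one)
  qed
  then have "f dvd p" using ann[of p] by auto
  then obtain q where q: "p = q * f" by (metis dvd_def mult.commute)
  have "pact (map_poly of_int p) w (- int N) \<in> \<int>"
    unfolding q of_int_poly_mult pact_mult by (rule pact_Ints[OF w])
  moreover have "pact (map_poly of_int p) w (- int N) = (\<Sum>i\<le>2 * N. of_int (coeff p i) * w (- int N + int i))"
    using dp by (subst pact_altdef[of _ "2 * N"]) auto
  moreover have "\<dots> = (\<Sum>i\<le>2 * N. of_int (c (int i - int N)) * w (int i - int N))"
    by (rule sum.cong) (auto simp: cp algebra_simps)
  moreover have "\<dots> = (\<Sum>n\<in>?J. of_int (c n) * w n)"
    by (rule sum.reindex_bij_betw[OF bij])
  ultimately obtain m where m: "(\<Sum>n\<in>?J. of_int (c n) * w n) = of_int m"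
    by (auto elim: Ints_cases)
  have powi: "cis x powi k = cis (of_int k * x)" for x k
    by (simp add: cis_power_int)
  have "(\<Prod>n\<in>S. cis (- 2 * pi * w n) powi c n) = cis (- 2 * pi * (\<Sum>n\<in>S. of_int (c n) * w n))" if "finite S" for S
    using that by (induction S rule: finite_induct) (auto simp: powi cis_mult algebra_simps)
  from this[of ?J] have "(\<Prod>n\<in>?J. cis (- 2 * pi * w n) powi c n) = cis (2 * pi * of_int (- m))"
    by (simp add: m)
  also have "\<dots> = 1" by (rule cis_multiple_2pi) simp
  finally show ?thesis .
qed

text \<open>A monomial that is nontrivial on \<Gamma> has mean zero, so a constant factor leaves its
  mean unchanged. A monomial that is trivial on \<Gamma> is multiplied by one, by the third
  assumption.\<close>

lemma mean_trig_translate: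
  assumes "trig J F" "\<And>n. norm (z n) = 1"
    and "\<And>c. (\<And>g. (\<Prod>n\<in>J. coord n g powi c n) = 1) \<Longrightarrow> (\<Prod>n\<in>J. z n powi c n) = 1"
  shows "cont (\<lambda>g. F (\<lambda>n. z n * coord n g)) \<and> cont (\<lambda>g. F (\<lambda>n. coord n g)) \<and>
    mean (\<lambda>g. F (\<lambda>n. z n * coord n g)) = mean (\<lambda>g. F (\<lambda>n. coord n g))"
  using assms(1)
proof (induction rule: trig.induct)
  case (trig_mono F c)
  define \<psi> where "\<psi> g = (\<Prod>n\<in>J. coord n g powi c n)" for g
  have F1: "F (\<lambda>n. coord n g) = \<psi> g" for g by (simp add: trig_mono \<psi>_def)
  have F2: "F (\<lambda>n. z n * coord n g) = (\<Prod>n\<in>J. z n powi c n) * \<psi> g" for g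
    by (subst trig_mono) (simp_all add: \<psi>_def norm_mult assms(2) power_int_mult_distrib prod.distrib)
  have c\<psi>: "cont \<psi>" unfolding \<psi>_def by (intro continuous_intros cont_coord) simp
  have hom: "\<psi> (a + b) = \<psi> a * \<psi> b" for a b
    by (simp add: \<psi>_def coord_add power_int_mult_distrib prod.distrib)
  have "(\<Prod>n\<in>J. z n powi c n) * mean \<psi> = mean \<psi>"
  proof (cases "\<forall>g. \<psi> g = 1")
    case True
    then show ?thesis using assms(3)[of c] by (simp add: \<psi>_def)
  next
    case False
    then obtain a where a: "\<psi> a \<noteq> 1" by blast
    have "mean \<psi> = \<psi> a * mean \<psi>"
      using mean_translate[OF c\<psi>, of a] mean_cmul[OF c\<psi>, of "\<psi> a"] by (simp add: hom mult.commute)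
    then have "mean \<psi> = 0" using a by simp
    then show ?thesis by simp
  qed
  then show ?case using c\<psi> unfolding F1 F2 by (simp add: mean_cmul continuous_intros)
next
  case (trig_add F H)
  then show ?case by (simp add: mean_add continuous_intros)
next
  case (trig_cmul F a)
  then show ?case by (simp add: mean_cmul continuous_intros)
qed

text \<open>If the point with lift \<open>w\<close> were missed, the mean of the peak function translated by it
  would decay faster in \<open>M\<close> than its mean at the identity, although the two means agree.\<close>

theorem coord_surj:
  fixes w :: "int \<Rightarrow> real"
  assumes w: "\<And>n. pact (map_poly of_int f) w n \<in> \<int>"
  obtains g where "\<And>n. coord n g = cis (2 * pi * w n)"
proof (rule ccontr)
  assume "\<not> thesis"
  then have "\<exists>n. coord n g \<noteq> cis (2 * pi * w n)" for g using that by blast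
  then obtain N :: nat where N0: "\<And>g. \<exists>n. \<bar>n\<bar> \<le> int N \<and> norm (coord n g - cis (2 * pi * w n)) > 1 / (real N + 1)"
    using coord_separation[of UNIV "\<lambda>n. cis (2 * pi * w n)"] by (metis UNIV_I closed_UNIV)
  define J where "J = {- int N..int N}"
  define \<delta> where "\<delta> = 1 / (real N + 1)"
  define z where "z n = cis (- 2 * pi * w n)" for n
  have fJ: "finite J" by (simp add: J_def)
  have \<delta>: "0 < \<delta>" "\<delta> \<le> 1" by (auto simp: \<delta>_def)
  have nz: "norm (z n) = 1" for n by (simp add: z_def)
  have N: "\<exists>n\<in>J. norm (z n * coord n g - 1) > \<delta>" for g
  proof -
    obtain n where n: "\<bar>n\<bar> \<le> int N" "norm (coord n g - cis (2 * pi * w n)) > \<delta>"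
      using N0[of g] by (auto simp: \<delta>_def)
    have "z n * coord n g - 1 = z n * (coord n g - cis (2 * pi * w n))"
      by (simp add: algebra_simps z_def cis_mult)
    then have "norm (z n * coord n g - 1) > \<delta>" using n(2) by (simp add: norm_mult nz)
    then show ?thesis using n(1) by (intro bexI[of _ n]) (auto simp: J_def)
  qed
  define K where "K = card J"
  \<comment> \<open>Small enough for \<open>K\<close> factors \<open>1 - \<eta>\<^sup>2 / 4\<close>
    to have product at least \<open>B\<close>: by Bernoulli's inequality the loss is at most
    \<open>K * \<eta>\<^sup>2 / 4\<close>, and this is at most
    \<open>\<delta>\<^sup>2 / 8\<close>.\<close>
  define \<eta> where "\<eta> = \<delta> / sqrt (2 * real K + 1)"
  have \<eta>: "\<eta> > 0" using \<delta> by (simp add: \<eta>_def)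
  have \<eta>2: "\<eta>\<^sup>2 * (2 * real K + 1) = \<delta>\<^sup>2" by (simp add: \<eta>_def power_divide)
  have \<eta>1: "\<eta>\<^sup>2 \<le> 1"
  proof -
    have "\<delta>\<^sup>2 \<le> 1" using \<delta> by (simp add: power_le_one)
    moreover have "\<eta>\<^sup>2 * 1 \<le> \<eta>\<^sup>2 * (2 * real K + 1)" by (intro mult_left_mono) auto
    ultimately show ?thesis using \<eta>2 by simp
  qed
  \<comment> \<open>The power \<open>A ^ M\<close> bounds the translated peak function everywhere,
    while \<open>B ^ M\<close> bounds the original one from below on \<open>W\<close>.\<close>
  define A where "A = 1 - \<delta>\<^sup>2 / 4"
  define B where "B = 1 - \<delta>\<^sup>2 / 8"
  have AB: "0 \<le> A" "A < B" "0 < B" using \<delta> power_le_one[of \<delta> 2] by (auto simp: A_def B_def)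
  define W where "W = (\<Inter>n\<in>J. {g. norm (coord n g - 1) < \<eta>})"
  have "open W" unfolding W_def
    by (intro open_INT fJ ballI open_Collect_less continuous_intros cont_coord)
  moreover have "0 \<in> W" using \<eta> by (simp add: W_def)
  \<comment> \<open>Fixed before the exponent \<open>M\<close>, so the covering number stays
    constant against \<open>(A / B) ^ M\<close>.\<close>
  ultimately obtain zs where zs: "\<And>w. \<exists>y\<in>set zs. w + y \<in> W"
    using finite_translates_cover[of W] by blast
  have key: "B ^ M \<le> real (length zs) * A ^ M" for M
  proof -
    have "cont (\<lambda>g. peak J M (\<lambda>n. z n * coord n g)) \<and> cont (\<lambda>g. peak J M (\<lambda>n. coord n g)) \<and>
       mean (\<lambda>g. peak J M (\<lambda>n. z n * coord n g)) = mean (\<lambda>g. peak J M (\<lambda>n. coord n g))"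
      by (rule mean_trig_translate[OF trig_peak[OF fJ] nz])
         (use coord_dual[OF w, where N = N] in \<open>auto simp: J_def z_def\<close>)
    then have c1: "cont (\<lambda>g. peak J M (\<lambda>n. z n * coord n g))" and c2: "cont (\<lambda>g. peak J M (\<lambda>n. coord n g))"
      and eq: "mean (\<lambda>g. peak J M (\<lambda>n. z n * coord n g)) = mean (\<lambda>g. peak J M (\<lambda>n. coord n g))" by auto
    have "Re (mean (\<lambda>g. peak J M (\<lambda>n. z n * coord n g))) \<le> Re (mean (\<lambda>_::'a. of_real (A ^ M)))"
    proof (rule Re_mean_mono[OF c1])
      fix g
      obtain n where n: "n \<in> J" "norm (z n * coord n g - 1) > \<delta>" using N by blast
      let ?h = "\<lambda>n. 1 - (norm (z n * coord n g - 1))\<^sup>2 / 4"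
      have nn: "norm (z n * coord n g) = 1" for n by (simp add: norm_mult nz)
      have h: "0 \<le> ?h n" "?h n \<le> 1" for n using unimodular_factor_bounds[OF nn] by auto
      have "\<delta>\<^sup>2 \<le> (norm (z n * coord n g - 1))\<^sup>2" using n(2) \<delta> by (intro power_mono) auto
      then have "?h n ^ M \<le> A ^ M" using h[of n] by (intro power_mono) (auto simp: A_def)
      moreover have "(\<Prod>m\<in>J - {n}. ?h m ^ M) \<le> 1" by (intro prod_le_1) (use h in \<open>auto simp: power_le_one\<close>)
      moreover have "(\<Prod>m\<in>J. ?h m ^ M) = ?h n ^ M * (\<Prod>m\<in>J - {n}. ?h m ^ M)"
        using fJ n(1) by (rule prod.remove)
      moreover have "0 \<le> ?h n ^ M" using h by simp
      ultimately have "(\<Prod>m\<in>J. ?h m ^ M) \<le> A ^ M * 1"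
        using AB by (metis (no_types, lifting) mult_left_mono mult.right_neutral order.trans)
      then show "Re (peak J M (\<lambda>n. z n * coord n g)) \<le> Re (of_real (A ^ M))"
        by (simp add: Re_peak nn)
    qed simp
    then have le: "Re (mean (\<lambda>g. peak J M (\<lambda>n. coord n g))) \<le> A ^ M" by (simp add: eq)
    have "B ^ M \<le> real (length zs) * Re (mean (\<lambda>g. peak J M (\<lambda>n. coord n g)))"
    proof (rule Re_mean_lower[OF c2 _ _ zs])
      fix g
      show "0 \<le> Re (peak J M (\<lambda>n. coord n g))"
        using unimodular_factor_bounds[OF norm_coord] by (simp add: Re_peak prod_nonneg)
    next
      fix g assume "g \<in> W"
      then have "(norm (coord n g - 1))\<^sup>2 \<le> \<eta>\<^sup>2" if "n \<in> J" for n
        using that by (intro power_mono) (auto simp: W_def intro: less_imp_le)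
      then have "1 - \<eta>\<^sup>2 / 4 \<le> 1 - (norm (coord n g - 1))\<^sup>2 / 4" if "n \<in> J" for n using that by simp
      then have "(\<Prod>n\<in>J. (1 - \<eta>\<^sup>2 / 4) ^ M) \<le> (\<Prod>n\<in>J. (1 - (norm (coord n g - 1))\<^sup>2 / 4) ^ M)"
        using \<eta>1 by (intro prod_mono conjI power_mono) auto
      moreover have "B ^ M \<le> (\<Prod>n\<in>J. (1 - \<eta>\<^sup>2 / 4) ^ M)"
      proof -
        have "B \<le> 1 + real K * (- (\<eta>\<^sup>2 / 4))" using \<eta>2[symmetric] by (simp add: B_def field_simps)
        also have "\<dots> \<le> (1 + (- (\<eta>\<^sup>2 / 4))) ^ K" by (rule Bernoulli_inequality) (use \<eta>1 in simp)
        finally have "B \<le> (1 - \<eta>\<^sup>2 / 4) ^ K" by simp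
        then have "B ^ M \<le> ((1 - \<eta>\<^sup>2 / 4) ^ K) ^ M" using AB by (intro power_mono) auto
        then show ?thesis by (simp add: K_def power_mult[symmetric] mult.commute)
      qed
      ultimately show "B ^ M \<le> Re (peak J M (\<lambda>n. coord n g))" by (simp add: Re_peak)
    qed
    also have "\<dots> \<le> real (length zs) * A ^ M" using le by (intro mult_left_mono) auto
    finally show ?thesis .
  qed
  have "(\<lambda>M. real (length zs) * (A / B) ^ M) \<longlonglongrightarrow> real (length zs) * 0"
    using AB by (intro tendsto_mult tendsto_const LIMSEQ_power_zero) auto
  moreover have "1 \<le> real (length zs) * (A / B) ^ M" for M
    using key[of M] AB by (simp add: power_divide field_simps)
  ultimately have "1 \<le> real (length zs) * 0" by (intro LIMSEQ_le_const[of _ _ 1]) auto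
  then show False by simp
qed

end


section \<open>Linear recurrences and homoclinic points\<close>

text \<open>An exponential rate gives geometric bounds at each first order step, so that the steps
  can be iterated over the roots.\<close>

definition decaying :: "(int \<Rightarrow> complex) \<Rightarrow> bool" where
  "decaying s \<longleftrightarrow> (\<exists>C \<rho>. 0 < \<rho> \<and> \<rho> < 1 \<and> (\<forall>n. norm (s n) \<le> C * \<rho> ^ nat \<bar>n\<bar>))"

text \<open>Unrolling the recurrence into the past gives the sum of
  \<open>z ^ j * v (n - 1 - j)\<close> over all \<open>j\<close>, which converges for a root inside
  the disc.\<close>

lemma decaying_solution_inside:
  assumes v: "decaying v" and z: "norm z < 1"
  shows "\<exists>y. decaying y \<and> (\<forall>n. y (n + 1) - z * y n = v n)"
proof -
  obtain C \<rho>0 where C: "0 < \<rho>0" "\<rho>0 < 1" "\<And>n. norm (v n) \<le> C * \<rho>0 ^ nat \<bar>n\<bar>"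
    using v unfolding decaying_def by blast
  \<comment> \<open>Strictly larger than \<open>norm z\<close>, which leaves a ratio
    \<open>r\<close> below one, and at least \<open>\<rho>0\<close>, which dominates
    \<open>v\<close>.\<close>
  define \<rho> where "\<rho> = (1 + max (norm z) \<rho>0) / 2"
  have \<rho>: "0 < \<rho>" "\<rho> < 1" "\<rho>0 \<le> \<rho>" "norm z < \<rho>" using C z by (auto simp: \<rho>_def max_def)
  have C0: "0 \<le> C" using C(3)[of 0] norm_ge_zero[of "v 0"] by (simp del: norm_ge_zero)
  define r where "r = norm z / \<rho>"
  have r: "0 \<le> r" "r < 1" using \<rho> by (auto simp: r_def)
  have bound: "norm (z ^ j * v (n - 1 - int j)) \<le> (C / \<rho> * \<rho> ^ nat \<bar>n\<bar>) * r ^ j" for n j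
  proof -
    define k where "k = nat \<bar>n - 1 - int j\<bar>"
    have "nat \<bar>n\<bar> \<le> Suc j + k" by (simp add: k_def)
    then have "\<rho> ^ (Suc j + k) \<le> \<rho> ^ nat \<bar>n\<bar>" using \<rho> by (intro power_decreasing) auto
    then have k: "\<rho> ^ k \<le> \<rho> ^ nat \<bar>n\<bar> / \<rho> ^ Suc j"
      using \<rho> by (simp add: power_add field_simps)
    have "norm (v (n - 1 - int j)) \<le> C * \<rho>0 ^ k" using C(3) by (simp add: k_def)
    also have "\<dots> \<le> C * \<rho> ^ k" using C0 C(1) \<rho> by (intro mult_left_mono power_mono) auto
    also have "\<dots> \<le> C * (\<rho> ^ nat \<bar>n\<bar> / \<rho> ^ Suc j)" using k C0 by (intro mult_left_mono)
    finally have "norm z ^ j * norm (v (n - 1 - int j)) \<le> norm z ^ j * (C * (\<rho> ^ nat \<bar>n\<bar> / \<rho> ^ Suc j))"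
      by (intro mult_left_mono) auto
    also have "\<dots> = (C / \<rho> * \<rho> ^ nat \<bar>n\<bar>) * r ^ j" by (simp add: r_def power_divide)
    finally show ?thesis by (simp add: norm_mult norm_power)
  qed
  define y where "y n = (\<Sum>j. z ^ j * v (n - 1 - int j))" for n
  have smr: "summable (\<lambda>j. (C / \<rho> * \<rho> ^ nat \<bar>n\<bar>) * r ^ j)" for n
    using r by (intro summable_mult summable_geometric) auto
  have sm: "summable (\<lambda>j. norm (z ^ j * v (n - 1 - int j)))" for n
    by (rule summable_comparison_test'[OF smr[of n], where N = 0]) (use bound in auto)
  have "norm (y n) \<le> (C / \<rho> / (1 - r)) * \<rho> ^ nat \<bar>n\<bar>" for n
  proof -
    have "norm (y n) \<le> (\<Sum>j. norm (z ^ j * v (n - 1 - int j)))"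
      unfolding y_def by (rule summable_norm[OF sm])
    also have "\<dots> \<le> (\<Sum>j. (C / \<rho> * \<rho> ^ nat \<bar>n\<bar>) * r ^ j)" by (rule suminf_le[OF bound sm smr])
    also have "\<dots> = (C / \<rho> * \<rho> ^ nat \<bar>n\<bar>) * (1 / (1 - r))"
      using r by (subst suminf_mult) (auto simp: suminf_geometric summable_geometric)
    finally show ?thesis by simp
  qed
  then have "decaying y" unfolding decaying_def using \<rho> by blast
  moreover have "y (n + 1) - z * y n = v n" for n
  proof -
    have y1: "y (n + 1) = (\<Sum>j. z ^ j * v (n - int j))" by (simp add: y_def)
    have "summable (\<lambda>j. z ^ j * v (n - int j))"
      using summable_norm_cancel[OF sm[of "n + 1"]] by simp
    from suminf_split_head[OF this]
    have "y (n + 1) = v n + (\<Sum>j. z ^ Suc j * v (n - int (Suc j)))"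
      unfolding y1 by simp
    also have "(\<Sum>j. z ^ Suc j * v (n - int (Suc j))) = (\<Sum>j. z * (z ^ j * v (n - 1 - int j)))"
      by (simp add: algebra_simps)
    also have "\<dots> = z * y n" unfolding y_def by (rule suminf_mult[OF summable_norm_cancel[OF sm]])
    finally show ?thesis by simp
  qed
  ultimately show ?thesis by blast
qed

text \<open>For a root outside the disc the recurrence is run backwards: reversing the index
  replaces \<open>z\<close> by \<open>1 / z\<close> and the right-hand side by
  \<open>v'\<close>.\<close>

lemma decaying_solution_linear:
  assumes v: "decaying v" and z: "norm z \<noteq> 1"
  shows "\<exists>y. decaying y \<and> (\<forall>n. y (n + 1) - z * y n = v n)"
proof (cases "norm z < 1")
  case True
  then show ?thesis by (rule decaying_solution_inside[OF v])
next
  case False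
  with z have z1: "norm z > 1" by simp
  then have z0: "z \<noteq> 0" by auto
  obtain C \<rho> where C: "0 < \<rho>" "\<rho> < 1" "\<And>n. norm (v n) \<le> C * \<rho> ^ nat \<bar>n\<bar>"
    using v unfolding decaying_def by blast
  have C0: "0 \<le> C" using C(3)[of 0] norm_ge_zero[of "v 0"] by (simp del: norm_ge_zero)
  define v' where "v' m = - v (- m - 1) / z" for m
  have "norm (v' m) \<le> (C / \<rho> / norm z) * \<rho> ^ nat \<bar>m\<bar>" for m
  proof -
    have "\<rho> ^ Suc (nat \<bar>- m - 1\<bar>) \<le> \<rho> ^ nat \<bar>m\<bar>" using C by (intro power_decreasing) auto
    then have "\<rho> ^ nat \<bar>- m - 1\<bar> \<le> \<rho> ^ nat \<bar>m\<bar> / \<rho>" using C by (simp add: field_simps)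
    then have "C * \<rho> ^ nat \<bar>- m - 1\<bar> \<le> C * (\<rho> ^ nat \<bar>m\<bar> / \<rho>)" using C0 by (rule mult_left_mono)
    then have "norm (v (- m - 1)) \<le> C * (\<rho> ^ nat \<bar>m\<bar> / \<rho>)" using C(3)[of "- m - 1"] by simp
    then show ?thesis using z0 by (simp add: v'_def norm_divide field_simps)
  qed
  then have "decaying v'" unfolding decaying_def using C by blast
  moreover have "norm (1 / z) < 1" using z1 z0 by (simp add: norm_divide divide_less_eq)
  ultimately obtain y' where y': "decaying y'" "\<And>n. y' (n + 1) - (1 / z) * y' n = v' n"
    using decaying_solution_inside by blast
  define y where "y n = y' (- n)" for n
  have "decaying y" using y'(1) unfolding decaying_def y_def by (metis abs_minus_cancel)
  moreover have "y (n + 1) - z * y n = v n" for n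
  proof -
    have "z * (v n + z * y' (- n)) = z * y' (- n - 1)"
      using y'(2)[of "- n - 1"] z0 by (simp add: v'_def field_simps)
    then have "v n + z * y' (- n) = y' (- n - 1)" using z0 by simp
    moreover have "- (n + 1) = - n - 1" by simp
    ultimately show ?thesis unfolding y_def by (metis add_diff_cancel_right')
  qed
  ultimately show ?thesis by blast
qed

lemma root_factorization:
  fixes p :: "complex poly"
  assumes "degree p > 0"
  obtains z q where "p = [:- z, 1:] * q" "poly p z = 0" "degree q < degree p" "q \<noteq> 0"
proof -
  have "\<not> constant (poly p)" using assms constant_degree[of p] by simp
  then obtain z where z: "poly p z = 0" using fundamental_theorem_of_algebra by blast
  then obtain q where q: "p = [:- z, 1:] * q" by (auto simp: poly_eq_0_iff_dvd)
  have "q \<noteq> 0" using assms q by auto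
  moreover from this have "degree p = Suc (degree q)" unfolding q by (subst degree_mult_eq) auto
  ultimately show ?thesis using that[OF q z] by simp
qed

lemma pact_linear: "pact [:- z, 1:] y n = y (n + 1) - z * y n"
  by (simp add: pact_pCons)

text \<open>Linear factors are inverted one at a time: solving first for \<open>y\<close>, which is
  to be \<open>q(\<sigma>) w\<close>, leaves a polynomial of smaller degree.\<close>

lemma decaying_solution:
  fixes p :: "complex poly"
  assumes "p \<noteq> 0" "\<And>z. poly p z = 0 \<Longrightarrow> norm z \<noteq> 1" "decaying v"
  shows "\<exists>w. decaying w \<and> (\<forall>n. pact p w n = v n)"
  using assms
proof (induction "degree p" arbitrary: p v rule: less_induct)
  case less
  show ?case
  proof (cases "degree p = 0")
    case True
    then obtain c where c: "p = [:c:]" by (rule degree_eq_zeroE)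
    with less.prems have c0: "c \<noteq> 0" by simp
    obtain C \<rho> where C: "0 < \<rho>" "\<rho> < 1" "\<And>n. norm (v n) \<le> C * \<rho> ^ nat \<bar>n\<bar>"
      using less.prems(3) unfolding decaying_def by blast
    have "norm (v n / c) \<le> (C / norm c) * \<rho> ^ nat \<bar>n\<bar>" for n
      using C(3)[of n] c0 by (simp add: norm_divide divide_right_mono)
    then have "decaying (\<lambda>n. v n / c)" unfolding decaying_def using C(1,2) by blast
    then show ?thesis using c0 by (intro exI[of _ "\<lambda>n. v n / c"]) (simp add: c pact_pCons)
  next
    case False
    then obtain z q where q: "p = [:- z, 1:] * q" "poly p z = 0" "degree q < degree p" "q \<noteq> 0"
      by (auto elim: root_factorization)
    obtain y where y: "decaying y" "\<And>n. y (n + 1) - z * y n = v n"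
      using decaying_solution_linear[OF less.prems(3) less.prems(2)[OF q(2)]] by blast
    have "norm z' \<noteq> 1" if "poly q z' = 0" for z'
      using less.prems(2)[of z'] that by (simp add: q(1))
    then obtain w where "decaying w" "\<And>n. pact q w n = y n"
      using less.hyps[OF q(3,4) _ y(1)] by blast
    then have "pact p w n = v n" for n
      unfolding q(1) pact_mult pact_linear using y(2) by simp
    then show ?thesis using \<open>decaying w\<close> by blast
  qed
qed

lemma bounded_pact:
  fixes p :: "complex poly"
  assumes "\<And>n. norm (w n) \<le> B" shows "norm (pact p w n) \<le> (\<Sum>i\<le>degree p. norm (coeff p i) * B)"
  unfolding pact_def
  by (rule order.trans[OF norm_sum]) (auto intro!: sum_mono mult_left_mono assms simp: norm_mult)

text \<open>A nonzero geometric sequence grows without bound in one direction, forward for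
  \<open>norm z > 1\<close> and backward for \<open>norm z < 1\<close>.\<close>

lemma bounded_geometric_zero:
  fixes y :: "int \<Rightarrow> complex"
  assumes rec: "\<And>n. y (n + 1) = z * y n" and bd: "\<And>n. norm (y n) \<le> B" and z: "norm z \<noteq> 1"
  shows "y n = 0"
proof (rule ccontr)
  assume nz: "y n \<noteq> 0"
  have fw: "y (m + int k) = z ^ k * y m" for m k
  proof (induction k)
    case (Suc k)
    then show ?case using rec[of "m + int k"] by (simp add: ac_simps)
  qed simp
  show False
  proof (cases "norm z > 1")
    case True
    then obtain k where "B / norm (y n) < norm z ^ k" using real_arch_pow by blast
    then have "B < norm (y (n + int k))" using nz by (simp add: fw norm_mult norm_power field_simps)
    then show False using bd[of "n + int k"] by simp
  next
    case False
    then have z1: "norm z < 1" using z by simp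
    have B: "B > 0" using nz bd[of n] by (metis norm_le_zero_iff not_less order.trans)
    obtain k where k: "norm z ^ k < norm (y n) / B"
      using real_arch_pow_inv[of "norm (y n) / B" "norm z"] z1 nz B by auto
    have "norm (y n) = norm z ^ k * norm (y (n - int k))"
      using fw[of "n - int k" k] by (simp add: norm_mult norm_power)
    also have "\<dots> \<le> norm z ^ k * B" by (intro mult_left_mono bd) auto
    also have "\<dots> < norm (y n)" using k B by (simp add: field_simps)
    finally show False by simp
  qed
qed

text \<open>Boundedness passes to \<open>q(\<sigma>) w\<close>, which is geometric with ratio
  \<open>z\<close> and hence zero; then the degree has dropped.\<close>

lemma bounded_solution_unique:
  fixes p :: "complex poly"
  assumes "p \<noteq> 0" "\<And>z. poly p z = 0 \<Longrightarrow> norm z \<noteq> 1" "\<And>n. norm (w n) \<le> B" "\<And>n. pact p w n = 0"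
  shows "w n = 0"
  using assms
proof (induction "degree p" arbitrary: p n rule: less_induct)
  case less
  show ?case
  proof (cases "degree p = 0")
    case True
    then obtain c where c: "p = [:c:]" by (rule degree_eq_zeroE)
    then show ?thesis using less.prems(1) less.prems(4)[of n] by (simp add: pact_pCons)
  next
    case False
    then obtain z q where q: "p = [:- z, 1:] * q" "poly p z = 0" "degree q < degree p" "q \<noteq> 0"
      by (auto elim: root_factorization)
    have q0: "pact q w m = 0" for m
    proof (rule bounded_geometric_zero)
      show "pact q w (n + 1) = z * pact q w n" for n
        using less.prems(4)[of n] unfolding q(1) pact_mult pact_linear by simp
      show "norm (pact q w n) \<le> (\<Sum>i\<le>degree q. norm (coeff q i) * B)" for n
        by (rule bounded_pact[OF less.prems(3)])
      show "norm z \<noteq> 1" by (rule less.prems(2)[OF q(2)])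
    qed
    have "norm z' \<noteq> 1" if "poly q z' = 0" for z'
      using less.prems(2)[of z'] that by (simp add: q(1))
    then show ?thesis using less.hyps[OF q(3,4) _ less.prems(3) q0] by blast
  qed
qed

lemma pact_Re:
  "pact (map_poly of_int f) (\<lambda>n. Re (w n)) n = Re (pact (map_poly of_int f) w n)"
  by (simp add: pact_def)

lemma pact_of_real:
  "pact (map_poly of_int f) (\<lambda>n. complex_of_real (w n)) n = of_real (pact (map_poly of_int f) w n)"
  by (simp add: pact_def)

lemma pact_of_int:
  "pact (map_poly of_int f) (\<lambda>n. of_int (m n)) n = (of_int (pact f m n) :: 'b::{comm_ring_1,ring_char_0})"
  by (simp add: pact_def)

lemma pact_power_int:
  fixes z :: complex
  assumes "z \<noteq> 0" shows "pact p (\<lambda>n. z powi n) n = z powi n * poly p z"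
  using assms by (simp add: pact_def poly_altdef power_int_add sum_distrib_left mult_ac)

lemma vanishing_iff:
  fixes s :: "int \<Rightarrow> 'b::real_normed_vector"
  shows "vanishing s \<longleftrightarrow> (\<lambda>n. s (int n)) \<longlonglongrightarrow> 0 \<and> (\<lambda>n. s (- int n)) \<longlonglongrightarrow> 0"
proof (intro iffI conjI)
  assume v: "vanishing s"
  have "\<exists>N. \<forall>n\<ge>N. norm (s (int n)) < \<epsilon> \<and> norm (s (- int n)) < \<epsilon>" if "\<epsilon> > 0" for \<epsilon> :: real
  proof -
    obtain N where N: "\<And>n. \<bar>n\<bar> \<ge> N \<Longrightarrow> norm (s n) < \<epsilon>" using v \<open>\<epsilon> > 0\<close> unfolding vanishing_def by blast
    then show ?thesis by (intro exI[of _ "nat N"]) auto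
  qed
  then show "(\<lambda>n. s (int n)) \<longlonglongrightarrow> 0" "(\<lambda>n. s (- int n)) \<longlonglongrightarrow> 0"
    unfolding LIMSEQ_def dist_norm diff_zero by blast+
next
  assume lim: "(\<lambda>n. s (int n)) \<longlonglongrightarrow> 0 \<and> (\<lambda>n. s (- int n)) \<longlonglongrightarrow> 0"
  show "vanishing s" unfolding vanishing_def
  proof (intro allI impI)
    fix \<epsilon> :: real assume "\<epsilon> > 0"
    then obtain N1 N2 where N: "\<And>n. n \<ge> N1 \<Longrightarrow> norm (s (int n)) < \<epsilon>" "\<And>n. n \<ge> N2 \<Longrightarrow> norm (s (- int n)) < \<epsilon>"
      using lim unfolding LIMSEQ_def dist_norm diff_zero by meson
    have "norm (s n) < \<epsilon>" if n: "\<bar>n\<bar> \<ge> int (max N1 N2)" for n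
    proof (cases "n \<ge> 0")
      case True
      then show ?thesis using N(1)[of "nat n"] n by simp
    next
      case False
      then show ?thesis using N(2)[of "nat (- n)"] n by simp
    qed
    then show "\<exists>N. \<forall>n. \<bar>n\<bar> \<ge> N \<longrightarrow> norm (s n) < \<epsilon>" by blast
  qed
qed

lemma vanishing_shift:
  assumes "vanishing s" shows "vanishing (\<lambda>n. s (n + j))"
  unfolding vanishing_def
proof (intro allI impI)
  fix \<epsilon> :: real assume "\<epsilon> > 0"
  then obtain N where N: "\<And>n. \<bar>n\<bar> \<ge> N \<Longrightarrow> norm (s n) < \<epsilon>" using assms unfolding vanishing_def by blast
  have "norm (s (n + j)) < \<epsilon>" if "\<bar>n\<bar> \<ge> N + \<bar>j\<bar>" for n by (rule N) (use that in linarith)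
  then show "\<exists>N. \<forall>n. \<bar>n\<bar> \<ge> N \<longrightarrow> norm (s (n + j)) < \<epsilon>" by blast
qed

lemma vanishing_pact:
  fixes u :: "int \<Rightarrow> real"
  assumes "vanishing u" shows "vanishing (pact p u)"
  unfolding vanishing_iff
proof
  have sh: "(\<lambda>n. u (int n + j)) \<longlonglongrightarrow> 0" "(\<lambda>n. u (- int n + j)) \<longlonglongrightarrow> 0" for j
    using vanishing_shift[OF assms, of j] unfolding vanishing_iff by auto
  show "(\<lambda>n. pact p u (int n)) \<longlonglongrightarrow> 0" "(\<lambda>n. pact p u (- int n)) \<longlonglongrightarrow> 0"
    unfolding pact_def by (intro tendsto_null_sum tendsto_mult_right_zero sh)+
qed

lemma vanishing_bounded:
  fixes u :: "int \<Rightarrow> 'b::real_normed_vector"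
  assumes "vanishing u" obtains B where "\<And>n. norm (u n) \<le> B"
proof -
  obtain N where N: "\<And>n. \<bar>n\<bar> \<ge> N \<Longrightarrow> norm (u n) < 1"
    using assms unfolding vanishing_def by (meson zero_less_one)
  define B where "B = Max (insert 1 ((\<lambda>n. norm (u n)) ` {- N..N}))"
  have "norm (u n) \<le> B" for n
  proof (cases "\<bar>n\<bar> \<ge> N")
    case True
    have "1 \<le> B" by (simp add: B_def)
    then show ?thesis using N[OF True] by simp
  next
    case False
    then have "n \<in> {- N..N}" by auto
    then have "norm (u n) \<in> insert 1 ((\<lambda>n. norm (u n)) ` {- N..N})" by blast
    then show ?thesis unfolding B_def by (intro Max_ge) auto
  qed
  then show ?thesis by (rule that)
qed

lemma decaying_imp_vanishing: "decaying s \<Longrightarrow> vanishing s"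
proof -
  assume "decaying s"
  then obtain C \<rho> where C: "0 < \<rho>" "\<rho> < 1" "\<And>n. norm (s n) \<le> C * \<rho> ^ nat \<bar>n\<bar>"
    unfolding decaying_def by blast
  have lim: "(\<lambda>n. C * \<rho> ^ n) \<longlonglongrightarrow> 0"
    using C by (intro tendsto_mult_right_zero LIMSEQ_power_zero) auto
  have "(\<lambda>n. s (int n)) \<longlonglongrightarrow> 0" "(\<lambda>n. s (- int n)) \<longlonglongrightarrow> 0"
    by (rule Lim_null_comparison[OF _ lim], use C(3)[of "int _"] C(3)[of "- int _"] in simp)+
  then show ?thesis by (simp add: vanishing_iff)
qed

lemma vanishing_Ints_finite_support:
  fixes u :: "int \<Rightarrow> real"
  assumes "vanishing u" "\<And>n. u n \<in> \<int>"
  obtains v :: "int \<Rightarrow> int" and N :: nat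
    where "\<And>n. u n = of_int (v n)" "\<And>n. \<bar>n\<bar> \<ge> int N \<Longrightarrow> v n = 0"
proof -
  define v where "v n = \<lfloor>u n\<rfloor>" for n
  have v: "u n = of_int (v n)" for n using assms(2)[of n] by (auto simp: v_def elim: Ints_cases)
  obtain N where N: "\<And>n. \<bar>n\<bar> \<ge> N \<Longrightarrow> norm (u n) < 1"
    using assms(1) unfolding vanishing_def by (meson zero_less_one)
  have "v n = 0" if "\<bar>n\<bar> \<ge> int (nat N)" for n
  proof -
    have "N \<le> \<bar>n\<bar>" using that by linarith
    then have "\<bar>u n\<bar> < 1" using N[of n] by simp
    then have "\<bar>real_of_int (v n)\<bar> < 1" by (simp add: v)
    then show ?thesis by linarith
  qed
  then show ?thesis using that[OF v] by blast
qed

lemma cis_2pi_eq_1_iff: "cis (2 * pi * x) = 1 \<longleftrightarrow> x \<in> \<int>"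
proof
  assume "cis (2 * pi * x) = 1"
  then have "cos (2 * pi * x) = 1" by (metis Re_complex_of_real cis.sel(1) of_real_1)
  then obtain n :: int where "2 * pi * x = of_int n * 2 * pi" using cos_one_2pi_int[of "2 * pi * x"] by auto
  then have "x = of_int n" by simp
  then show "x \<in> \<int>" by simp
qed simp

section \<open>Homoclinic points, paths and expansiveness in coordinates\<close>

context cyclic_system
begin

text \<open>The coordinates determine the topology: finitely many of them control a given
  neighbourhood of zero.\<close>

lemma coord_tendsto:
  assumes "\<And>n. ((\<lambda>x. coord n (h x)) \<longlongrightarrow> coord n l) F"
  shows "(h \<longlongrightarrow> l) F"
proof -
  have "((\<lambda>x. h x - l) \<longlongrightarrow> 0) F"
  proof (rule topological_tendstoI)
    fix U :: "'a set" assume "open U" "0 \<in> U"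
    then obtain N :: nat and \<epsilon> :: real where N: "\<epsilon> > 0"
      "\<And>g. (\<And>n. \<bar>n\<bar> \<le> int N \<Longrightarrow> norm (coord n g - 1) < \<epsilon>) \<Longrightarrow> g \<in> U"
      using coord_neighbourhood by blast
    have "\<forall>\<^sub>F x in F. norm (coord n (h x - l) - 1) < \<epsilon>" for n
    proof -
      have "((\<lambda>x. coord n (h x) / coord n l) \<longlongrightarrow> coord n l / coord n l) F"
        by (intro tendsto_divide assms tendsto_const) simp
      from tendstoD[OF this N(1)] show ?thesis by (simp add: coord_diff dist_norm)
    qed
    then have "\<forall>\<^sub>F x in F. \<forall>n\<in>{- int N..int N}. norm (coord n (h x - l) - 1) < \<epsilon>"
      by (intro eventually_ball_finite) auto
    then show "\<forall>\<^sub>F x in F. h x - l \<in> U"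
    proof eventually_elim
      case (elim x)
      show ?case
      proof (rule N(2))
        fix n :: int assume "\<bar>n\<bar> \<le> int N"
        then have "n \<in> {- int N..int N}" by auto
        then show "norm (coord n (h x - l) - 1) < \<epsilon>" using elim by blast
      qed
    qed
  qed
  from tendsto_add[OF this tendsto_const[of l]] show ?thesis by simp
qed

text \<open>Coordinate \<open>j\<close> of \<open>apow \<alpha> n g\<close> is coordinate
  \<open>j + n\<close> of \<open>g\<close>, so the decay of this one sequence controls every
  coordinate along the orbit.\<close>

lemma homoclinic_iff: "g \<in> homoclinic \<alpha> \<longleftrightarrow> vanishing (\<lambda>n. coord n g - 1)"
proof
  assume "g \<in> homoclinic \<alpha>"
  then have h: "(\<lambda>n. apow \<alpha> (int n) g) \<longlonglongrightarrow> 0" "(\<lambda>n. apow \<alpha> (- int n) g) \<longlonglongrightarrow> 0"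
    by (auto simp: homoclinic_def)
  have "isCont \<kappa> 0" using char by (simp add: is_char_def continuous_on_eq_continuous_at)
  from isCont_tendsto_compose[OF this h(1)] isCont_tendsto_compose[OF this h(2)]
  show "vanishing (\<lambda>n. coord n g - 1)"
    using coord_zero[of 0] unfolding vanishing_iff coord_def LIM_zero_iff by simp
next
  assume v: "vanishing (\<lambda>n. coord n g - 1)"
  have "(\<lambda>n. coord (j + int n) g - 1) \<longlonglongrightarrow> 0" "(\<lambda>n. coord (j + - int n) g - 1) \<longlonglongrightarrow> 0" for j
    using vanishing_shift[OF v, of j] unfolding vanishing_iff by (auto simp: add.commute)
  then show "g \<in> homoclinic \<alpha>"
    unfolding homoclinic_def LIM_zero_iff by (auto intro!: coord_tendsto simp: coord_apow)
qed

lemma coord_lift_Ints: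
  fixes u :: "int \<Rightarrow> real"
  assumes "\<And>n. coord n g = cis (2 * pi * u n)"
  shows "pact (map_poly of_int f) u n \<in> \<int>"
proof -
  have "lact \<alpha> f 0 \<kappa> = (\<lambda>_. 1)" using ann by simp
  then have "1 = lact \<alpha> f 0 \<kappa> (apow \<alpha> n g)" by simp
  also have "\<dots> = (\<Prod>i\<le>degree f. coord (n + int i) g powi coeff f i)"
    by (simp add: lact_def coord_def apow_add[symmetric] add.commute)
  also have "\<dots> = (\<Prod>i\<le>degree f. cis (2 * pi * (of_int (coeff f i) * u (n + int i))))"
    by (simp add: assms cis_power_int mult_ac)
  also have "\<dots> = cis (2 * pi * (\<Sum>i\<le>degree f. of_int (coeff f i) * u (n + int i)))"
  proof -
    have *: "(\<Prod>i\<in>S. cis (2 * pi * x i)) = cis (2 * pi * (\<Sum>i\<in>S. x i))" if "finite S" for S :: "nat set" and x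
      using that by (induction S rule: finite_induct) (auto simp: cis_mult distrib_left)
    show ?thesis by (rule *) simp
  qed
  finally show ?thesis using cis_2pi_eq_1_iff by (simp add: pact_def)
qed

lemma homoclinic_lift:
  assumes "g \<in> homoclinic \<alpha>"
  obtains u :: "int \<Rightarrow> real" where "vanishing u" "\<And>n. coord n g = cis (2 * pi * u n)"
proof -
  \<comment> \<open>The principal argument is continuous at one, so this particular lift tends to
    zero at both ends.\<close>
  define u where "u n = Arg (coord n g) / (2 * pi)" for n
  have "coord n g = cis (2 * pi * u n)" for n
    using cis_Arg[of "coord n g"] by (simp add: u_def sgn_div_norm)
  moreover have "vanishing u"
  proof -
    have v: "vanishing (\<lambda>n. coord n g - 1)" using assms homoclinic_iff by blast
    have "isCont Arg 1" using continuous_at_Arg[of 1] by simp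
    then have A: "((\<lambda>n. Arg (x n)) \<longlongrightarrow> Arg 1) sequentially" if "x \<longlonglongrightarrow> 1" for x
      using isCont_tendsto_compose that by blast
    have "(\<lambda>n. coord (int n) g) \<longlonglongrightarrow> 1" "(\<lambda>n. coord (- int n) g) \<longlonglongrightarrow> 1"
      using v unfolding vanishing_iff LIM_zero_iff by auto
    from this[THEN A] show ?thesis
      unfolding vanishing_iff u_def by (auto intro!: tendsto_divide_zero)
  qed
  ultimately show ?thesis using that by blast
qed

text \<open>Real multiples of a genuine solution are solutions; integrality alone would not survive
  the scaling. The points \<gamma> of the path are chosen separately for each \<open>s\<close>, and
  continuity follows because their coordinates vary continuously.\<close>

lemma solution_imp_path_component:
  fixes w :: "int \<Rightarrow> real"
  assumes w: "\<And>n. pact (map_poly of_int f) w n = 0" and g: "\<And>n. coord n g = cis (2 * pi * w n)"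
  shows "g \<in> path_component_set UNIV 0"
proof -
  have "\<exists>h. \<forall>n. coord n h = cis (2 * pi * (s * w n))" for s :: real
    by (rule coord_surj[of "\<lambda>n. s * w n"]) (auto simp: pact_seq_cmul w)
  then obtain \<gamma> where \<gamma>: "\<And>s n. coord n (\<gamma> s) = cis (2 * pi * (s * w n))" by metis
  have "continuous_on {0..1} \<gamma>"
    unfolding continuous_on_def
    by (intro ballI coord_tendsto) (auto simp: \<gamma> intro!: tendsto_intros)
  then have "path \<gamma>" by (simp add: path_def)
  moreover have "\<gamma> 0 = 0" by (rule coord_inject) (simp add: \<gamma>)
  moreover have "\<gamma> 1 = g" by (rule coord_inject) (simp add: \<gamma> g)
  ultimately have "path_component UNIV 0 g"
    unfolding path_component_def by (intro exI[of _ \<gamma>]) (auto simp: pathstart_def pathfinish_def)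
  then show ?thesis by simp
qed

text \<open>Each coordinate lifts along the path through a continuous logarithm. Then
  \<open>f(\<sigma>)\<close> of the lift is continuous and integral in every entry, hence constant
  in time, and it starts at zero.\<close>

lemma path_component_imp_solution:
  assumes "g \<in> path_component_set UNIV 0"
  obtains w :: "int \<Rightarrow> real"
    where "\<And>n. pact (map_poly of_int f) w n = 0" "\<And>n. coord n g = cis (2 * pi * w n)"
proof -
  obtain \<gamma> where \<gamma>: "continuous_on {0..1::real} \<gamma>" "\<gamma> 0 = 0" "\<gamma> 1 = g"
    using assms by (auto simp: path_component_def path_def pathstart_def pathfinish_def)
  have "\<exists>L. continuous_on {0..1} L \<and> (\<forall>s\<in>{0..1}. coord n (\<gamma> s) = exp (L s))" for n
  proof -
    have "continuous_on {0..1} (\<lambda>s. coord n (\<gamma> s))" by (rule cont_compose[OF cont_coord \<gamma>(1)])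
    moreover have "contractible {0..1::real}" by (simp add: convex_imp_contractible)
    ultimately show ?thesis using continuous_logarithm_on_contractible[of "{0..1}" "\<lambda>s. coord n (\<gamma> s)"]
      by (metis coord_nonzero)
  qed
  then obtain L where L: "\<And>n. continuous_on {0..1} (L n)"
    "\<And>n s. s \<in> {0..1} \<Longrightarrow> coord n (\<gamma> s) = exp (L n s)" by metis
  \<comment> \<open>Subtracting the value at time zero makes the initial lift the zero sequence and
    not merely an integral one.\<close>
  define W where "W s n = (Im (L n s) - Im (L n 0)) / (2 * pi)" for s n
  have cW: "continuous_on {0..1} (\<lambda>s. W s n)" for n
    unfolding W_def by (intro continuous_intros L) auto
  have cis: "coord n (\<gamma> s) = cis (Im (L n s))" if "s \<in> {0..1}" for n s
  proof -
    have "exp (Re (L n s)) = 1" using norm_coord[of n "\<gamma> s"] L(2)[OF that] by simp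
    then show ?thesis using L(2)[OF that, of n] by (simp add: exp_eq_polar)
  qed
  have cW': "coord n (\<gamma> s) = cis (2 * pi * W s n)" if "s \<in> {0..1}" for n s
  proof -
    have "cis (Im (L n 0)) = 1" using cis[of 0 n] \<gamma>(2) by simp
    then show ?thesis using cis[OF that, of n] by (simp add: W_def cis_divide[symmetric])
  qed
  have Z: "pact (map_poly of_int f) (W s) n \<in> \<int>" if "s \<in> {0..1}" for s n
    by (rule coord_lift_Ints[OF cW'[OF that]])
  have "(\<lambda>s. pact (map_poly of_int f) (W s) n) constant_on {0..1}" for n
  proof (rule continuous_discrete_range_constant)
    show "continuous_on {0..1} (\<lambda>s. pact (map_poly of_int f) (W s) n)"
      unfolding pact_def by (intro continuous_intros cW)
    fix s :: real assume s: "s \<in> {0..1}"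
    show "\<exists>e>0. \<forall>t. t \<in> {0..1} \<and> pact (map_poly of_int f) (W t) n \<noteq> pact (map_poly of_int f) (W s) n
        \<longrightarrow> e \<le> norm (pact (map_poly of_int f) (W t) n - pact (map_poly of_int f) (W s) n)"
    proof (intro exI[of _ 1] conjI allI impI)
      fix t assume t: "t \<in> {0..1} \<and> pact (map_poly of_int f) (W t) n \<noteq> pact (map_poly of_int f) (W s) n"
      have "pact (map_poly of_int f) (W t) n - pact (map_poly of_int f) (W s) n \<in> \<int>"
        using Z s t by (intro Ints_diff) auto
      then show "1 \<le> norm (pact (map_poly of_int f) (W t) n - pact (map_poly of_int f) (W s) n)"
        using t by (auto intro: Ints_nonzero_abs_ge1)
    qed simp
  qed simp
  moreover have "pact (map_poly of_int f) (W 0) n = 0" for n by (simp add: pact_def W_def)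
  ultimately have "pact (map_poly of_int f) (W 1) n = 0" for n
    unfolding constant_on_def by (metis atLeastAtMost_iff order_refl zero_le_one)
  then show ?thesis using that[of "W 1"] cW'[of 1] \<gamma>(3) by auto
qed

text \<open>A zero on the circle gives the bounded solution \<open>Re (z powi n)\<close>. Scaled
  down, it lifts a point whose whole orbit stays in \<open>U\<close>.\<close>

lemma expansive_imp_hyperbolic:
  assumes "expansive \<alpha>" "poly (map_poly of_int f) z = 0"
  shows "norm (z :: complex) \<noteq> 1"
proof
  assume z1: "norm z = 1"
  then have z0: "z \<noteq> 0" by auto
  obtain U where U: "open U" "0 \<in> U" "(\<Inter>n::int. apow \<alpha> n ` U) = {0}"
    using assms(1) unfolding expansive_def by blast
  obtain N :: nat and \<epsilon> :: real where N: "\<epsilon> > 0"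
      "\<And>g. (\<And>n. \<bar>n\<bar> \<le> int N \<Longrightarrow> norm (coord n g - 1) < \<epsilon>) \<Longrightarrow> g \<in> U"
    using coord_neighbourhood[OF U(1,2)] by blast
  have "continuous_on UNIV (\<lambda>x. cis (2 * pi * x))" by (intro continuous_intros)
  then obtain d where d: "d > 0" "\<And>x. dist x 0 < d \<Longrightarrow> dist (cis (2 * pi * x)) (cis (2 * pi * 0)) < \<epsilon>"
    using N(1) unfolding continuous_on_iff by (meson UNIV_I)
  then have d2: "norm (cis (2 * pi * x) - 1) < \<epsilon>" if "\<bar>x\<bar> < d" for x
    using that by (simp add: dist_norm)
  \<comment> \<open>\<open>r < d\<close> keeps the orbit in \<open>U\<close>, and
    \<open>0 < r < 1\<close> makes \<open>w 0 = r\<close> nonintegral, so the point is not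
    zero.\<close>
  define r where "r = min (d / 2) (1 / 2)"
  have r: "0 < r" "r < d" "r < 1" using d by (auto simp: r_def)
  define w where "w n = r * Re (z powi n)" for n
  have wd: "\<bar>w n\<bar> < d" for n
  proof -
    have "\<bar>Re (z powi n)\<bar> \<le> 1" using abs_Re_le_cmod[of "z powi n"] z1 by (simp add: norm_power_int)
    then have "r * \<bar>Re (z powi n)\<bar> \<le> r * 1" using r by (intro mult_left_mono) auto
    then have "\<bar>w n\<bar> \<le> r" using r by (simp add: w_def abs_mult del: mult_le_cancel_left1 mult_le_cancel_left2)
    then show ?thesis using r by simp
  qed
  have "pact (map_poly of_int f) w n = 0" for n
    unfolding w_def by (simp add: pact_seq_cmul pact_Re pact_power_int[OF z0] assms(2))
  then obtain g where g: "\<And>n. coord n g = cis (2 * pi * w n)" using coord_surj[of w] by auto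
  have "apow \<alpha> m g \<in> U" for m
    by (rule N(2)) (simp add: coord_apow g d2 wd)
  then have "g \<in> apow \<alpha> n ` U" for n
    using apow_add[of n "- n" g] by (intro image_eqI[of _ _ "apow \<alpha> (- n) g"]) auto
  then have "g = 0" using U(3) by blast
  then have "cis (2 * pi * r) = 1" using g[of 0] by (simp add: w_def)
  then have "r \<in> \<int>" by (simp add: cis_2pi_eq_1_iff)
  then show False using r by (auto elim!: Ints_cases)
qed

end


section \<open>Power series with integer coefficients\<close>

text \<open>Gauss's lemma for power series: if \<open>i\<close> and \<open>j\<close> are the first
  indices where \<open>p\<close> fails to divide a coefficient of \<open>f\<close> and of
  \<open>S\<close>, it fails to divide coefficient \<open>i + j\<close> of the product.\<close>

lemma prime_dvd_fps_mult:
  fixes f :: "int poly" and S :: "int fps"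
  assumes "content f = 1" "prime p" "\<And>n. p dvd fps_nth (fps_of_poly f * S) n"
  shows "p dvd fps_nth S n"
proof (rule ccontr)
  assume "\<not> p dvd fps_nth S n"
  define j where "j = (LEAST j. \<not> p dvd fps_nth S j)"
  have j: "\<not> p dvd fps_nth S j" unfolding j_def by (rule LeastI[of _ n]) fact
  have j': "p dvd fps_nth S k" if "k < j" for k using not_less_Least[of k] that unfolding j_def by blast
  have "\<exists>i. \<not> p dvd coeff f i"
  proof (rule ccontr)
    assume "\<not> ?thesis"
    then have "[:p:] dvd f" by (simp add: const_poly_dvd_iff)
    then have "is_unit p" using assms(1) by (simp add: const_poly_dvd_iff_dvd_content)
    then show False using assms(2) not_prime_unit by blast
  qed
  then obtain i0 where i0: "\<not> p dvd coeff f i0" by blast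
  define i where "i = (LEAST i. \<not> p dvd coeff f i)"
  have i: "\<not> p dvd coeff f i" unfolding i_def by (rule LeastI[of _ i0]) fact
  have i': "p dvd coeff f k" if "k < i" for k using not_less_Least[of k] that unfolding i_def by blast
  have "fps_nth (fps_of_poly f * S) (i + j) = (\<Sum>k=0..i + j. coeff f k * fps_nth S (i + j - k))"
    by (simp add: fps_mult_nth)
  also have "\<dots> = coeff f i * fps_nth S j + (\<Sum>k\<in>{0..i + j} - {i}. coeff f k * fps_nth S (i + j - k))"
    by (subst sum.remove[of _ i]) auto
  finally have "coeff f i * fps_nth S j
    = fps_nth (fps_of_poly f * S) (i + j) - (\<Sum>k\<in>{0..i + j} - {i}. coeff f k * fps_nth S (i + j - k))"
    by simp
  moreover have "p dvd (\<Sum>k\<in>{0..i + j} - {i}. coeff f k * fps_nth S (i + j - k))"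
  proof (rule dvd_sum)
    fix k assume k: "k \<in> {0..i + j} - {i}"
    show "p dvd coeff f k * fps_nth S (i + j - k)"
    proof (cases "k < i")
      case True
      then show ?thesis using i' by simp
    next
      case False
      then have "i + j - k < j" using k by auto
      then show ?thesis using j' by simp
    qed
  qed
  ultimately have "p dvd coeff f i * fps_nth S j" using assms(3)[of "i + j"] by (simp only: dvd_diff)
  then show False using i j assms(2) by (simp add: prime_dvd_mult_iff)
qed

text \<open>The prime factors of \<open>c\<close> are cancelled one at a time, each dividing all of
  \<open>S\<close> by \<open>prime_dvd_fps_mult\<close>.\<close>

lemma fps_quotient_primitive:
  fixes f :: "int poly" and S :: "int fps"
  assumes "content f = 1" "c \<noteq> 0" "fps_of_poly f * S = fps_const c * T"
  shows "\<exists>S'. fps_of_poly f * S' = T"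
  using assms(2,3)
proof (induction c arbitrary: S rule: prime_divisors_induct)
  case (unit c)
  then obtain d where "c * d = 1" by (metis dvdE)
  then have "fps_of_poly f * (fps_const d * S) = T"
    using unit.prems(2) by (simp add: mult.left_commute flip: mult.assoc)
  then show ?case by blast
next
  case (factor p c)
  have "p dvd fps_nth S n" for n
    by (rule prime_dvd_fps_mult[OF assms(1) factor(1)]) (simp add: factor.prems(2))
  then have "\<forall>n. \<exists>d. fps_nth S n = p * d" by (simp add: dvd_def)
  from choice[OF this] obtain S' where "\<And>n. fps_nth S n = p * S' n" by blast
  then have S: "S = fps_const p * Abs_fps S'" by (simp add: fps_eq_iff)
  have "fps_const p * (fps_of_poly f * Abs_fps S') = fps_const p * (fps_const c * T)"
    using factor.prems(2) unfolding S by (simp add: mult.left_commute mult.assoc flip: fps_const_mult)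
  moreover have "fps_const p \<noteq> 0" using prime_gt_0_int[OF factor(1)] by simp
  ultimately have "fps_of_poly f * Abs_fps S' = fps_const c * T" by simp
  then show ?case using factor.IH factor.prems(1) by simp
qed simp

lemma primitive_dvd_smult:
  fixes Q R :: "int poly"
  assumes "content Q = 1" "c \<noteq> 0" "Q dvd smult c R" shows "Q dvd R"
proof -
  obtain D where D: "smult c R = Q * D" using assms(3) by (rule dvdE)
  then have "content (smult c R) = content D" using assms(1) by (simp add: content_mult)
  then have "c dvd content D" by (metis content_smult dvd_mult2 dvd_normalize_iff dvd_refl)
  then have "[:c:] dvd D" by (simp add: const_poly_dvd_iff_dvd_content)
  then obtain D' where "D = [:c:] * D'" by (rule dvdE)
  then have "smult c R = smult c (Q * D')" using D by simp
  then have "R = Q * D'" using assms(2) by (simp add: smult_cancel)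
  then show ?thesis by simp
qed

text \<open>Fatou's lemma on power series with integer coefficients. The polynomials \<open>P\<close> that are
  multiples of \<open>f\<close> in the ring of power series form an ideal, and by pseudo-division a primitive
  element of least degree divides all of them.\<close>

lemma Fatou_irreducible:
  fixes f P :: "int poly" and S :: "int fps"
  assumes cf: "content f = 1" and irr: "irreducible f" and eq: "fps_of_poly f * S = fps_of_poly P"
  shows "f dvd P \<or> is_unit (coeff f 0)"
proof -
  define I where "I P \<longleftrightarrow> (\<exists>S. fps_of_poly f * S = fps_of_poly P)" for P
  have If: "I f" unfolding I_def by (intro exI[of _ 1]) simp
  have f0: "f \<noteq> 0" using irr by auto
  then obtain Q0 where Q0: "I Q0 \<and> Q0 \<noteq> 0" and min0: "\<And>R. I R \<and> R \<noteq> 0 \<Longrightarrow> degree Q0 \<le> degree R"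
    using ex_has_least_nat[of "\<lambda>R. I R \<and> R \<noteq> 0" f degree] If by blast
  \<comment> \<open>The primitive part of a least element remains in \<open>I\<close> by
    \<open>fps_quotient_primitive\<close>; being primitive, it lets the constant \<open>c\<close> of
    the pseudo-division be cancelled.\<close>
  obtain Q where Q: "Q0 = smult (content Q0) Q" "content Q = 1" by (rule content_decompose)
  have cQ: "content Q0 \<noteq> 0" using Q0 by simp
  have degQ: "degree Q = degree Q0" by (subst Q(1)) (use cQ in simp)
  have Qnz: "Q \<noteq> 0" using Q(2) by auto
  obtain S0 where "fps_of_poly f * S0 = fps_of_poly Q0" using Q0 by (auto simp: I_def)
  then have "fps_of_poly f * S0 = fps_const (content Q0) * fps_of_poly Q"
    by (subst (asm) Q(1)) (simp add: fps_of_poly_smult)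
  from fps_quotient_primitive[OF cf cQ this] have IQ: "I Q" by (simp add: I_def)
  have div: "Q dvd R" if IR: "I R" for R
  proof -
    obtain D T where DT: "pseudo_divmod R Q = (D, T)" by fastforce
    define c where "c = coeff Q (degree Q) ^ (Suc (degree R) - degree Q)"
    have c0: "c \<noteq> 0" using Qnz by (simp add: c_def)
    have e: "smult c R = Q * D + T" and T: "T = 0 \<or> degree T < degree Q"
      using pseudo_divmod[OF Qnz DT] by (auto simp: c_def)
    obtain S1 where S1: "fps_of_poly f * S1 = fps_of_poly R" using IR by (auto simp: I_def)
    obtain S2 where S2: "fps_of_poly f * S2 = fps_of_poly Q" using IQ by (auto simp: I_def)
    have "T = smult c R - Q * D" using e by simp
    then have "fps_of_poly T = fps_const c * fps_of_poly R - fps_of_poly Q * fps_of_poly D"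
      by (simp add: fps_of_poly_smult fps_of_poly_mult fps_of_poly_diff)
    also have "\<dots> = fps_of_poly f * (fps_const c * S1 - S2 * fps_of_poly D)"
      by (simp add: S1[symmetric] S2[symmetric] algebra_simps)
    finally have "I T" unfolding I_def by metis
    then have "T = 0" using min0[of T] T degQ by fastforce
    then show ?thesis using e primitive_dvd_smult[OF Q(2) c0, of R] by (metis add.right_neutral dvd_triv_left)
  qed
  obtain H where H: "f = Q * H" using div[OF If] by (rule dvdE)
  from irreducibleD[OF irr H] show ?thesis
  proof
    \<comment> \<open>A unit among the multiples of \<open>f\<close> makes \<open>f\<close>
      invertible as a power series, which shows in the constant term.\<close>
    assume "is_unit Q"
    then obtain a where a: "Q = [:a:]" "is_unit a" by (auto simp: is_unit_poly_iff)
    obtain S2 where "fps_of_poly f * S2 = fps_of_poly Q" using IQ by (auto simp: I_def)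
    then have "fps_nth (fps_of_poly f * S2) 0 = a" by (simp add: a)
    then have "coeff f 0 * fps_nth S2 0 = a" by simp
    then show ?thesis using a(2) by (metis dvd_triv_left dvd_trans)
  next
    assume "is_unit H"
    then have "f dvd Q" using H by (metis dvd_refl mult_unit_dvd_iff)
    moreover have "Q dvd P" by (rule div) (use eq in \<open>auto simp: I_def\<close>)
    ultimately show ?thesis using dvd_trans by blast
  qed
qed

text \<open>The recurrence says that \<open>f\<close> times the generating function of
  \<open>s\<close> is a polynomial of degree below that of \<open>f\<close>. By Fatou's lemma
  \<open>f\<close> divides it, so it is zero.\<close>

lemma integer_recurrence_zero:
  fixes f :: "int poly" and s :: "nat \<Rightarrow> int"
  assumes cf: "content f = 1" and irr: "irreducible f" and nu: "\<not> is_unit (coeff f 0)"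
    and rec: "\<And>k. k \<ge> degree f \<Longrightarrow> (\<Sum>i\<le>degree f. coeff f i * s (k - i)) = 0"
  shows "s n = 0"
proof -
  define P where "P = Poly (map (fps_nth (fps_of_poly f * Abs_fps s)) [0..<degree f])"
  have f0: "f \<noteq> 0" using irr by auto
  have nth: "fps_nth (fps_of_poly f * Abs_fps s) k = 0" if "k \<ge> degree f" for k
  proof -
    have "fps_nth (fps_of_poly f * Abs_fps s) k = (\<Sum>i\<in>{0..k}. coeff f i * s (k - i))"
      by (simp add: fps_mult_nth)
    also have "\<dots> = (\<Sum>i\<le>degree f. coeff f i * s (k - i))"
      by (rule sum.mono_neutral_right) (use that in \<open>auto simp: coeff_eq_0\<close>)
    finally show ?thesis using rec[OF that] by simp
  qed
  have cP: "coeff P k = (if k < degree f then fps_nth (fps_of_poly f * Abs_fps s) k else 0)" for k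
    by (simp add: P_def nth_default_def)
  have eq: "fps_of_poly f * Abs_fps s = fps_of_poly P"
    by (rule fps_ext) (use nth cP in \<open>auto simp: not_less\<close>)
  have "P = 0"
  proof (rule ccontr)
    assume "P \<noteq> 0"
    moreover have "f dvd P" using Fatou_irreducible[OF cf irr eq] nu by simp
    ultimately have "degree f \<le> degree P" by (simp add: dvd_imp_degree_le)
    then have "lead_coeff P = 0" by (subst cP) simp
    then show False using \<open>P \<noteq> 0\<close> by simp
  qed
  then have "Abs_fps s = 0" using eq f0 by simp
  then show ?thesis by (metis fps_nth_Abs_fps fps_zero_nth)
qed

text \<open>Reversal is multiplicative, and it is an involution on polynomials with nonzero constant
  term, so factorisations correspond.\<close>

lemma irreducible_reflect_poly:
  fixes f :: "int poly"
  assumes irr: "irreducible f" and f0: "coeff f 0 \<noteq> 0" and deg: "degree f > 0"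
  shows "irreducible (reflect_poly f)"
proof (rule irreducibleI)
  show "reflect_poly f \<noteq> 0" using assms by auto
  show "\<not> is_unit (reflect_poly f)"
    using deg f0 by (auto simp: is_unit_poly_iff dest!: arg_cong[where f = degree])
  fix a b assume ab: "reflect_poly f = a * b"
  have "coeff (reflect_poly f) 0 \<noteq> 0" using irr by auto
  then have ab0: "coeff a 0 \<noteq> 0" "coeff b 0 \<noteq> 0" by (auto simp: ab coeff_mult_0)
  have "f = reflect_poly a * reflect_poly b"
    using f0 ab by (metis reflect_poly_mult reflect_poly_reflect_poly)
  then have "is_unit (reflect_poly a) \<or> is_unit (reflect_poly b)" by (rule irreducibleD[OF irr])
  moreover have "is_unit a" if a: "is_unit (reflect_poly a)" "coeff a 0 \<noteq> 0" for a :: "int poly"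
  proof -
    obtain c where c: "reflect_poly a = [:c:]" "is_unit c" using a(1) unfolding is_unit_poly_iff by blast
    then have "a = [:c:]" using a(2) by (metis reflect_poly_const reflect_poly_reflect_poly)
    then show ?thesis using c(2) by (simp add: is_unit_poly_iff)
  qed
  ultimately show "is_unit a \<or> is_unit b" using ab0 by blast
qed

lemma content_reflect_poly:
  fixes f :: "int poly"
  assumes "content f = 1" "coeff f 0 \<noteq> 0"
  shows "content (reflect_poly f) = 1"
proof -
  have "content (reflect_poly f) dvd coeff f i" for i
  proof (cases "i \<le> degree f")
    case True
    then have "coeff f i = coeff (reflect_poly f) (degree f - i)" by (simp add: coeff_reflect_poly)
    then show ?thesis by simp
  qed (simp add: coeff_eq_0)
  then have "[:content (reflect_poly f):] dvd f" by (simp add: const_poly_dvd_iff)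
  then have "content (reflect_poly f) dvd 1" using assms(1) by (metis const_poly_dvd_iff_dvd_content)
  then show ?thesis by (metis is_unit_normalize normalize_content)
qed


section \<open>Homoclinic points in the path component\<close>

text \<open>In reversed form \<open>f(\<sigma>)\<close> looks only backwards from index
  \<open>n + degree f\<close>, which is the shape of a product of power series.\<close>

lemma pact_reflect:
  fixes f :: "'b::comm_ring_1 poly"
  assumes "coeff f 0 \<noteq> 0"
  shows "pact f w n = (\<Sum>j\<le>degree (reflect_poly f). coeff (reflect_poly f) j * w (n + int (degree f) - int j))"
proof -
  have "degree (reflect_poly f) = degree f" using assms by simp
  moreover have "(\<Sum>j\<le>degree f. coeff (reflect_poly f) j * w (n + int (degree f) - int j))
      = (\<Sum>i\<le>degree f. coeff f i * w (n + int i))"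
    by (rule sum.reindex_bij_witness[of _ "\<lambda>i. degree f - i" "\<lambda>i. degree f - i"])
       (auto simp: coeff_reflect_poly of_nat_diff algebra_simps)
  ultimately show ?thesis by (simp add: pact_def)
qed

text \<open>A power series whose constant term is a unit is invertible over the integers. Its
  inverse applied to \<open>T\<close>, extended by zero to negative indices, solves the
  equation.\<close>

lemma causal_solution:
  fixes h :: "int poly" and T :: "int \<Rightarrow> int"
  assumes u: "is_unit (coeff h 0)" and T: "\<And>k. k < 0 \<Longrightarrow> T k = 0"
  shows "\<exists>S. \<forall>k. (\<Sum>i\<le>degree h. coeff h i * S (k - int i)) = T k"
proof -
  obtain y where y: "coeff h 0 * y = 1" using u by (metis dvdE)
  define R where "R = fps_right_inverse (fps_of_poly h) y * Abs_fps (\<lambda>k. T (int k))"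
  have "fps_of_poly h * fps_right_inverse (fps_of_poly h) y = 1"
    by (rule fps_right_inverse) (simp add: y)
  then have R: "fps_of_poly h * R = Abs_fps (\<lambda>k. T (int k))"
    unfolding R_def by (simp add: mult.assoc[symmetric])
  define S where "S j = (if j < 0 then 0 else fps_nth R (nat j))" for j
  have "(\<Sum>i\<le>degree h. coeff h i * S (k - int i)) = T k" for k
  proof (cases "k < 0")
    case True
    then show ?thesis by (simp add: S_def T)
  next
    case False
    define m where "m = nat k"
    have k: "k = int m" using False by (simp add: m_def)
    have "T k = fps_nth (fps_of_poly h * R) m" unfolding R by (simp add: k)
    also have "\<dots> = (\<Sum>i\<in>{0..m}. coeff h i * fps_nth R (m - i))" by (simp add: fps_mult_nth)
    also have "\<dots> = (\<Sum>i\<in>{0..m}. coeff h i * S (k - int i))"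
      by (rule sum.cong) (auto simp: S_def k nat_diff_distrib)
    also have "\<dots> = (\<Sum>i\<in>{0..m} \<union> {..degree h}. coeff h i * S (k - int i))"
      by (rule sum.mono_neutral_left) (auto simp: S_def k)
    also have "\<dots> = (\<Sum>i\<le>degree h. coeff h i * S (k - int i))"
      by (rule sum.mono_neutral_right) (auto simp: coeff_eq_0)
    finally show ?thesis ..
  qed
  then show ?thesis by blast
qed

lemma integer_solution:
  fixes f :: "int poly" and v :: "int \<Rightarrow> int"
  assumes f0: "coeff f 0 \<noteq> 0" and unit: "is_unit (lead_coeff f) \<or> is_unit (coeff f 0)"
    and v: "\<And>n. \<bar>n\<bar> \<ge> int N \<Longrightarrow> v n = 0"
  shows "\<exists>m. \<forall>n. pact f m n = v n"
  using unit
proof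
  assume u: "is_unit (lead_coeff f)"
  \<comment> \<open>\<open>N\<close> moves the support of \<open>v\<close> to nonnegative indices,
    and \<open>degree f\<close> matches the offset in \<open>pact_reflect\<close>.\<close>
  let ?c = "int (degree f) + int N"
  have "is_unit (coeff (reflect_poly f) 0)" using u by simp
  moreover have "v (k - ?c) = 0" if "k < 0" for k using that by (intro v) auto
  ultimately obtain S where S: "\<And>k. (\<Sum>i\<le>degree (reflect_poly f). coeff (reflect_poly f) i * S (k - int i)) = v (k - ?c)"
    using causal_solution[of "reflect_poly f" "\<lambda>k. v (k - ?c)"] by blast
  have "pact f (\<lambda>n. S (n + int N)) n = v n" for n
    using S[of "n + ?c"] unfolding pact_reflect[OF f0] by (simp add: algebra_simps)
  then show ?thesis by blast
next
  assume u: "is_unit (coeff f 0)"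
  have "v (int N - k) = 0" if "k < 0" for k using that by (intro v) auto
  with u obtain S where S: "\<And>k. (\<Sum>i\<le>degree f. coeff f i * S (k - int i)) = v (int N - k)"
    using causal_solution[of f "\<lambda>k. v (int N - k)"] by blast
  have "pact f (\<lambda>n. S (int N - n)) n = v n" for n
    using S[of "int N - n"] unfolding pact_def by (simp add: algebra_simps)
  then show ?thesis by blast
qed

text \<open>The right tail satisfies the recurrence of \<open>reflect_poly f\<close>, whose constant
  term is the leading coefficient of \<open>f\<close>; the left tail, read backwards, satisfies that
  of \<open>f\<close>. Each tail vanishes because its constant term is a nonunit.\<close>

lemma integer_solution_finite_support:
  fixes f :: "int poly" and m :: "int \<Rightarrow> int"
  assumes cf: "content f = 1" and irr: "irreducible f" and f0: "coeff f 0 \<noteq> 0" and deg: "degree f > 0"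
    and nu: "\<not> is_unit (lead_coeff f)" "\<not> is_unit (coeff f 0)"
    and rec: "\<And>n. \<bar>n\<bar> \<ge> int N \<Longrightarrow> pact f m n = 0" and n: "\<bar>n\<bar> \<ge> int N"
  shows "m n = 0"
proof (cases "n \<ge> 0")
  case True
  have dr: "degree (reflect_poly f) = degree f" using f0 by simp
  have "m (int N + int j) = 0" for j
  proof (rule integer_recurrence_zero[of "reflect_poly f" "\<lambda>j. m (int N + int j)"])
    show "content (reflect_poly f) = 1" by (rule content_reflect_poly[OF cf f0])
    show "irreducible (reflect_poly f)" by (rule irreducible_reflect_poly[OF irr f0 deg])
    show "\<not> is_unit (coeff (reflect_poly f) 0)" using nu by simp
    fix k assume k: "degree (reflect_poly f) \<le> k"
    have "(\<Sum>i\<le>degree (reflect_poly f). coeff (reflect_poly f) i * m (int N + int (k - i)))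
      = pact f m (int N + int k - int (degree f))"
      unfolding pact_reflect[OF f0]
      by (rule sum.cong) (use k in \<open>auto simp: of_nat_diff algebra_simps\<close>)
    also have "\<dots> = 0" by (rule rec) (use k dr in auto)
    finally show "(\<Sum>i\<le>degree (reflect_poly f). coeff (reflect_poly f) i * m (int N + int (k - i))) = 0" .
  qed
  from this[of "nat (n - int N)"] show ?thesis using True n by simp
next
  case False
  have "m (- int N - int j) = 0" for j
  proof (rule integer_recurrence_zero[OF cf irr nu(2), of "\<lambda>j. m (- int N - int j)"])
    fix k assume k: "degree f \<le> k"
    have "(\<Sum>i\<le>degree f. coeff f i * m (- int N - int (k - i))) = pact f m (- int N - int k)"
      unfolding pact_def by (rule sum.cong) (use k in \<open>auto simp: of_nat_diff algebra_simps\<close>)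
    also have "\<dots> = 0" by (rule rec) auto
    finally show "(\<Sum>i\<le>degree f. coeff f i * m (- int N - int (k - i))) = 0" .
  qed
  from this[of "nat (- n - int N)"] show ?thesis using False n by simp
qed

text \<open>\<open>f\<close> is not invertible as a Laurent polynomial. With support from
  \<open>b\<close> to \<open>a\<close>, the sequence \<open>f(\<sigma>) v\<close> is nonzero at
  \<open>a\<close> and at \<open>b - degree f\<close>. Both must be the index zero, against
  \<open>b \<le> a\<close>.\<close>

lemma no_finite_fundamental_solution:
  fixes f :: "int poly" and v :: "int \<Rightarrow> int"
  assumes f0: "coeff f 0 \<noteq> 0" and deg: "degree f > 0"
    and v: "\<And>n. \<bar>n\<bar> \<ge> int N \<Longrightarrow> v n = 0"
    and rec: "\<And>n. pact f v n = (if n = 0 then 1 else 0)"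
  shows False
proof -
  define A where "A = {n. v n \<noteq> 0}"
  have "A \<subseteq> {- int N..int N}" using v by (force simp: A_def)
  then have fin: "finite A" by (rule finite_subset) simp
  have ne: "A \<noteq> {}"
  proof
    assume "A = {}"
    then have "pact f v 0 = 0" by (simp add: A_def pact_def)
    then show False using rec[of 0] by simp
  qed
  define a where "a = Max A"
  define b where "b = Min A"
  have "a \<in> A" "b \<in> A" using fin ne by (simp_all add: a_def b_def)
  moreover have "n \<le> a" "b \<le> n" if "n \<in> A" for n using that fin by (simp_all add: a_def b_def)
  ultimately have a: "v a \<noteq> 0" "\<And>n. n > a \<Longrightarrow> v n = 0"
    and b: "v b \<noteq> 0" "\<And>n. n < b \<Longrightarrow> v n = 0" by (force simp: A_def)+
  have "pact f v a = coeff f 0 * v a"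
    unfolding pact_def by (subst sum.remove[of _ 0]) (auto simp: a(2))
  then have "a = 0" using rec[of a] a(1) f0 by (auto split: if_splits)
  have "pact f v (b - int (degree f)) = lead_coeff f * v b"
    unfolding pact_def by (subst sum.remove[of _ "degree f"]) (auto simp: b(2))
  moreover have "lead_coeff f \<noteq> 0" using f0 by auto
  ultimately have "b = int (degree f)" using rec[of "b - int (degree f)"] b(1) by (auto split: if_splits)
  then show False using a(2)[of b] b(1) \<open>a = 0\<close> deg by simp
qed

lemma degree_pos_of_primitive_irreducible:
  fixes f :: "int poly"
  assumes "content f = 1" "irreducible f" shows "degree f > 0"
proof (rule ccontr)
  assume "\<not> degree f > 0"
  then obtain c where c: "f = [:c:]" using degree_eq_zeroE by blast
  have "c \<noteq> 0" using assms(2) c by auto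
  then have "is_unit c" using assms(1) c by simp
  then have "is_unit f" using c is_unit_poly_iff by blast
  then show False using assms(2) irreducible_not_unit by blast
qed

context cyclic_system
begin

lemma homoclinic_subset_path_component:
  assumes f0: "coeff f 0 \<noteq> 0" and unit: "is_unit (lead_coeff f) \<or> is_unit (coeff f 0)"
  shows "homoclinic \<alpha> \<subseteq> path_component_set UNIV 0"
proof
  fix g assume "g \<in> homoclinic \<alpha>"
  then obtain u :: "int \<Rightarrow> real" where u: "vanishing u" "\<And>n. coord n g = cis (2 * pi * u n)"
    by (rule homoclinic_lift) blast
  obtain v :: "int \<Rightarrow> int" and N :: nat where v: "\<And>n. pact (map_poly of_int f) u n = of_int (v n)"
    "\<And>n. \<bar>n\<bar> \<ge> int N \<Longrightarrow> v n = 0"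
    using vanishing_Ints_finite_support[OF vanishing_pact[OF u(1)] coord_lift_Ints[OF u(2)]] by blast
  obtain m where m: "\<And>n. pact f m n = - v n"
    using integer_solution[OF f0 unit, of N "\<lambda>n. - v n"] v(2) by auto
  show "g \<in> path_component_set UNIV 0"
  proof (rule solution_imp_path_component)
    show "pact (map_poly of_int f) (\<lambda>n. u n + of_int (m n)) n = 0" for n
      by (simp add: pact_seq_add pact_of_int v m)
    show "coord n g = cis (2 * pi * (u n + of_int (m n)))" for n
      by (simp add: u(2) distrib_left cis_mult[symmetric])
  qed
qed

lemma homoclinic_path_component_imp_unit:
  assumes ex: "expansive \<alpha>" and cf: "content f = 1" and irr: "irreducible f" and f0: "coeff f 0 \<noteq> 0"
    and g: "g \<in> homoclinic \<alpha>" "g \<in> path_component_set UNIV 0" "g \<noteq> 0"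
  shows "is_unit (lead_coeff f) \<or> is_unit (coeff f 0)"
proof (rule ccontr)
  assume nu: "\<not> ?thesis"
  have deg: "degree f > 0" by (rule degree_pos_of_primitive_irreducible[OF cf irr])
  obtain u :: "int \<Rightarrow> real" where u: "vanishing u" "\<And>n. coord n g = cis (2 * pi * u n)"
    using g(1) by (rule homoclinic_lift) blast
  obtain w :: "int \<Rightarrow> real" where w: "\<And>n. pact (map_poly of_int f) w n = 0" "\<And>n. coord n g = cis (2 * pi * w n)"
    using g(2) by (rule path_component_imp_solution) blast
  obtain v :: "int \<Rightarrow> int" and N :: nat where v: "\<And>n. pact (map_poly of_int f) u n = of_int (v n)"
    "\<And>n. \<bar>n\<bar> \<ge> int N \<Longrightarrow> v n = 0"
    using vanishing_Ints_finite_support[OF vanishing_pact[OF u(1)] coord_lift_Ints[OF u(2)]] by blast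
  \<comment> \<open>Two lifts of the same point differ by integers, so the floor is exact.\<close>
  define m where "m n = \<lfloor>w n - u n\<rfloor>" for n
  have "w n - u n \<in> \<int>" for n
  proof -
    have "cis (2 * pi * (w n - u n)) = 1"
      using u(2)[of n] w(2)[of n] by (simp add: right_diff_distrib cis_divide[symmetric])
    then show ?thesis by (simp add: cis_2pi_eq_1_iff)
  qed
  then have m: "w n = u n + of_int (m n)" for n unfolding m_def by (auto elim: Ints_cases)
  have "of_int (pact f m n) = (- of_int (v n) :: real)" for n
  proof -
    have "w = (\<lambda>n. u n + of_int (m n))" using m by (rule ext)
    then have "0 = pact (map_poly of_int f) (\<lambda>n. u n + of_int (m n)) n" using w(1)[of n] by simp
    then show ?thesis by (simp add: pact_seq_add pact_of_int v)
  qed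
  then have "pact f m n = - v n" for n by (metis of_int_eq_iff of_int_minus)
  then have "m n = 0" if "\<bar>n\<bar> \<ge> int N" for n
    using integer_solution_finite_support[OF cf irr f0 deg _ _ _ that] nu v(2) by simp
  \<comment> \<open>The lift \<open>w\<close> came from a path without any bound uniform in
    \<open>n\<close>. Now it is bounded, as the sum of \<open>u\<close> and a finitely supported
    sequence.\<close>
  then have "vanishing (\<lambda>n. real_of_int (m n))" unfolding vanishing_def by (metis norm_zero of_int_0)
  then obtain B1 where B1: "\<And>n. norm (real_of_int (m n)) \<le> B1" using vanishing_bounded by blast
  obtain B2 where B2: "\<And>n. norm (u n) \<le> B2" using vanishing_bounded[OF u(1)] by blast
  have bd: "norm (complex_of_real (w n)) \<le> B1 + B2" for n
    using B1[of n] B2[of n] unfolding m[of n] norm_of_real by simp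
  have "complex_of_real (w n) = 0" for n
  proof (rule bounded_solution_unique[OF _ _ bd])
    show "map_poly complex_of_int f \<noteq> 0" using deg degree_of_int_poly[of f] by (metis degree_0 less_numeral_extra(3))
    show "norm z \<noteq> 1" if "poly (map_poly complex_of_int f) z = 0" for z
      using expansive_imp_hyperbolic[OF ex that] .
    show "pact (map_poly complex_of_int f) (\<lambda>n. complex_of_real (w n)) n = 0" for n
      by (simp add: pact_of_real w(1))
  qed
  then have "coord n g = 1" for n using w(2)[of n] by simp
  then show False using coord_eq_1_imp_0 g(3) by blast
qed

text \<open>The point is lifted by the decaying fundamental solution \<open>u\<close>. Were the
  point zero, \<open>u\<close> would be integral and vanishing, hence finitely supported, and would
  invert \<open>f\<close> among Laurent polynomials.\<close>

lemma homoclinic_nontrivial: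
  assumes ex: "expansive \<alpha>" and f0: "coeff f 0 \<noteq> 0" and deg: "degree f > 0"
  obtains g where "g \<in> homoclinic \<alpha>" "g \<noteq> 0"
proof -
  define \<delta> :: "int \<Rightarrow> complex" where "\<delta> n = (if n = 0 then 1 else 0)" for n
  have "decaying \<delta>" unfolding decaying_def \<delta>_def by (intro exI[of _ 1] exI[of _ "1/2"]) auto
  moreover have "map_poly complex_of_int f \<noteq> 0" using deg degree_of_int_poly[of f] by (metis degree_0 less_numeral_extra(3))
  ultimately obtain w where w: "decaying w" "\<And>n. pact (map_poly of_int f) w n = \<delta> n"
    using decaying_solution[of "map_poly of_int f" \<delta>] expansive_imp_hyperbolic[OF ex] by blast
  define u where "u n = Re (w n)" for n
  have pu: "pact (map_poly of_int f) u n = (if n = 0 then 1 else 0)" for n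
    unfolding u_def by (simp add: pact_Re w(2) \<delta>_def)
  have vu: "vanishing u"
    using decaying_imp_vanishing[OF w(1)] unfolding vanishing_iff u_def using tendsto_Re by fastforce
  have "pact (map_poly of_int f) u n \<in> \<int>" for n by (simp add: pu)
  then obtain g where g: "\<And>n. coord n g = cis (2 * pi * u n)" using coord_surj[of u] by blast
  have "vanishing (\<lambda>n. coord n g - 1)"
  proof -
    have "(\<lambda>n. cis (2 * pi * x n) - 1) \<longlonglongrightarrow> cis (2 * pi * 0) - 1" if "x \<longlonglongrightarrow> 0" for x :: "nat \<Rightarrow> real"
      by (intro tendsto_intros that)
    then show ?thesis using vu unfolding vanishing_iff g by simp
  qed
  then have "g \<in> homoclinic \<alpha>" by (simp add: homoclinic_iff)
  moreover have "g \<noteq> 0"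
  proof
    assume "g = 0"
    then have "u n \<in> \<int>" for n using g[of n] cis_2pi_eq_1_iff by simp
    then obtain v :: "int \<Rightarrow> int" and N :: nat where v: "\<And>n. u n = of_int (v n)" "\<And>n. \<bar>n\<bar> \<ge> int N \<Longrightarrow> v n = 0"
      using vanishing_Ints_finite_support[OF vu] by blast
    have "u = (\<lambda>n. of_int (v n))" using v(1) by auto
    then have "real_of_int (pact f v n) = of_int (if n = 0 then 1 else 0)" for n
      using pu[of n] by (simp add: pact_of_int)
    then have rec: "pact f v n = (if n = 0 then 1 else 0)" for n using of_int_eq_iff by blast
    show False by (rule no_finite_fundamental_solution[of f N v]) (use f0 deg v(2) rec in auto)
  qed
  ultimately show ?thesis by (rule that)
qed

lemma zero_mem_homoclinic: "0 \<in> homoclinic \<alpha>"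
  by (simp add: homoclinic_def)

end

theorem mainTheorem14:
  fixes \<alpha> :: "'a::{topological_ab_group_add, t2_space} \<Rightarrow> 'a"
    and f :: "int poly"
  assumes "compact (UNIV :: 'a set)" and "connected (UNIV :: 'a set)"
    and "cont_aut \<alpha>" and "expansive \<alpha>"
    and "cyclic_with_poly \<alpha> f"
    and "content f = 1" and "coeff f 0 \<noteq> 0" and "lead_coeff f > 0"
    and "irreducible f"
  shows "(homoclinic \<alpha> \<inter> path_component_set UNIV 0 \<noteq> {0}
            \<longleftrightarrow> homoclinic \<alpha> \<subseteq> path_component_set UNIV 0)
       \<and> (homoclinic \<alpha> \<subseteq> path_component_set UNIV 0
            \<longleftrightarrow> (lead_coeff f = 1 \<or> lead_coeff f = -1 \<or> coeff f 0 = 1 \<or> coeff f 0 = -1))"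
proof -
  obtain \<kappa> where \<kappa>: "is_char \<kappa>" "\<And>\<psi>. is_char \<psi> \<Longrightarrow> \<exists>p k. \<psi> = lact \<alpha> p k \<kappa>"
    "\<And>p. lact \<alpha> p 0 \<kappa> = (\<lambda>_. 1) \<longleftrightarrow> f dvd p"
    using assms(5) unfolding cyclic_with_poly_def by blast
  interpret cyclic_system "TYPE('a)" \<alpha> f \<kappa>
    by unfold_locales (use assms(1,3) \<kappa> in auto)
  define \<Omega> where "\<Omega> = homoclinic \<alpha>"
  define \<Gamma>\<^sub>0 where "\<Gamma>\<^sub>0 = path_component_set (UNIV :: 'a set) 0"
  let ?C = "lead_coeff f = 1 \<or> lead_coeff f = -1 \<or> coeff f 0 = 1 \<or> coeff f 0 = -1"
  have unit: "is_unit c \<longleftrightarrow> c = 1 \<or> c = -1" for c :: int by (auto simp: abs_if split: if_splits)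
  have deg: "degree f > 0"
    by (rule degree_pos_of_primitive_irreducible[OF assms(6,9)])
  have "0 \<in> \<Omega> \<inter> \<Gamma>\<^sub>0"
    by (simp add: \<Omega>_def \<Gamma>\<^sub>0_def zero_mem_homoclinic path_component_refl)
  have 32: "\<Omega> \<subseteq> \<Gamma>\<^sub>0" if ?C
    using homoclinic_subset_path_component[OF assms(7)] that by (auto simp: \<Omega>_def \<Gamma>\<^sub>0_def unit)
  have 21: "\<Omega> \<inter> \<Gamma>\<^sub>0 \<noteq> {0}" if "\<Omega> \<subseteq> \<Gamma>\<^sub>0"
  proof -
    obtain g where "g \<in> homoclinic \<alpha>" "g \<noteq> 0"
      by (rule homoclinic_nontrivial[OF assms(4,7) deg])
    with that show ?thesis unfolding \<Omega>_def by blast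
  qed
  have 13: ?C if ne: "\<Omega> \<inter> \<Gamma>\<^sub>0 \<noteq> {0}"
  proof -
    obtain g where "g \<in> \<Omega>" "g \<in> \<Gamma>\<^sub>0" "g \<noteq> 0"
      using ne \<open>0 \<in> \<Omega> \<inter> \<Gamma>\<^sub>0\<close> by blast
    then have "is_unit (lead_coeff f) \<or> is_unit (coeff f 0)"
      unfolding \<Omega>_def \<Gamma>\<^sub>0_def
      by (rule homoclinic_path_component_imp_unit[OF assms(4,6,9,7)])
    then show ?thesis by (simp only: unit) blast
  qed
  show ?thesis using 32 21 13 unfolding \<Omega>_def[symmetric] \<Gamma>\<^sub>0_def[symmetric] by blast
qed

end
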